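(* Let $z>0$ and let $(a_i)_{i\ge1}$, $(b_i)_{i\ge2}$ be sequences of positive numbers such that $$\lim_{i\to\infty} \frac{b_i}{a_i}=z_s>0,\qquad \lim_{i\to\infty}\frac{b_{i+1}}{b_i}=1,$$ $$\frac{b_{i+1}}{b_i}-1=O(i^{-1}),\qquad \frac{a_{i+1}}{a_i}-1=O(i^{-1}),\qquad a_i=O(i),\qquad \lim_{i\to\infty}a_i=+\infty .$$ Let $\Pi^{\mathrm{in}}$ be a probability distribution on $\mathcal E$ such that $\mathbf E_{\Pi^{\mathrm{in}}}\big[\langle C,\sqrt{\mathbf Q}\rangle_H\big]<\infty$. Let $\mathbf C(t)=(C_2(t),C_3(t),\ldots)$ be the Becker–Döring process and let $\lambda>0$ be the spectral constant defined in the context. (1) (Sub-critical case.) If $z<z_s$, then for all $t\ge0$, $$\big\|\mathbf P_{\Pi^{\mathrm{in}}}\{\mathbf C(t)\in\cdot\}-\Pi^{\mathrm{eq}}\big\|\le R^{\mathrm{in}}e^{-\lambda t},\qquad R^{\mathrm{in}}=K\Big(\mathbf E_{\Pi^{\mathrm{in}}}\big[\langle C,\sqrt{\mathbf Q}\rangle_H\big]+\mathbf E_{\Pi^{\mathrm{eq}}}\big[\langle C,\sqrt{\mathbf Q}\rangle_H\big]\Big),$$ where $K=\big(\sum_{i=2}^\infty Q_iz^i\big)^{1/2}$. (2) (Super-critical case.) If $z>z_s$, then for all $t\ge0$ and all $n\ge2$, $$\Big\|\mathbf P_{\Pi^{\mathrm{in}}}\{(C_2(t),\ldots,C_n(t))\in\cdot\}-\Pi^{\mathrm{stat}}\Big(\cdot\times\prod_{k=n+1}^\infty\mathbb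 N_0\Big)\Big\|\le R^{\mathrm{in}}_n e^{-\lambda t},\qquad R_n^{\mathrm{in}}=K_n\Big(\mathbf E_{\Pi^{\mathrm{in}}}\big[\langle C,\sqrt{\mathbf Q}\rangle_H\big]+\|\mathbf f\|_H\Big),$$ where $K_n=\big(\sum_{i=2}^n Q_iz^i\big)^{1/2}$.
   Context: Notation: $\mathbb N_0=\{0,1,2,\ldots\}$, $\mathbb N_m=\{m,m+1,\ldots\}$. $\mathcal E=\ell^1(\mathbb N_2,\mathbb N_0)$ is the countable set of summable (hence finitely supported) $\mathbb N_0$-valued sequences $C=(C_2,C_3,\ldots)$. $\|\mu-\nu\|=\frac12\sum_x|\mu(x)-\nu(x)|$ is the total variation distance between probability measures on a countable set. Becker–Döring (BD) process: the continuous-time Markov chain $\mathbf C(t)=(C_2(t),C_3(t),\ldots)$ on $\mathcal E$ with generator $$\mathcal A\psi(C)=\sum_{i=1}^\infty\Big(a_izC_i[\psi(C+\Delta_i)-\psi(C)]+b_{i+1}C_{i+1}[\psi(C-\Delta_i)-\psi(C)]\Big),$$ with the convention $C_1=z$, and $\Delta_1=\mathbf e_2$, $\Delta_i=\mathbf e_{i+1}-\mathbf e_i$ for $i\ge2$, where $\mathbf e_2,\mathbf e_3,\ldots$ is the canonical basis. It is non-explosive under the hypotheses considered ($z\ne z_s$). $\mathbf P_{\Pi}$ is its law when $\mathbf C(0)\sim\Pi$. For a function $h$ on $\mathcal E$, $\mathbf E_\Pi[h(C)]=\sum_{C\in\mathcal E}h(C)\Pi(C)$. Coefficients: $Q_1=1$,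 $Q_i=\dfrac{a_1a_2\cdots a_{i-1}}{b_2\cdots b_i}$ for $i\ge2$. For $z<z_s$, $\sum_{i\ge 2} Q_iz^i<\infty$; for $z>z_s$, $\sum_{k\ge 1} 1/(a_kQ_kz^{k+1})<\infty$. $H$ is the Hilbert space of real sequences $\mathbf x=(x_2,x_3,\ldots)$ with $\|\mathbf x\|_H^2=\sum_{i\ge2}x_i^2/(Q_iz^i)<\infty$, with scalar product $\langle \mathbf x,\mathbf y\rangle_H=\sum_{i\ge2}x_iy_i/(Q_iz^i)$. $\sqrt{\mathbf Q}=(\sqrt{Q_iz^i})_{i\ge2}$, so that $\langle C,\sqrt{\mathbf Q}\rangle_H=\sum_{i\ge2}C_i/\sqrt{Q_iz^i}$ (a finite sum for $C\in\mathcal E$). Constant $\lambda$: let $X$ be the continuous-time Markov chain on $\mathbb N_1$ with nonzero rates $q_{i,i+1}=a_iz$, $q_{i,i-1}=b_i$, $q_{i,i}=-(a_iz+b_i)$ for $i\ge2$ (state $1$ is absorbing), and $p_{ij}(t)=\mathbf P\{X(t)=j\mid X(0)=i\}$. It is known (Kreer, 1993) that, under the hypotheses on $(a_i),(b_i)$ above and $z\neq z_s$, the infinite matrix $(q_{i,j})_{i,j\ge2}$, acting on row sequences by $\mathbf x\mapsto(\sum_{i\ge2}x_iq_{i,j})_{j\ge2}$, is self-adjoint on $H$ and has a negative maximum eigenvalue, denoted $-\lambda$ ($\lambda>0$), and that $\|(p_{ij}(t))_{j\ge2}\|_H\le e^{-\lambda t}/\sqrt{Q_iz^i}$ for all $i\ge2$,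 $t\ge0$. Measures: for $z<z_s$, $\Pi^{\mathrm{eq}}(C)=\prod_{i=2}^\infty e^{-c_i^{\mathrm{eq}}}\dfrac{(c_i^{\mathrm{eq}})^{C_i}}{C_i!}$ with $c_i^{\mathrm{eq}}=Q_iz^i$, a probability measure on $\mathcal E$. For $z>z_s$, $\Pi^{\mathrm{stat}}$ is the product over $i\ge2$ of the Poisson distributions on $\mathbb N_0$ with means $$f_i=JQ_iz^i\sum_{k=i}^\infty\frac1{a_kQ_kz^{k+1}},\qquad J=\Big(\sum_{k=1}^\infty\frac1{a_kQ_kz^{k+1}}\Big)^{-1},$$ so $\Pi^{\mathrm{stat}}(\cdot\times\prod_{k\ge n+1}\mathbb N_0)$ is its marginal on coordinates $2,\ldots,n$. $\mathbf f=(f_i)_{i\ge2}$, which belongs to $H$ for $z>z_s$. *)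

theory Defs
  imports "HOL-Probability.Probability" "HOL-Library.Landau_Symbols"
begin

section \<open>Continuous-time Markov chains on a countable set\<close>

text \<open>Honest transition functions: each \<open>P t x\<close> has total mass 1, so the chain stays in \<open>S\<close>
  for all times (non-explosion).\<close>

definition transition_function :: "'s set \<Rightarrow> (real \<Rightarrow> 's \<Rightarrow> 's \<Rightarrow> real) \<Rightarrow> bool" where
  "transition_function S P \<longleftrightarrow>
     (\<forall>t\<ge>0. \<forall>x\<in>S. (\<forall>y\<in>S. 0 \<le> P t x y) \<and> (P t x has_sum 1) S) \<and>
     (\<forall>x\<in>S. \<forall>y\<in>S. P 0 x y = (if x = y then 1 else 0)) \<and>
     (\<forall>s\<ge>0. \<forall>t\<ge>0. \<forall>x\<in>S. \<forall>y\<in>S. ((\<lambda>u. P s x u * P t u y) has_sum P (s + t) x y) S)"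

text \<open>\<open>L\<close> is the (pointwise) generator on bounded functions: \<open>P\<^sub>t \<psi> (x) = \<psi> x + t L \<psi> x + o(t)\<close>
  as \<open>t \<down> 0\<close>. For \<open>\<psi>\<close> the indicator of a point this says that the transition rates of the
  chain are the off-diagonal matrix elements of \<open>L\<close>.\<close>

definition has_generator ::
  "'s set \<Rightarrow> (real \<Rightarrow> 's \<Rightarrow> 's \<Rightarrow> real) \<Rightarrow> (('s \<Rightarrow> real) \<Rightarrow> 's \<Rightarrow> real) \<Rightarrow> bool" where
  "has_generator S P L \<longleftrightarrow>
     (\<forall>\<psi>. bounded (\<psi> ` S) \<longrightarrow>
        (\<forall>x\<in>S. ((\<lambda>t. \<Sum>\<^sub>\<infinity>y\<in>S. P t x y * \<psi> y) has_real_derivative L \<psi> x) (at_right 0)))"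

text \<open>The Markov property is expressed through the finite-dimensional distributions. No regularity
  of the paths is required; the law of the chain does not depend on the choice of a version.\<close>

definition markov_chain ::
  "'w measure \<Rightarrow> 's set \<Rightarrow> (('s \<Rightarrow> real) \<Rightarrow> 's \<Rightarrow> real) \<Rightarrow> (real \<Rightarrow> 'w \<Rightarrow> 's) \<Rightarrow> bool" where
  "markov_chain M S L X \<longleftrightarrow>
     prob_space M \<and>
     (\<forall>t\<ge>0. X t \<in> measurable M (count_space S)) \<and>
     (\<exists>P. transition_function S P \<and> has_generator S P L \<and>
        (\<forall>(n::nat) (t :: nat \<Rightarrow> real) (x :: nat \<Rightarrow> 's).
           t 0 = 0 \<longrightarrow> (\<forall>k<n. t k \<le> t (Suc k)) \<longrightarrow> (\<forall>k\<le>n. x k \<in> S) \<longrightarrow>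
           measure M {\<omega> \<in> space M. \<forall>k\<le>n. X (t k) \<omega> = x k} =
             measure M {\<omega> \<in> space M. X 0 \<omega> = x 0} *
               (\<Prod>k<n. P (t (Suc k) - t k) (x k) (x (Suc k)))))"

text \<open>Total variation distance and expectation on a countable set, for measures given by
  their point masses.\<close>

definition tv_dist :: "'s set \<Rightarrow> ('s \<Rightarrow> real) \<Rightarrow> ('s \<Rightarrow> real) \<Rightarrow> real" where
  "tv_dist S \<mu> \<nu> = (1 / 2) * (\<Sum>\<^sub>\<infinity>x\<in>S. \<bar>\<mu> x - \<nu> x\<bar>)"

definition expect :: "'s set \<Rightarrow> ('s \<Rightarrow> real) \<Rightarrow> ('s \<Rightarrow> real) \<Rightarrow> real" where
  "expect S \<mu> h = (\<Sum>\<^sub>\<infinity>x\<in>S. h x * \<mu> x)"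

section \<open>The Becker--Doering process\<close>

text \<open>A sequence indexed by \<open>{2, 3, \<dots>}\<close> is a function on \<open>nat\<close>; real sequences are only evaluated
  on \<open>{2..}\<close>, while a state vanishes at 0 and 1 so that equality of states is equality of
  functions. Likewise \<open>a 0\<close>, \<open>b 0\<close> and \<open>b 1\<close> are never used.\<close>

definition BD_states :: "(nat \<Rightarrow> nat) set" where
  "BD_states = {C. C 0 = 0 \<and> C 1 = 0 \<and> finite {i. C i \<noteq> 0}}"

text \<open>The convention \<open>C\<^sub>1 = z\<close>.\<close>

definition BD_conc :: "real \<Rightarrow> (nat \<Rightarrow> nat) \<Rightarrow> nat \<Rightarrow> real" where
  "BD_conc z C i = (if i = 1 then z else real (C i))"

definition unit_seq :: "nat \<Rightarrow> nat \<Rightarrow> int" where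
  "unit_seq i j = (if j = i then 1 else 0)"

definition BD_jump :: "nat \<Rightarrow> nat \<Rightarrow> int" where
  "BD_jump i j = (if i = 1 then unit_seq 2 j else unit_seq (i + 1) j - unit_seq i j)"

text \<open>Truncation of negative entries by \<open>nat\<close> only occurs for jumps whose rate is zero.\<close>

definition add_jump :: "(nat \<Rightarrow> nat) \<Rightarrow> (nat \<Rightarrow> int) \<Rightarrow> nat \<Rightarrow> nat" where
  "add_jump C d = (\<lambda>j. nat (int (C j) + d j))"

definition BD_generator ::
  "(nat \<Rightarrow> real) \<Rightarrow> (nat \<Rightarrow> real) \<Rightarrow> real \<Rightarrow> ((nat \<Rightarrow> nat) \<Rightarrow> real) \<Rightarrow> (nat \<Rightarrow> nat) \<Rightarrow> real" where
  "BD_generator a b z \<psi> C =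
     (\<Sum>\<^sub>\<infinity>i\<in>{1..}.
        a i * z * BD_conc z C i * (\<psi> (add_jump C (BD_jump i)) - \<psi> C) +
        b (i + 1) * BD_conc z C (i + 1) * (\<psi> (add_jump C (\<lambda>j. - BD_jump i j)) - \<psi> C))"

definition BD_process ::
  "(nat \<Rightarrow> real) \<Rightarrow> (nat \<Rightarrow> real) \<Rightarrow> real \<Rightarrow> 'w measure \<Rightarrow> (real \<Rightarrow> 'w \<Rightarrow> nat \<Rightarrow> nat) \<Rightarrow> bool" where
  "BD_process a b z M C \<longleftrightarrow> markov_chain M BD_states (BD_generator a b z) C"

section \<open>The Hilbert space \<open>H\<close> and the spectral constant\<close>

definition BD_Q :: "(nat \<Rightarrow> real) \<Rightarrow> (nat \<Rightarrow> real) \<Rightarrow> nat \<Rightarrow> real" where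
  "BD_Q a b i = (\<Prod>k\<in>{1..<i}. a k) / (\<Prod>k\<in>{2..i}. b k)"

definition in_H :: "(nat \<Rightarrow> real) \<Rightarrow> (nat \<Rightarrow> real) \<Rightarrow> real \<Rightarrow> (nat \<Rightarrow> real) \<Rightarrow> bool" where
  "in_H a b z x \<longleftrightarrow> (\<lambda>i. (x i)\<^sup>2 / (BD_Q a b i * z ^ i)) summable_on {2..}"

definition inner_H ::
  "(nat \<Rightarrow> real) \<Rightarrow> (nat \<Rightarrow> real) \<Rightarrow> real \<Rightarrow> (nat \<Rightarrow> real) \<Rightarrow> (nat \<Rightarrow> real) \<Rightarrow> real" where
  "inner_H a b z x y = (\<Sum>\<^sub>\<infinity>i\<in>{2..}. x i * y i / (BD_Q a b i * z ^ i))"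

definition norm_H :: "(nat \<Rightarrow> real) \<Rightarrow> (nat \<Rightarrow> real) \<Rightarrow> real \<Rightarrow> (nat \<Rightarrow> real) \<Rightarrow> real" where
  "norm_H a b z x = sqrt (\<Sum>\<^sub>\<infinity>i\<in>{2..}. (x i)\<^sup>2 / (BD_Q a b i * z ^ i))"

definition sqrt_Q :: "(nat \<Rightarrow> real) \<Rightarrow> (nat \<Rightarrow> real) \<Rightarrow> real \<Rightarrow> nat \<Rightarrow> real" where
  "sqrt_Q a b z i = sqrt (BD_Q a b i * z ^ i)"

text \<open>Rates \<open>q\<^sub>i\<^sub>j\<close> of the birth-and-death chain \<open>X\<close>, with state 1 absorbing.\<close>

definition BD_rate :: "(nat \<Rightarrow> real) \<Rightarrow> (nat \<Rightarrow> real) \<Rightarrow> real \<Rightarrow> nat \<Rightarrow> nat \<Rightarrow> real" where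
  "BD_rate a b z i j =
     (if i < 2 then 0
      else if j = i + 1 then a i * z
      else if j + 1 = i then b i
      else if j = i then - (a i * z + b i)
      else 0)"

text \<open>Each sum below has at most three nonzero terms, so the matrix acts on all sequences;
  as an operator on \<open>H\<close> it has the maximal domain of those \<open>x\<close> in \<open>H\<close> whose image is in \<open>H\<close>,
  and an eigenvector automatically belongs to it.\<close>

definition BD_eigenvalue :: "(nat \<Rightarrow> real) \<Rightarrow> (nat \<Rightarrow> real) \<Rightarrow> real \<Rightarrow> real \<Rightarrow> bool" where
  "BD_eigenvalue a b z \<mu> \<longleftrightarrow>
     (\<exists>x. in_H a b z x \<and> (\<exists>i\<ge>2. x i \<noteq> 0) \<and>
        (\<forall>j\<ge>2. (\<Sum>\<^sub>\<infinity>i\<in>{2..}. x i * BD_rate a b z i j) = \<mu> * x j))"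

definition BD_spectral_constant :: "(nat \<Rightarrow> real) \<Rightarrow> (nat \<Rightarrow> real) \<Rightarrow> real \<Rightarrow> real \<Rightarrow> bool" where
  "BD_spectral_constant a b z l \<longleftrightarrow>
     0 < l \<and> BD_eigenvalue a b z (- l) \<and> (\<forall>\<mu>. BD_eigenvalue a b z \<mu> \<longrightarrow> \<mu> \<le> - l)"

section \<open>Equilibrium and stationary measures\<close>

text \<open>Point masses of \<open>\<Pi>\<^sup>e\<^sup>q\<close>; the product over \<open>i \<ge> 2\<close> is indexed by \<open>i - 2\<close>.\<close>

definition BD_eq :: "(nat \<Rightarrow> real) \<Rightarrow> (nat \<Rightarrow> real) \<Rightarrow> real \<Rightarrow> (nat \<Rightarrow> nat) \<Rightarrow> real" where
  "BD_eq a b z C =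
     prodinf (\<lambda>i. exp (- (BD_Q a b (i + 2) * z ^ (i + 2))) *
                  (BD_Q a b (i + 2) * z ^ (i + 2)) ^ C (i + 2) / fact (C (i + 2)))"

definition BD_J :: "(nat \<Rightarrow> real) \<Rightarrow> (nat \<Rightarrow> real) \<Rightarrow> real \<Rightarrow> real" where
  "BD_J a b z = inverse (\<Sum>\<^sub>\<infinity>k\<in>{1..}. 1 / (a k * BD_Q a b k * z ^ (k + 1)))"

definition BD_f :: "(nat \<Rightarrow> real) \<Rightarrow> (nat \<Rightarrow> real) \<Rightarrow> real \<Rightarrow> nat \<Rightarrow> real" where
  "BD_f a b z i =
     BD_J a b z * BD_Q a b i * z ^ i * (\<Sum>\<^sub>\<infinity>k\<in>{i..}. 1 / (a k * BD_Q a b k * z ^ (k + 1)))"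

text \<open>\<open>\<Pi>\<^sup>s\<^sup>t\<^sup>a\<^sup>t\<close> lives on all sequences of natural numbers, not on \<open>BD_states\<close>.\<close>

definition BD_stat :: "(nat \<Rightarrow> real) \<Rightarrow> (nat \<Rightarrow> real) \<Rightarrow> real \<Rightarrow> (nat \<Rightarrow> nat) measure" where
  "BD_stat a b z = PiM {2..} (\<lambda>i. measure_pmf (poisson_pmf (BD_f a b z i)))"

end

theory Submission
  imports Defs
begin

text \<open>The clusters of size at least 2 do not interact with each other, and every bound below exploits this
through the sensitivity of the process to one additional cluster. Let \<open>w t x\<close> be the probability,
for the process started in the configuration \<open>x\<close>, that an event occurs at time \<open>t\<close>, and let
\<open>diff_cl (w t) i x\<close> be the change of this probability when a cluster of size \<open>i\<close> is added to \<open>x\<close>.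
The backward equation for \<open>w\<close> shows that \<open>diff_cl (w t) i x\<close> solves the backward equation of the pair
consisting of the process and of an independent tagged cluster that moves like the birth-and-death
chain \<open>X\<close> and is killed at size 1 (\<open>gen_diff_cl\<close>).
Since \<open>a i = O(i)\<close>, the total mass of the configuration plus the size of the tagged cluster is a
Lyapunov function with finite sublevel sets. A maximum principle therefore bounds
\<open>diff_cl (w t) i x\<close> by the solution of the birth-and-death equation alone,
truncated to finitely many sizes, up to an error that vanishes with the truncation
(\<open>diff_cl_le_truncated\<close>).

The truncated equation dissipates the norm of \<open>\<ell>\<^sup>2(\<pi>)\<close>, \<open>\<pi>\<^sub>i = Q\<^sub>i z\<^sup>i\<close>, at rate \<open>\<lambda>\<close> as soon as the
eigenvalue equation for \<open>-\<lambda>\<close> has a positive solution (\<open>ground_state_inequality\<close>). That it has one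
is the spectral part of the argument (\<open>sol_spectral_constant_pos\<close>). The solution with parameter \<open>\<mu>\<close>
is determined by its values 0 at 1 and 1 at 2, depends continuously on \<open>\<mu>\<close> and is
positive for \<open>\<mu> = 0\<close>. If positivity failed for \<open>\<mu> = \<lambda>\<close>, then at the first parameter \<open>\<mu>\<^sup>*\<close> beyond which
it fails the solution would still be positive, but would be a limit of solutions with a change
of sign. As \<open>a i\<close> tends to infinity and \<open>z \<noteq> zs\<close>, a suitable power \<open>r ^ i\<close> is a supersolution at infinity
and dominates solutions up to their change of sign; in the limit the
solution for \<open>\<mu>\<^sup>*\<close> is in \<open>\<ell>\<^sup>2(\<pi>)\<close>. So \<open>-\<mu>\<^sup>* > -\<lambda>\<close> would be an eigenvalue, against the
maximality of \<open>-\<lambda>\<close>.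

It remains to compare the law at time \<open>t\<close> with the limit law. Adding the clusters of a configuration
one by one to the empty one, the sensitivities bound the distance between the laws at time \<open>t\<close> for any
two initial laws in terms of their mean cluster numbers. As second initial law serves the product of
Poisson laws with means \<open>m i\<close> on the sizes \<open>2..N\<close>, where \<open>m\<close> has constant flux
\<open>J = a i * z * m i - b (i + 1) * m (i + 1)\<close>: \<open>m = \<pi>\<close> with \<open>J = 0\<close> in the sub-critical case, and
the stationary means \<open>f\<close> in the super-critical case. The truncation at \<open>N\<close> is essential in the latter case, as
infinitely many clusters are present under the stationary law. By Mecke's
formula the generator, integrated against this law, telescopes to boundary terms at \<open>N\<close>
(\<open>gen_poisson\<close>). They tend to 0 as \<open>N\<close> grows, in the sub-critical case because
\<open>a N * \<pi> N\<close> does, in the super-critical case because a cluster of size \<open>N\<close> is unlikely to come back to the observed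
sizes. Finally, the total variation distance is attained on the event where one law exceeds the other, so that
one event per time suffices.\<close>

section \<open>A maximum principle and one-sided derivatives\<close>

no_notation Infinite_Sum.abs_summable_on (infixr \<open>abs'_summable'_on\<close> 46)

text \<open>The factor \<open>exp (- s)\<close> turns the weak inequality at a positive maximum into a strict one: at the
maximum of \<open>exp (- s) * u y s\<close> over \<open>F\<close> and \<open>[0, T]\<close> the left derivative would be negative.\<close>

lemma real_max_principle:
  fixes u u' :: "'i \<Rightarrow> real \<Rightarrow> real"
  assumes fin: "finite F" and T: "0 \<le> T"
    and der: "\<And>x t. x \<in> F \<Longrightarrow> 0 \<le> t \<Longrightarrow> t \<le> T \<Longrightarrow>
      (u x has_real_derivative u' x t) (at t within {0..T})"
    and init: "\<And>x. x \<in> F \<Longrightarrow> u x 0 \<le> 0"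
    and max: "\<And>x t. x \<in> F \<Longrightarrow> 0 < t \<Longrightarrow> t \<le> T \<Longrightarrow> u x t > 0 \<Longrightarrow> (\<And>y. y \<in> F \<Longrightarrow> u y t \<le> u x t)
      \<Longrightarrow> u' x t \<le> 0"
    and x: "x \<in> F" and t: "0 \<le> t" "t \<le> T"
  shows "u x t \<le> 0"
proof (rule ccontr)
  assume "\<not> u x t \<le> 0"
  define v where "v y s = exp (- s) * u y s" for y s
  have vder: "(v y has_real_derivative exp (- s) * (u' y s - u y s)) (at s within {0..T})"
    if "y \<in> F" "0 \<le> s" "s \<le> T" for y s
    unfolding v_def by (rule derivative_eq_intros der[OF that] refl | simp add: algebra_simps)+
  have vcont: "continuous_on {0..T} (v y)" if "y \<in> F" for y
    unfolding continuous_on_eq_continuous_within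
    using vder[OF that] by (meson DERIV_continuous atLeastAtMost_iff)
  have "\<exists>s\<in>{0..T}. \<forall>r\<in>{0..T}. v y r \<le> v y s" if "y \<in> F" for y
    by (rule continuous_attains_sup) (use vcont[OF that] T in auto)
  then obtain \<tau> where \<tau>: "\<And>y. y \<in> F \<Longrightarrow> \<tau> y \<in> {0..T}" "\<And>y r. y \<in> F \<Longrightarrow> r \<in> {0..T} \<Longrightarrow> v y r \<le> v y (\<tau> y)"
    by metis
  have "\<exists>y\<in>F. \<forall>y'\<in>F. v y' (\<tau> y') \<le> v y (\<tau> y)"
  proof -
    have "Max ((\<lambda>y. v y (\<tau> y)) ` F) \<in> (\<lambda>y. v y (\<tau> y)) ` F"
      using fin x by (intro Max_in) auto
    then obtain y where "y \<in> F" "v y (\<tau> y) = Max ((\<lambda>y. v y (\<tau> y)) ` F)" by auto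
    then show ?thesis using fin by (intro bexI[of _ y]) auto
  qed
  then obtain y where y: "y \<in> F" "\<And>y'. y' \<in> F \<Longrightarrow> v y' (\<tau> y') \<le> v y (\<tau> y)" by blast
  define s where "s = \<tau> y"
  have s: "0 \<le> s" "s \<le> T" using \<tau>(1)[OF y(1)] by (auto simp: s_def)
  have glob: "v y' r \<le> v y s" if "y' \<in> F" "r \<in> {0..T}" for y' r
    using \<tau>(2)[OF that] y(2)[OF that(1)] by (simp add: s_def)
  have "0 < v x t" using \<open>\<not> u x t \<le> 0\<close> by (simp add: v_def)
  also have "v x t \<le> v y s" using glob x t by auto
  finally have pos: "0 < u y s" by (simp add: v_def zero_less_mult_iff)
  have s0: "0 < s" using init[OF y(1)] pos s(1) by (cases "s = 0") auto
  have "u y' s \<le> u y s" if "y' \<in> F" for y'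
    using glob[OF that, of s] s by (simp add: v_def)
  then have "u' y s \<le> 0" using max[OF y(1) s0 s(2) pos] by blast
  then have neg: "exp (- s) * (u' y s - u y s) < 0"
    using pos by (simp add: mult_less_0_iff)
  from has_real_derivative_neg_dec_left[OF vder[OF y(1) s] neg]
  obtain d where d: "d > 0" "\<And>h. h > 0 \<Longrightarrow> s - h \<in> {0..T} \<Longrightarrow> h < d \<Longrightarrow> v y s < v y (s - h)" by blast
  define h where "h = min (d / 2) s"
  have "v y s < v y (s - h)" using d s0 s by (intro d(2)) (auto simp: h_def min_def)
  moreover have "v y (s - h) \<le> v y s" using glob[OF y(1), of "s - h"] d s0 s by (auto simp: h_def min_def)
  ultimately show False by simp
qed

text \<open>After tilting by \<open>- e * s\<close> the right derivative is negative, so the minimum over \<open>[0, T]\<close> can only be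
attained at \<open>T\<close>. Letting \<open>e\<close> tend to 0, for \<open>f\<close> and for \<open>- f\<close>, gives the claim.\<close>

lemma right_derivative_zero_imp_eq:
  fixes f :: "real \<Rightarrow> real"
  assumes T: "0 \<le> T" and cont: "continuous_on {0..T} f"
    and der: "\<And>t. 0 \<le> t \<Longrightarrow> t < T \<Longrightarrow> (f has_real_derivative 0) (at_right t)"
  shows "f T = f 0"
proof -
  have le: "g T \<le> g 0 + e * T" if g: "continuous_on {0..T} g"
    "\<And>t. 0 \<le> t \<Longrightarrow> t < T \<Longrightarrow> (g has_real_derivative 0) (at_right t)" and e: "e > 0" for g :: "real \<Rightarrow> real" and e
  proof -
    have "\<exists>s\<in>{0..T}. \<forall>r\<in>{0..T}. g s - e * s \<le> g r - e * r"
      by (rule continuous_attains_inf) (use T g in \<open>auto intro!: continuous_intros\<close>)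
    then obtain s where s: "s \<in> {0..T}" "\<And>r. r \<in> {0..T} \<Longrightarrow> g s - e * s \<le> g r - e * r" by blast
    have "s = T"
    proof (rule ccontr)
      assume "s \<noteq> T"
      with s have sT: "s < T" "0 \<le> s" by auto
      have "((\<lambda>r. e * r - g r) has_real_derivative e) (at_right s)"
        by (rule derivative_eq_intros g(2)[OF sT(2,1)] refl | simp)+
      from has_real_derivative_pos_inc_right[OF this e]
      obtain d where d: "d > 0" "\<And>h. h > 0 \<Longrightarrow> s + h \<in> {s<..} \<Longrightarrow> h < d \<Longrightarrow> e * s - g s < e * (s + h) - g (s + h)"
        by blast
      define h where "h = min (d / 2) (T - s)"
      have h: "0 < h" "h < d" "s + h \<le> T" using d sT by (auto simp: h_def min_def)
      show False using d(2)[of h] s(2)[of "s + h"] h sT by auto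
    qed
    then show ?thesis using s(2)[of 0] T by auto
  qed
  have *: "f T \<le> f 0 + e" "f T \<ge> f 0 - e" if e: "e > 0" for e
  proof -
    define e' where "e' = e / (T + 1)"
    have e': "e' > 0" "e' * T \<le> e" using e T by (auto simp: e'_def field_simps)
    have "f T \<le> f 0 + e' * T" by (rule le[OF cont der e'(1)])
    moreover have "- f T \<le> - f 0 + e' * T"
      by (rule le[OF _ _ e'(1)]) (auto intro!: continuous_intros cont derivative_eq_intros der)
    ultimately show "f T \<le> f 0 + e" "f T \<ge> f 0 - e" using e'(2) by auto
  qed
  show ?thesis
    by (rule antisym; rule field_le_epsilon) (use * in force)+
qed

text \<open>The generator of a chain only provides right derivatives in time, while the maximum principle needs
left derivatives. Subtracting a primitive of \<open>g\<close> reduces the gap to a vanishing right derivative.\<close>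

lemma continuous_right_derivative_imp_derivative:
  fixes f g :: "real \<Rightarrow> real"
  assumes cont: "continuous_on {0..} f" and gcont: "continuous_on {0..} g"
    and der: "\<And>t. 0 \<le> t \<Longrightarrow> (f has_real_derivative g t) (at_right t)" and t: "0 \<le> t"
  shows "(f has_real_derivative g t) (at t within {0..})"
proof -
  define T where "T = t + 1"
  have "continuous_on {0..T} g" using gcont by (rule continuous_on_subset) auto
  from antiderivative_continuous[OF this] obtain G where
    G: "\<And>x. x \<in> {0..T} \<Longrightarrow> (G has_real_derivative g x) (at x within {0..T})"
    by (metis has_real_derivative_iff_has_vector_derivative)
  have fG: "f s - G s = f 0 - G 0" if s: "s \<in> {0..T}" for s
  proof (rule right_derivative_zero_imp_eq[of s "\<lambda>r. f r - G r"])
    have "continuous_on {0..T} G"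
      unfolding continuous_on_eq_continuous_within using G by (meson DERIV_continuous)
    then have "continuous_on {0..s} G" by (rule continuous_on_subset) (use s in auto)
    moreover have "continuous_on {0..s} f" using cont by (rule continuous_on_subset) auto
    ultimately show "continuous_on {0..s} (\<lambda>r. f r - G r)" by (intro continuous_on_diff)
    fix r assume r: "0 \<le> r" "r < s"
    have "(G has_real_derivative g r) (at r within {r<..<T})"
      by (rule has_field_derivative_subset[OF G]) (use r s in auto)
    moreover have "at r within {r<..<T} = at_right r"
      by (rule at_within_nhd[of r "{..<T}"]) (use r s in auto)
    ultimately have "(G has_real_derivative g r) (at_right r)" by simp
    from DERIV_diff[OF der[OF r(1)] this] show "((\<lambda>r. f r - G r) has_real_derivative 0) (at_right r)" by simp
  qed (use s in auto)
  have "((\<lambda>s. G s + (f 0 - G 0)) has_real_derivative g t) (at t within {0..T})"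
    using DERIV_add[OF G[of t] DERIV_const[of "f 0 - G 0"]] t by (simp add: T_def)
  then have "(f has_real_derivative g t) (at t within {0..T})"
    by (rule has_field_derivative_transform_within[of _ _ _ _ 1])
       (use fG t in \<open>auto simp: T_def algebra_simps\<close>)
  moreover have "at t within {0..T} = at t within {0..}"
    by (rule at_within_nhd[of t "{..<T}"]) (use t in \<open>auto simp: T_def\<close>)
  ultimately show ?thesis by simp
qed

section \<open>Infinite sums and expectations under discrete laws\<close>

lemma summable_ratio_limit:
  fixes f :: "nat \<Rightarrow> real"
  assumes pos: "\<And>i. i \<ge> n \<Longrightarrow> f i > 0" and lim: "(\<lambda>i. f (Suc i) / f i) \<longlonglongrightarrow> q" and q: "q < 1"
  shows "summable f"
proof -
  obtain c where c: "q < c" "c < 1" using dense[OF q] by blast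
  have "\<forall>\<^sub>F i in sequentially. f (Suc i) / f i < c" using order_tendstoD(2)[OF lim c(1)] .
  then obtain N where N: "\<And>i. i \<ge> N \<Longrightarrow> f (Suc i) / f i < c" by (auto simp: eventually_sequentially)
  show ?thesis
  proof (rule summable_ratio_test[OF c(2)])
    fix i assume i: "i \<ge> max n N"
    then have "f (Suc i) < c * f i" using N[of i] pos[of i] by (simp add: divide_less_eq)
    then show "norm (f (Suc i)) \<le> c * norm (f i)" using pos[of i] pos[of "Suc i"] i by simp
  qed
qed

lemma inverse_ratio_limit:
  assumes "(\<lambda>i. f (Suc i) / f i) \<longlonglongrightarrow> q" "q \<noteq> (0::real)"
  shows "(\<lambda>i. (1 / f (Suc i)) / (1 / f i)) \<longlonglongrightarrow> 1 / q"
  using tendsto_inverse[OF assms] by (simp add: inverse_eq_divide)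

lemma summable_imp_summable_on_pos:
  fixes f :: "nat \<Rightarrow> real"
  assumes "summable f" "\<And>i. i \<ge> 1 \<Longrightarrow> f i > 0" "n \<ge> 1"
  shows "f summable_on {n..}"
proof -
  have "summable (\<lambda>i. norm (f i))"
    using assms(1) by (rule summable_cong[THEN iffD2, rotated])
      (use assms(2) in \<open>auto intro!: eventually_sequentiallyI[of 1] simp: abs_of_pos\<close>)
  then have "f summable_on UNIV" by (rule norm_summable_imp_summable_on)
  then show ?thesis by (rule summable_on_subset_banach) auto
qed

lemma has_sum_sum:
  fixes f :: "'k \<Rightarrow> 'x \<Rightarrow> real"
  assumes "finite K" "\<And>k. k \<in> K \<Longrightarrow> (f k has_sum s k) A"
  shows "((\<lambda>x. \<Sum>k\<in>K. f k x) has_sum (\<Sum>k\<in>K. s k)) A"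
  using assms by (induction K rule: finite_induct) (auto intro!: has_sum_add)

lemma has_sum_tail_bound:
  fixes f g :: "'a \<Rightarrow> real"
  assumes g: "(g has_sum G) S" and f: "(f has_sum F) S" and le: "\<And>x. x \<in> S \<Longrightarrow> \<bar>f x\<bar> \<le> g x"
    and A: "finite A" "A \<subseteq> S"
  shows "\<bar>F - sum f A\<bar> \<le> G - sum g A"
proof -
  have f': "(f has_sum F - sum f A) (S - A)" and g': "(g has_sum G - sum g A) (S - A)"
    using A by (auto intro!: has_sum_Diff f g has_sum_finite)
  have "F - sum f A \<le> G - sum g A"
    by (rule has_sum_mono[OF f' g']) (use le in \<open>force simp: abs_le_iff\<close>)
  moreover have "- (F - sum f A) \<le> G - sum g A"
  proof (rule has_sum_mono[OF _ g'])
    show "((\<lambda>x. - f x) has_sum - (F - sum f A)) (S - A)" using f' by (simp add: has_sum_uminus)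
  qed (use le in \<open>force simp: abs_le_iff\<close>)
  ultimately show ?thesis by simp
qed

lemma pmf_expectation_has_sum:
  assumes "set_pmf p \<subseteq> A" and "\<And>x. x \<in> A \<Longrightarrow> \<bar>f x\<bar> \<le> B"
  shows "((\<lambda>x. pmf p x * f x) has_sum measure_pmf.expectation p f) A"
proof -
  have z: "pmf p x = 0" if "x \<notin> A" for x using assms(1) that by (auto simp: set_pmf_eq)
  have B: "norm (pmf p x * f x) \<le> B * pmf p x" for x
  proof (cases "x \<in> A")
    case True
    then show ?thesis using assms(2)[OF True] by (simp add: abs_mult mult_mono mult.commute[of B])
  qed (simp add: z)
  have "(\<lambda>x. pmf p x * f x) abs_summable_on UNIV"
    by (rule Infinite_Set_Sum.abs_summable_on_comparison_test'[where g = "\<lambda>x. B * pmf p x"])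
      (use B in \<open>auto intro!: abs_summable_on_cmult_right\<close>)
  then have s: "Infinite_Sum.abs_summable_on (\<lambda>x. pmf p x * f x) UNIV" and
    e: "measure_pmf.expectation p f = infsum (\<lambda>x. pmf p x * f x) UNIV"
    by (rule abs_summable_equivalent[THEN iffD2]) (simp add: pmf_expectation_eq_infsetsum infsetsum_infsum[OF \<open>_ abs_summable_on UNIV\<close>])
  have "((\<lambda>x. pmf p x * f x) has_sum measure_pmf.expectation p f) UNIV"
    unfolding e by (rule has_sum_infsum) (rule abs_summable_summable[OF s])
  then show ?thesis
    by (subst has_sum_cong_neutral[of UNIV A]) (auto simp: z)
qed

lemma pmf_has_sum_1: "set_pmf p \<subseteq> A \<Longrightarrow> (pmf p has_sum 1) A"
  using pmf_expectation_has_sum[of p A "\<lambda>_. 1" 1] by simp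

lemma pmf_infsum:
  assumes "set_pmf p \<subseteq> A" and "\<And>x. x \<in> A \<Longrightarrow> \<bar>f x\<bar> \<le> B"
  shows "infsum (\<lambda>x. pmf p x * f x) A = measure_pmf.expectation p f"
  using pmf_expectation_has_sum[OF assms] by (simp add: infsumI)

lemma integrable_pmf_bounded_on:
  fixes f :: "'a \<Rightarrow> real"
  assumes "set_pmf p \<subseteq> A" and "\<And>x. x \<in> A \<Longrightarrow> \<bar>f x\<bar> \<le> B"
  shows "integrable (measure_pmf p) f"
  using assms by (intro measure_pmf.integrable_const_bound[where B = B]) (auto simp: AE_measure_pmf_iff)

lemma pmf_expectation_le:
  fixes f :: "'a \<Rightarrow> real"
  assumes "set_pmf p \<subseteq> A" and "\<And>x. x \<in> A \<Longrightarrow> \<bar>f x\<bar> \<le> B"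
  shows "\<bar>measure_pmf.expectation p f\<bar> \<le> B"
proof -
  have "\<bar>measure_pmf.expectation p f\<bar> \<le> measure_pmf.expectation p (\<lambda>x. \<bar>f x\<bar>)"
    by (rule integral_abs_bound)
  also have "\<dots> \<le> B"
    using assms by (intro measure_pmf.integral_le_const)
      (auto simp: AE_measure_pmf_iff intro: integrable_pmf_bounded_on)
  finally show ?thesis .
qed

text \<open>A shift by \<open>B\<close> makes \<open>f\<close> nonnegative, where the corresponding rule for \<open>nn_integral\<close> applies.\<close>

lemma expectation_bind_pmf:
  fixes f :: "'a \<Rightarrow> real"
  assumes B: "\<And>y. \<bar>f y\<bar> \<le> B"
  shows "measure_pmf.expectation (bind_pmf p K) f = measure_pmf.expectation p (\<lambda>x. measure_pmf.expectation (K x) f)"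
proof -
  have int: "integrable (measure_pmf q) f" for q
    by (rule integrable_pmf_bounded_on[of _ UNIV]) (auto intro: B)
  have int2: "integrable (measure_pmf q) (\<lambda>x. measure_pmf.expectation (K x) f)" for q
    by (rule integrable_pmf_bounded_on[of _ UNIV], simp) (rule pmf_expectation_le[of _ UNIV], auto intro: B)
  have shift: "measure_pmf.expectation q f + B = measure_pmf.expectation q (\<lambda>y. f y + B)" for q
    using int by simp
  have nn: "f y + B \<ge> 0" for y using B[of y] by linarith
  have "ennreal (measure_pmf.expectation (bind_pmf p K) (\<lambda>y. f y + B)) =
      (\<integral>\<^sup>+ x. ennreal (measure_pmf.expectation (K x) (\<lambda>y. f y + B)) \<partial>p)"
  proof -
    have "(\<integral>\<^sup>+ y. ennreal (f y + B) \<partial>measure_pmf q) = ennreal (measure_pmf.expectation q (\<lambda>y. f y + B))" for q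
      using int nn by (intro nn_integral_eq_integral) auto
    from this[symmetric] show ?thesis by (simp only: nn_integral_bind_pmf)
  qed
  also have "\<dots> = ennreal (measure_pmf.expectation p (\<lambda>x. measure_pmf.expectation (K x) (\<lambda>y. f y + B)))"
  proof (rule nn_integral_eq_integral)
    show "integrable (measure_pmf p) (\<lambda>x. measure_pmf.expectation (K x) (\<lambda>y. f y + B))"
      unfolding shift[symmetric] using int2 by simp
  qed (auto intro!: AE_I2 integral_nonneg_AE nn)
  finally have "measure_pmf.expectation (bind_pmf p K) (\<lambda>y. f y + B) =
      measure_pmf.expectation p (\<lambda>x. measure_pmf.expectation (K x) (\<lambda>y. f y + B))"
    using nn by (subst (asm) ennreal_inj) (auto intro!: integral_nonneg_AE)
  then show ?thesis using int2 unfolding shift[symmetric] by simp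
qed

lemma expectation_bind_pmf_on:
  fixes f :: "'a \<Rightarrow> real"
  assumes B: "\<And>y. y \<in> S \<Longrightarrow> \<bar>f y\<bar> \<le> B" and sub: "\<And>x. x \<in> set_pmf p \<Longrightarrow> set_pmf (K x) \<subseteq> S"
  shows "measure_pmf.expectation (bind_pmf p K) f = measure_pmf.expectation p (\<lambda>x. measure_pmf.expectation (K x) f)"
proof -
  have B': "\<bar>if y \<in> S then f y else 0\<bar> \<le> max B 0" for y using B[of y] by auto
  have "measure_pmf.expectation (bind_pmf p K) f = measure_pmf.expectation (bind_pmf p K) (\<lambda>y. if y \<in> S then f y else 0)"
    using sub by (intro integral_cong_AE) (auto simp: AE_measure_pmf_iff)
  also have "\<dots> = measure_pmf.expectation p (\<lambda>x. measure_pmf.expectation (K x) (\<lambda>y. if y \<in> S then f y else 0))"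
    by (rule expectation_bind_pmf[OF B'])
  also have "\<dots> = measure_pmf.expectation p (\<lambda>x. measure_pmf.expectation (K x) f)"
  proof -
    have "measure_pmf.expectation (K x) (\<lambda>y. if y \<in> S then f y else 0) = measure_pmf.expectation (K x) f"
      if "x \<in> set_pmf p" for x
      using sub[OF that] by (intro integral_cong_AE) (auto simp: AE_measure_pmf_iff)
    then show ?thesis by (intro integral_cong_AE) (auto simp: AE_measure_pmf_iff)
  qed
  finally show ?thesis .
qed

lemma pmf_has_sum_prob: "(pmf p has_sum measure_pmf.prob p B) B"
proof -
  have "((\<lambda>x. pmf p x * indicator B x) has_sum measure_pmf.expectation p (indicator B)) UNIV"
    by (rule pmf_expectation_has_sum[where B = 1]) (auto simp: indicator_def)
  then have "((\<lambda>x. pmf p x * indicator B x) has_sum measure_pmf.prob p B) UNIV" by simp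
  then show ?thesis
    by (rule has_sum_cong_neutral[THEN iffD1, rotated -1]) (auto simp: indicator_def)
qed

text \<open>The supremum over events in the definition of total variation is attained on \<open>{\<mu> > \<nu>}\<close>. A missing mass
of \<open>\<nu>\<close> only lowers the distance, so that the total mass of \<open>\<nu>\<close> need not be determined exactly.\<close>

lemma tv_dist_le_positive_part:
  assumes \<mu>: "(\<mu> has_sum 1) S" and \<nu>: "(\<nu> has_sum s) S" and s: "s \<le> 1"
    and \<mu>B: "(\<mu> has_sum p) {x\<in>S. \<mu> x > \<nu> x}" and \<nu>B: "(\<nu> has_sum q) {x\<in>S. \<mu> x > \<nu> x}"
  shows "tv_dist S \<mu> \<nu> \<le> p - q"
proof -
  define B where "B = {x\<in>S. \<mu> x > \<nu> x}"
  have *: "((\<lambda>x. if x \<in> B then f x else 0) has_sum c) S" if "(f has_sum c) B" for f :: "'a \<Rightarrow> real" and c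
    using that by (rule has_sum_cong_neutral[THEN iffD1, rotated -1]) (auto simp: B_def)
  have "((\<lambda>x. 2 * (if x \<in> B then \<mu> x else 0) + (- 2) * (if x \<in> B then \<nu> x else 0) + ((- 1) * \<mu> x + \<nu> x)) has_sum
      (2 * p + (- 2) * q + ((- 1) * 1 + s))) S"
    using \<mu>B \<nu>B by (intro has_sum_add has_sum_cmult_right * \<mu> \<nu>) (auto simp: B_def)
  then have "((\<lambda>x. \<bar>\<mu> x - \<nu> x\<bar>) has_sum (2 * p + (- 2) * q + ((- 1) * 1 + s))) S"
    by (rule has_sum_cong[THEN iffD1, rotated]) (auto simp: B_def)
  then have "tv_dist S \<mu> \<nu> = (1 / 2) * (2 * p + (- 2) * q + ((- 1) * 1 + s))"
    unfolding tv_dist_def by (simp add: infsumI)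
  then show ?thesis using s by simp
qed

section \<open>The Markov semigroup and its backward equation\<close>

definition trans_pmf :: "'s set \<Rightarrow> (real \<Rightarrow> 's \<Rightarrow> 's \<Rightarrow> real) \<Rightarrow> real \<Rightarrow> 's \<Rightarrow> 's pmf" where
  "trans_pmf S P t x = embed_pmf (\<lambda>y. if y \<in> S then P t x y else 0)"

text \<open>Written as an expectation under the law at time \<open>t\<close>, so that the calculus of discrete laws applies; for bounded \<open>\<psi>\<close> it agrees
with the sum in the definition of the generator.\<close>

definition semigroup_op :: "'s set \<Rightarrow> (real \<Rightarrow> 's \<Rightarrow> 's \<Rightarrow> real) \<Rightarrow> real \<Rightarrow> ('s \<Rightarrow> real) \<Rightarrow> 's \<Rightarrow> real" where
  "semigroup_op S P t \<psi> x = measure_pmf.expectation (trans_pmf S P t x) \<psi>"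

lemma pmf_trans_pmf:
  assumes P: "transition_function S P" and t: "0 \<le> t" and x: "x \<in> S"
  shows "pmf (trans_pmf S P t x) y = (if y \<in> S then P t x y else 0)"
  unfolding trans_pmf_def
proof (rule pmf_embed_pmf)
  have nn: "\<And>y. y \<in> S \<Longrightarrow> 0 \<le> P t x y" and sum: "(P t x has_sum 1) S"
    using P t x by (auto simp: transition_function_def)
  show "0 \<le> (if y \<in> S then P t x y else 0)" for y using nn by simp
  have s1: "((\<lambda>y. if y \<in> S then P t x y else 0) has_sum 1) UNIV"
    by (rule has_sum_cong_neutral[of UNIV S _ "P t x", THEN iffD1, OF _ _ _ sum]) auto
  then have "(\<lambda>y. if y \<in> S then P t x y else 0) summable_on UNIV" by (rule has_sum_imp_summable)
  then have "(\<lambda>y. if y \<in> S then P t x y else 0) abs_summable_on UNIV"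
    by (metis (mono_tags, lifting) abs_summable_equivalent summable_on_iff_abs_summable_on_real)
  then have "(\<integral>\<^sup>+ y. ennreal (if y \<in> S then P t x y else 0) \<partial>count_space UNIV)
      = ennreal (infsetsum (\<lambda>y. if y \<in> S then P t x y else 0) UNIV)"
    using nn by (intro nn_integral_conv_infsetsum) auto
  also have "infsetsum (\<lambda>y. if y \<in> S then P t x y else 0) UNIV = 1"
    by (subst infsetsum_infsum) (use \<open>_ abs_summable_on UNIV\<close> s1 in \<open>auto simp: infsumI\<close>)
  finally show "(\<integral>\<^sup>+ y. ennreal (if y \<in> S then P t x y else 0) \<partial>count_space UNIV) = 1" by simp
qed

lemma set_trans_pmf:
  assumes "transition_function S P" "0 \<le> t" "x \<in> S"
  shows "set_pmf (trans_pmf S P t x) \<subseteq> S"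
  by (auto simp: set_pmf_eq pmf_trans_pmf[OF assms])

lemma semigroup_op_eq_infsum:
  assumes P: "transition_function S P" "0 \<le> t" "x \<in> S" and B: "\<And>y. y \<in> S \<Longrightarrow> \<bar>\<psi> y\<bar> \<le> B"
  shows "semigroup_op S P t \<psi> x = (\<Sum>\<^sub>\<infinity>y\<in>S. P t x y * \<psi> y)"
proof -
  have "semigroup_op S P t \<psi> x = (\<Sum>\<^sub>\<infinity>y\<in>S. pmf (trans_pmf S P t x) y * \<psi> y)"
    unfolding semigroup_op_def by (rule pmf_infsum[OF set_trans_pmf[OF P] B, symmetric])
  also have "\<dots> = (\<Sum>\<^sub>\<infinity>y\<in>S. P t x y * \<psi> y)"
    by (intro infsum_cong) (simp add: pmf_trans_pmf[OF P])
  finally show ?thesis .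
qed

lemma semigroup_op_bounded:
  assumes P: "transition_function S P" "0 \<le> t" "x \<in> S" and B: "\<And>y. y \<in> S \<Longrightarrow> \<bar>\<psi> y\<bar> \<le> B"
  shows "\<bar>semigroup_op S P t \<psi> x\<bar> \<le> B"
  unfolding semigroup_op_def by (rule pmf_expectation_le[OF set_trans_pmf[OF P] B])

lemma semigroup_op_0:
  assumes P: "transition_function S P" and x: "x \<in> S"
  shows "semigroup_op S P 0 \<psi> x = \<psi> x"
proof -
  have "trans_pmf S P 0 x = return_pmf x"
    using P x by (intro pmf_eqI) (auto simp: pmf_trans_pmf transition_function_def indicator_def)
  then show ?thesis by (simp add: semigroup_op_def)
qed

lemma trans_pmf_add:
  assumes P: "transition_function S P" and s: "0 \<le> s" and t: "0 \<le> t" and x: "x \<in> S"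
  shows "trans_pmf S P (s + t) x = bind_pmf (trans_pmf S P s x) (trans_pmf S P t)"
proof (rule pmf_eqI)
  fix y
  note set = set_trans_pmf[OF P s x]
  have "pmf (bind_pmf (trans_pmf S P s x) (trans_pmf S P t)) y
      = (\<Sum>\<^sub>\<infinity>u\<in>S. pmf (trans_pmf S P s x) u * pmf (trans_pmf S P t u) y)"
    unfolding pmf_bind by (rule pmf_infsum[OF set, of _ 1, symmetric]) (simp add: pmf_le_1)
  also have "\<dots> = (\<Sum>\<^sub>\<infinity>u\<in>S. P s x u * (if y \<in> S then P t u y else 0))"
    by (intro infsum_cong) (simp add: pmf_trans_pmf[OF P s x] pmf_trans_pmf[OF P t])
  also have "\<dots> = pmf (trans_pmf S P (s + t) x) y"
  proof (cases "y \<in> S")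
    case True
    then have "((\<lambda>u. P s x u * P t u y) has_sum P (s + t) x y) S"
      using P s t x by (auto simp: transition_function_def)
    then show ?thesis using True s t x by (simp add: pmf_trans_pmf[OF P] infsumI)
  qed (use s t x in \<open>simp add: pmf_trans_pmf[OF P]\<close>)
  finally show "pmf (trans_pmf S P (s + t) x) y = pmf (bind_pmf (trans_pmf S P s x) (trans_pmf S P t)) y" by simp
qed

lemma semigroup_op_add:
  assumes P: "transition_function S P" and s: "0 \<le> s" and t: "0 \<le> t" and x: "x \<in> S"
    and B: "\<And>y. y \<in> S \<Longrightarrow> \<bar>\<psi> y\<bar> \<le> B"
  shows "semigroup_op S P (s + t) \<psi> x = semigroup_op S P s (semigroup_op S P t \<psi>) x"
  unfolding semigroup_op_def trans_pmf_add[OF P s t x]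
  by (rule expectation_bind_pmf_on[OF B]) (use set_trans_pmf[OF P s x] set_trans_pmf[OF P t] in blast)+

lemma semigroup_op_right_derivative:
  assumes P: "transition_function S P" and L: "has_generator S P L" and t: "0 \<le> t" and x: "x \<in> S"
    and B: "\<And>y. y \<in> S \<Longrightarrow> \<bar>\<psi> y\<bar> \<le> B"
  shows "((\<lambda>s. semigroup_op S P s \<psi> x) has_real_derivative L (semigroup_op S P t \<psi>) x) (at_right t)"
proof -
  define \<phi> where "\<phi> = semigroup_op S P t \<psi>"
  have \<phi>B: "\<bar>\<phi> y\<bar> \<le> B" if "y \<in> S" for y
    unfolding \<phi>_def by (rule semigroup_op_bounded[OF P t that B])
  have "bounded (\<phi> ` S)" using \<phi>B by (intro boundedI[of _ B]) auto
  then have "((\<lambda>h. \<Sum>\<^sub>\<infinity>y\<in>S. P h x y * \<phi> y) has_real_derivative L \<phi> x) (at_right 0)"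
    using L x by (auto simp: has_generator_def)
  moreover have eq: "(\<Sum>\<^sub>\<infinity>y\<in>S. P h x y * \<phi> y) = semigroup_op S P h \<phi> x" if "0 \<le> h" for h
    by (rule semigroup_op_eq_infsum[OF P that x \<phi>B, symmetric])
  moreover have "\<forall>\<^sub>F h in at_right 0. (\<Sum>\<^sub>\<infinity>y\<in>S. P h x y * \<phi> y) = semigroup_op S P h \<phi> x"
    using eventually_at_right_less[of "0::real"] by eventually_elim (simp add: eq)
  ultimately have "((\<lambda>h. semigroup_op S P h \<phi> x) has_real_derivative L \<phi> x) (at_right 0)"
    by (subst (asm) has_field_derivative_cong_eventually[where g = "\<lambda>h. semigroup_op S P h \<phi> x"]) auto
  then have "((\<lambda>h. (semigroup_op S P h \<phi> x - semigroup_op S P 0 \<phi> x) / (h - 0)) \<longlongrightarrow> L \<phi> x) (at_right 0)"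
    by (simp only: has_field_derivative_iff)
  then have "((\<lambda>h. (semigroup_op S P (h + t) \<psi> x - semigroup_op S P t \<psi> x) / ((h + t) - t)) \<longlongrightarrow> L \<phi> x) (at_right 0)"
  proof (rule Lim_transform_eventually)
    show "\<forall>\<^sub>F h in at_right 0. (semigroup_op S P h \<phi> x - semigroup_op S P 0 \<phi> x) / (h - 0) =
        (semigroup_op S P (h + t) \<psi> x - semigroup_op S P t \<psi> x) / ((h + t) - t)"
      using eventually_at_right_less[of "0::real"]
      by eventually_elim (simp add: semigroup_op_0[OF P x] \<phi>_def semigroup_op_add[OF P _ t x B])
  qed
  then have "((\<lambda>s. (semigroup_op S P s \<psi> x - semigroup_op S P t \<psi> x) / (s - t)) \<longlongrightarrow> L \<phi> x) (at_right t)"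
    by (subst filterlim_at_right_to_0) simp
  then show ?thesis by (simp add: has_field_derivative_iff \<phi>_def)
qed

text \<open>By the semigroup property an increment over a time step \<open>h\<close> is the effect of \<open>h\<close> on a function bounded by \<open>B\<close>;
it is at most \<open>2 * B\<close> times the probability of having left \<open>x\<close> after time \<open>h\<close>. This modulus of
continuity does not depend on the time, which yields continuity from the left as well.\<close>

lemma semigroup_op_continuous:
  assumes P: "transition_function S P" and L: "has_generator S P L" and x: "x \<in> S"
    and B: "\<And>y. y \<in> S \<Longrightarrow> \<bar>\<psi> y\<bar> \<le> B"
  shows "continuous_on {0..} (\<lambda>s. semigroup_op S P s \<psi> x)"
proof -
  define q where "q h = 2 * B * (1 - P h x x)" for h
  have pxx: "semigroup_op S P h (indicator {x}) x = P h x x" if "0 \<le> h" for h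
    using x that by (simp add: semigroup_op_def measure_pmf_single pmf_trans_pmf[OF P])
  have B0: "0 \<le> B" using B[OF x] by linarith
  have inc: "\<bar>semigroup_op S P t \<psi> x - semigroup_op S P s \<psi> x\<bar> \<le> q (t - s)" if st: "0 \<le> s" "s \<le> t" for s t
  proof -
    define h where "h = t - s"
    define \<phi> where "\<phi> = semigroup_op S P s \<psi>"
    have h: "0 \<le> h" using st by (simp add: h_def)
    have \<phi>B: "\<bar>\<phi> y\<bar> \<le> B" if "y \<in> S" for y
      unfolding \<phi>_def by (rule semigroup_op_bounded[OF P st(1) that B])
    have "semigroup_op S P t \<psi> x - semigroup_op S P s \<psi> x = semigroup_op S P h \<phi> x - \<phi> x"
      using semigroup_op_add[OF P h st(1) x B] by (simp add: h_def \<phi>_def)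
    also have "\<dots> = measure_pmf.expectation (trans_pmf S P h x) (\<lambda>y. \<phi> y - \<phi> x)"
      unfolding semigroup_op_def
      by (subst Bochner_Integration.integral_diff)
         (auto intro!: integrable_pmf_bounded_on[OF set_trans_pmf[OF P h x] \<phi>B])
    finally have "\<bar>semigroup_op S P t \<psi> x - semigroup_op S P s \<psi> x\<bar> \<le>
        measure_pmf.expectation (trans_pmf S P h x) (\<lambda>y. \<bar>\<phi> y - \<phi> x\<bar>)"
      by (simp add: integral_abs_bound)
    also have "\<dots> \<le> measure_pmf.expectation (trans_pmf S P h x) (\<lambda>y. 2 * B * (1 - indicator {x} y))"
    proof (rule integral_mono_AE)
      have "\<bar>\<phi> y - \<phi> x\<bar> \<le> 2 * B" if "y \<in> S" for y using \<phi>B[OF that] \<phi>B[OF x] by linarith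
      then show "integrable (measure_pmf (trans_pmf S P h x)) (\<lambda>y. \<bar>\<phi> y - \<phi> x\<bar>)"
        by (intro integrable_pmf_bounded_on[OF set_trans_pmf[OF P h x], where B = "2 * B"]) auto
      show "integrable (measure_pmf (trans_pmf S P h x)) (\<lambda>y. 2 * B * (1 - indicator {x} y))"
        by (intro integrable_pmf_bounded_on[of _ UNIV _ "2 * B"]) (use B0 in \<open>auto simp: indicator_def\<close>)
      show "AE y in trans_pmf S P h x. \<bar>\<phi> y - \<phi> x\<bar> \<le> 2 * B * (1 - indicator {x} y)"
        using set_trans_pmf[OF P h x] \<open>\<And>y. y \<in> S \<Longrightarrow> \<bar>\<phi> y - \<phi> x\<bar> \<le> 2 * B\<close>
        by (auto simp: AE_measure_pmf_iff indicator_def)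
    qed
    also have "\<dots> = q h"
    proof -
      have "integrable (measure_pmf (trans_pmf S P h x)) (indicator {x} :: _ \<Rightarrow> real)"
        by (intro integrable_pmf_bounded_on[of _ UNIV _ 1]) (auto simp: indicator_def)
      then show ?thesis using pxx[OF h] by (simp add: q_def semigroup_op_def)
    qed
    finally show ?thesis by (simp add: h_def)
  qed
  have "((\<lambda>h. semigroup_op S P h (indicator {x}) x) \<longlongrightarrow> semigroup_op S P 0 (indicator {x}) x) (at_right 0)"
    using DERIV_continuous[OF semigroup_op_right_derivative[OF P L order.refl x, of "indicator {x}" 1]]
    by (simp add: continuous_within indicator_def)
  then have "((\<lambda>h. P h x x) \<longlongrightarrow> 1) (at_right 0)"
    unfolding semigroup_op_0[OF P x] indicator_simps(1)[OF singletonI]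
    by (rule Lim_transform_eventually)
       (use eventually_at_right_less[of "0::real"] in \<open>auto elim!: eventually_mono simp: pxx\<close>)
  then have q0: "(q \<longlongrightarrow> 0) (at_right 0)"
    unfolding q_def by (auto intro!: tendsto_eq_intros)
  show ?thesis
    unfolding continuous_on_iff
  proof (intro ballI allI impI)
    fix t e :: real assume t: "t \<in> {0..}" and e: "e > 0"
    from tendstoD[OF q0 e] obtain d where d: "d > 0" "\<And>h. 0 < h \<Longrightarrow> h < d \<Longrightarrow> \<bar>q h\<bar> < e"
      unfolding eventually_at_right_field dist_real_def by auto
    have "\<bar>semigroup_op S P s \<psi> x - semigroup_op S P t \<psi> x\<bar> < e" if s: "s \<in> {0..}" "\<bar>s - t\<bar> < d" for s
      using inc[of s t] inc[of t s] d(2)[of "s - t"] d(2)[of "t - s"] s t e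
      by (cases s t rule: linorder_cases) auto
    then show "\<exists>d>0. \<forall>s\<in>{0..}. dist s t < d \<longrightarrow> dist (semigroup_op S P s \<psi> x) (semigroup_op S P t \<psi> x) < e"
      using d(1) by (auto simp: dist_real_def)
  qed
qed

lemma backward_equation:
  assumes P: "transition_function S P" and L: "has_generator S P L" and x: "x \<in> S"
    and B: "\<And>y. y \<in> S \<Longrightarrow> \<bar>\<psi> y\<bar> \<le> B"
    and Lcont: "continuous_on {0..} (\<lambda>s. L (semigroup_op S P s \<psi>) x)" and t: "0 \<le> t"
  shows "((\<lambda>s. semigroup_op S P s \<psi> x) has_real_derivative L (semigroup_op S P t \<psi>) x) (at t within {0..})"
  by (rule continuous_right_derivative_imp_derivative[OF semigroup_op_continuous[OF P L x B] Lcont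
      semigroup_op_right_derivative[OF P L _ x B] t])

text \<open>Both the joint law of \<open>(X 0, X t)\<close> and the mixture of the transition laws are carried by the countable
set \<open>S \<times> S\<close>, so it suffices to compare point masses.\<close>

lemma markov_chain_law:
  fixes X :: "real \<Rightarrow> 'w \<Rightarrow> 's"
  assumes mc: "markov_chain M S L X" and S: "countable S" and p: "set_pmf p \<subseteq> S"
    and init: "\<And>c. c \<in> S \<Longrightarrow> measure M {\<omega> \<in> space M. X 0 \<omega> = c} = pmf p c"
  shows "\<exists>P. transition_function S P \<and> has_generator S P L \<and>
    (\<forall>t\<ge>0. \<forall>B. measure M {\<omega> \<in> space M. X t \<omega> \<in> B} = measure_pmf.prob (bind_pmf p (trans_pmf S P t)) B)"
proof -
  interpret prob_space M using mc by (simp add: markov_chain_def)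
  have meas: "X t \<in> measurable M (count_space S)" if "0 \<le> t" for t
    using mc that by (simp add: markov_chain_def)
  obtain P where P: "transition_function S P" and L: "has_generator S P L" and
    fdd: "\<forall>(n::nat) (t :: nat \<Rightarrow> real) (x :: nat \<Rightarrow> 's).
           t 0 = 0 \<longrightarrow> (\<forall>k<n. t k \<le> t (Suc k)) \<longrightarrow> (\<forall>k\<le>n. x k \<in> S) \<longrightarrow>
           measure M {\<omega> \<in> space M. \<forall>k\<le>n. X (t k) \<omega> = x k} =
             measure M {\<omega> \<in> space M. X 0 \<omega> = x 0} *
               (\<Prod>k<n. P (t (Suc k) - t k) (x k) (x (Suc k)))"
    using mc unfolding markov_chain_def by blast
  have "measure M {\<omega> \<in> space M. X t \<omega> \<in> B} = measure_pmf.prob (bind_pmf p (trans_pmf S P t)) B"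
    if t: "0 \<le> t" for t B
  proof -
    define Y where "Y \<omega> = (X 0 \<omega>, X t \<omega>)" for \<omega>
    define Q where "Q = bind_pmf p (\<lambda>x. map_pmf (Pair x) (trans_pmf S P t x))"
    have sp: "X 0 \<omega> \<in> S" "X t \<omega> \<in> S" if "\<omega> \<in> space M" for \<omega>
      using measurable_space[OF meas that] t by auto
    have joint: "measure M {\<omega> \<in> space M. X 0 \<omega> = x \<and> X t \<omega> = y} = pmf p x * P t x y" if xy: "x \<in> S" "y \<in> S" for x y
    proof -
      have "measure M {\<omega> \<in> space M. \<forall>k\<le>1. X (if k = (0::nat) then 0 else t) \<omega> = (if k = 0 then x else y)} =
          measure M {\<omega> \<in> space M. X 0 \<omega> = x} * P t x y"
        using fdd[rule_format, of "\<lambda>k. if k = 0 then 0 else t" 1 "\<lambda>k. if k = 0 then x else y"] t xy by simp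
      moreover have "{\<omega> \<in> space M. \<forall>k\<le>1. X (if k = (0::nat) then 0 else t) \<omega> = (if k = 0 then x else y)} =
          {\<omega> \<in> space M. X 0 \<omega> = x \<and> X t \<omega> = y}"
        by (auto simp: le_Suc_eq)
      ultimately show ?thesis using init[OF xy(1)] by simp
    qed
    have Ym: "Y \<in> measurable M (count_space UNIV)"
    proof -
      have "Y \<in> measurable M (count_space (S \<times> S))"
        unfolding measurable_count_space_eq_countable[OF countable_SIGMA[OF S S]]
      proof (intro conjI ballI)
        show "Y \<in> space M \<rightarrow> S \<times> S" using sp by (auto simp: Y_def)
        fix q assume "q \<in> S \<times> S"
        then obtain x y where q: "q = (x, y)" "x \<in> S" "y \<in> S" by auto
        have "Y -` {q} \<inter> space M = (X 0 -` {x} \<inter> space M) \<inter> (X t -` {y} \<inter> space M)"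
          by (auto simp: Y_def q)
        also have "\<dots> \<in> sets M"
          using measurable_sets[OF meas[of 0], of "{x}"] measurable_sets[OF meas[OF t], of "{y}"] q by auto
        finally show "Y -` {q} \<inter> space M \<in> sets M" .
      qed
      from measurable_compose[OF this, of "\<lambda>x. x" "count_space UNIV"] show ?thesis by simp
    qed
    have pmfQ: "pmf Q (x, y) = pmf p x * P t x y" if xy: "x \<in> S" "y \<in> S" for x y
    proof -
      have e: "pmf (map_pmf (Pair u) (trans_pmf S P t u)) (x, y) = indicator {x} u * P t x y" for u
      proof (cases "u = x")
        case True
        have "pmf (map_pmf (Pair x) (trans_pmf S P t x)) (Pair x y) = pmf (trans_pmf S P t x) y"
          by (rule pmf_map_inj') (simp add: inj_def)
        then show ?thesis using True xy by (simp add: pmf_trans_pmf[OF P t])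
      next
        case False
        then have "(x, y) \<notin> set_pmf (map_pmf (Pair u) (trans_pmf S P t u))" by auto
        then show ?thesis using False by (simp add: set_pmf_eq)
      qed
      show ?thesis unfolding Q_def pmf_bind e by (simp add: measure_pmf_single)
    qed
    have setQ: "set_pmf Q \<subseteq> S \<times> S"
      unfolding Q_def using p set_trans_pmf[OF P t] by auto
    have "distr M (count_space UNIV) Y = measure_pmf Q"
    proof (rule measure_eqI_countable_AE[where \<Omega> = "S \<times> S"])
      show "AE q in distr M (count_space UNIV) Y. q \<in> S \<times> S"
        using sp by (subst AE_distr_iff[OF Ym]) (auto simp: Y_def)
      show "AE q in Q. q \<in> S \<times> S" using setQ by (auto simp: AE_measure_pmf_iff)
      show "countable (S \<times> S)" using S by (intro countable_SIGMA)
      fix q assume "q \<in> S \<times> S"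
      then obtain x y where q: "q = (x, y)" "x \<in> S" "y \<in> S" by auto
      have "emeasure (distr M (count_space UNIV) Y) {q} = emeasure M {\<omega> \<in> space M. X 0 \<omega> = x \<and> X t \<omega> = y}"
        by (subst emeasure_distr[OF Ym]) (auto simp: q Y_def intro!: arg_cong[where f = "emeasure M"])
      also have "\<dots> = ennreal (pmf Q q)"
        by (simp add: emeasure_eq_measure joint[OF q(2,3)] q(1) pmfQ[OF q(2,3)])
      also have "\<dots> = emeasure (measure_pmf Q) {q}" by (simp add: emeasure_pmf_single)
      finally show "emeasure (distr M (count_space UNIV) Y) {q} = emeasure (measure_pmf Q) {q}" .
    qed simp_all
    then have "measure (distr M (count_space UNIV) Y) (snd -` B) = measure_pmf.prob Q (snd -` B)" by simp
    moreover have "measure (distr M (count_space UNIV) Y) (snd -` B) = measure M {\<omega> \<in> space M. X t \<omega> \<in> B}"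
      by (subst measure_distr[OF Ym]) (auto simp: Y_def intro!: arg_cong[where f = "measure M"])
    moreover have "measure_pmf.prob Q (snd -` B) = measure_pmf.prob (map_pmf snd Q) B"
      by simp
    moreover have "map_pmf snd Q = bind_pmf p (trans_pmf S P t)"
      unfolding Q_def by (simp add: map_bind_pmf map_pmf_comp)
    ultimately show ?thesis by simp
  qed
  then show ?thesis using P L by blast
qed

section \<open>The birth-and-death chain of a tagged cluster\<close>

text \<open>The coordinates of the matrix exponential, written as power series.\<close>

lemma linear_ode_solution:
  fixes A :: "'i \<Rightarrow> 'i \<Rightarrow> real" and f :: "'i \<Rightarrow> real"
  assumes fin: "finite I"
  obtains G where "\<And>i. i \<in> I \<Longrightarrow> G i 0 = f i"
    and "\<And>i t. i \<in> I \<Longrightarrow> (G i has_real_derivative (\<Sum>j\<in>I. A i j * G j t)) (at t)"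
proof -
  define u where "u = rec_nat f (\<lambda>k v i. \<Sum>j\<in>I. A i j * v j)"
  have u0: "u 0 = f" and uS: "u (Suc k) i = (\<Sum>j\<in>I. A i j * u k j)" for k i
    by (simp_all add: u_def)
  define M where "M = (\<Sum>i\<in>I. \<Sum>j\<in>I. \<bar>A i j\<bar>)"
  define F where "F = (\<Sum>i\<in>I. \<bar>f i\<bar>)"
  have F0: "F \<ge> 0" unfolding F_def by (intro sum_nonneg) auto
  have M0: "M \<ge> 0" unfolding M_def by (intro sum_nonneg) auto
  have ub: "\<bar>u k i\<bar> \<le> F * M ^ k" if "i \<in> I" for k i
    using that
  proof (induction k arbitrary: i)
    case 0
    then show ?case unfolding F_def u0 using member_le_sum[of i I "\<lambda>i. \<bar>f i\<bar>"] fin by simp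
  next
    case (Suc k)
    have "\<bar>u (Suc k) i\<bar> \<le> (\<Sum>j\<in>I. \<bar>A i j\<bar> * (F * M ^ k))"
      unfolding uS by (rule order_trans[OF sum_abs]) (auto simp: abs_mult intro!: sum_mono mult_left_mono Suc.IH)
    also have "\<dots> = (\<Sum>j\<in>I. \<bar>A i j\<bar>) * (F * M ^ k)" by (simp add: sum_distrib_right)
    also have "\<dots> \<le> M * (F * M ^ k)"
      unfolding M_def using F0 M0 Suc.prems fin
      by (intro mult_right_mono member_le_sum[of i I "\<lambda>i. \<Sum>j\<in>I. \<bar>A i j\<bar>"]) (auto intro!: sum_nonneg mult_nonneg_nonneg zero_le_power simp: M_def[symmetric])
    finally show ?case by (simp add: algebra_simps)
  qed
  define c where "c i k = u k i / fact k" for i k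
  define G where "G i t = (\<Sum>k. c i k * t ^ k)" for i t
  have sm: "summable (\<lambda>k. c i k * t ^ k)" if "i \<in> I" for i and t :: real
  proof (rule summable_comparison_test')
    show "summable (\<lambda>k. F * (inverse (fact k) * (M * \<bar>t\<bar>) ^ k))"
      by (intro summable_mult summable_exp)
    show "norm (c i k * t ^ k) \<le> F * (inverse (fact k) * (M * \<bar>t\<bar>) ^ k)" if "k \<ge> 0" for k
      using mult_right_mono[OF ub[OF \<open>i \<in> I\<close>, of k], of "\<bar>t\<bar> ^ k / fact k"]
      by (simp add: c_def abs_mult power_abs power_mult_distrib field_simps)
  qed
  have "G i 0 = f i" if "i \<in> I" for i using powser_zero[of "c i"] by (simp add: G_def c_def u0)
  moreover have "(G i has_real_derivative (\<Sum>j\<in>I. A i j * G j t)) (at t)" if i: "i \<in> I" for i t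
  proof -
    have d: "diffs (c i) k = (\<Sum>j\<in>I. A i j * c j k)" for k
    proof -
      have "diffs (c i) k = u (Suc k) i / fact k"
        by (simp add: diffs_def c_def nonzero_divide_eq_eq del: of_nat_Suc)
      then show ?thesis by (simp add: uS c_def sum_divide_distrib)
    qed
    have "(G i has_real_derivative (\<Sum>k. diffs (c i) k * t ^ k)) (at t)"
      unfolding G_def by (rule termdiffs_strong_converges_everywhere[OF sm[OF i]])
    also have "(\<Sum>k. diffs (c i) k * t ^ k) = (\<Sum>k. \<Sum>j\<in>I. A i j * (c j k * t ^ k))"
      by (simp add: d sum_distrib_right mult.assoc)
    also have "\<dots> = (\<Sum>j\<in>I. \<Sum>k. A i j * (c j k * t ^ k))"
      by (rule suminf_sum) (intro summable_mult sm)
    also have "\<dots> = (\<Sum>j\<in>I. A i j * G j t)"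
      unfolding G_def by (intro sum.cong refl suminf_mult sm)
    finally show ?thesis .
  qed
  ultimately show thesis by (rule that)
qed

text \<open>The solution of the eigenvalue equation \<open>a i * z * (g (i + 1) - g i) + b i * (g (i - 1) - g i) = - \<mu> * g i\<close>,
\<open>i \<ge> 2\<close>, with \<open>g 1 = 0\<close> and \<open>g 2 = 1\<close>.\<close>

fun bd_sol :: "(nat \<Rightarrow> real) \<Rightarrow> (nat \<Rightarrow> real) \<Rightarrow> real \<Rightarrow> real \<Rightarrow> nat \<Rightarrow> real" where
  "bd_sol a b z \<mu> 0 = 0"
| "bd_sol a b z \<mu> (Suc 0) = 0"
| "bd_sol a b z \<mu> (Suc (Suc 0)) = 1"
| "bd_sol a b z \<mu> (Suc (Suc (Suc n))) =
    ((a (Suc (Suc n)) * z + b (Suc (Suc n)) - \<mu>) * bd_sol a b z \<mu> (Suc (Suc n))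
      - b (Suc (Suc n)) * bd_sol a b z \<mu> (Suc n)) / (a (Suc (Suc n)) * z)"

locale BD_coeffs =
  fixes a b :: "nat \<Rightarrow> real" and z :: real
  assumes z_pos: "z > 0"
    and a_pos: "\<And>i. i \<ge> 1 \<Longrightarrow> a i > 0"
    and b_pos: "\<And>i. i \<ge> 2 \<Longrightarrow> b i > 0"
begin

text \<open>The reversible measure \<open>\<pi>\<close> of the birth-and-death chain, which is also the weight that defines the Hilbert space \<open>H\<close>:
\<open>x\<close> belongs to \<open>H\<close> if and only if \<open>x i / wt i\<close> is square summable with respect to \<open>wt\<close>.\<close>

definition wt :: "nat \<Rightarrow> real" where "wt i = BD_Q a b i * z ^ i"

text \<open>The conductance of the edge between \<open>i\<close> and \<open>i + 1\<close>; detailed balance is the lemma \<open>wt_Suc\<close>.\<close>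

definition kap :: "nat \<Rightarrow> real" where "kap i = a i * z * wt i"

text \<open>The generator of the birth-and-death chain acting on functions. It is conjugate, via multiplication by
\<open>wt\<close>, to the action of the rate matrix on row sequences.\<close>

definition bd_op :: "(nat \<Rightarrow> real) \<Rightarrow> nat \<Rightarrow> real" where
  "bd_op g i = a i * z * (g (i + 1) - g i) + b i * (g (i - 1) - g i)"

lemma wt_1: "wt 1 = z" by (simp add: wt_def BD_Q_def)

lemma wt_pos: "i \<ge> 1 \<Longrightarrow> wt i > 0"
  unfolding wt_def BD_Q_def using z_pos by (auto intro!: mult_pos_pos divide_pos_pos prod_pos a_pos b_pos)

lemma kap_pos: "i \<ge> 1 \<Longrightarrow> kap i > 0"
  unfolding kap_def using z_pos wt_pos a_pos by simp

lemma wt_Suc: assumes "i \<ge> 1" shows "wt (Suc i) * b (Suc i) = kap i"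
proof -
  have "b (Suc i) > 0" using b_pos assms by simp
  moreover have "{Suc 0..<Suc i} = insert i {Suc 0..<i}" "{2..Suc i} = insert (Suc i) {2..i}" using assms by auto
  ultimately show ?thesis
    unfolding kap_def wt_def BD_Q_def by (simp add: field_simps)
qed

lemma wt_b: assumes "i \<ge> 2" shows "wt i * b i = kap (i - 1)"
  using wt_Suc[of "i - 1"] assms by simp

abbreviation "sol \<equiv> bd_sol a b z"

lemma bd_op_sol: assumes "i \<ge> 2" shows "bd_op (sol \<mu>) i = - \<mu> * sol \<mu> i"
proof -
  obtain n where n: "i = Suc (Suc n)" using assms by (metis add_2_eq_Suc le_Suc_ex)
  have "a i * z \<noteq> 0" using a_pos[of i] assms z_pos by simp
  then show ?thesis unfolding bd_op_def n by (simp add: field_simps)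
qed

lemma sol_1: "sol \<mu> 1 = 0" and sol_2: "sol \<mu> 2 = 1"
  by (simp_all add: numeral_2_eq_2)

lemma isCont_sol: "isCont (\<lambda>\<mu>. sol \<mu> i) \<mu>"
  by (induction a b z \<mu> i rule: bd_sol.induct) (auto simp: divide_inverse intro!: continuous_intros)

lemma sol_0_pos: assumes "i \<ge> 2" shows "sol 0 i > 0"
proof -
  have "sol 0 i > 0 \<and> sol 0 i > sol 0 (i - 1)"
    using assms
  proof (induction i rule: dec_induct)
    case base
    then show ?case by (simp add: numeral_2_eq_2)
  next
    case (step n)
    have "a n * z * (sol 0 (Suc n) - sol 0 n) = b n * (sol 0 n - sol 0 (n - 1))"
      using bd_op_sol[of n 0] step.hyps by (simp add: bd_op_def algebra_simps)
    moreover have "b n * (sol 0 n - sol 0 (n - 1)) > 0" using step b_pos[of n] by simp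
    moreover have "a n * z > 0" using step a_pos[of n] z_pos by simp
    ultimately have "sol 0 (Suc n) - sol 0 n > 0" by (metis zero_less_mult_pos)
    then show ?case using step by simp
  qed
  then show ?thesis by simp
qed

text \<open>At a first zero \<open>n + 1\<close> the equation gives the values at \<open>n\<close> and \<open>n + 2\<close> opposite signs.\<close>

lemma sol_nonneg_imp_pos:
  assumes nn: "\<And>i. i \<ge> 2 \<Longrightarrow> sol \<mu> i \<ge> 0" and "i \<ge> 2"
  shows "sol \<mu> i > 0"
  using \<open>i \<ge> 2\<close>
proof (induction i rule: dec_induct)
  case base
  then show ?case by (simp add: numeral_2_eq_2)
next
  case (step n)
  have "a (Suc n) * z * sol \<mu> (Suc (Suc n)) + b (Suc n) * sol \<mu> n =
      (a (Suc n) * z + b (Suc n) - \<mu>) * sol \<mu> (Suc n)"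
    using bd_op_sol[of "Suc n" \<mu>] step.hyps by (simp add: bd_op_def algebra_simps)
  moreover have "b (Suc n) * sol \<mu> n > 0" using step b_pos[of "Suc n"] by simp
  moreover have "a (Suc n) * z * sol \<mu> (Suc (Suc n)) \<ge> 0"
    using a_pos[of "Suc n"] z_pos nn[of "Suc (Suc n)"] step.hyps by simp
  ultimately have "sol \<mu> (Suc n) \<noteq> 0" by auto
  then show ?case using nn[of "Suc n"] step.hyps by simp
qed

text \<open>The quotient of a solution and a strict supersolution has no positive interior maximum. At \<open>N + 1\<close> the
quotient is not positive, so that its maximum over \<open>m..N\<close> is attained at \<open>m\<close>.\<close>

lemma sol_le_supersolution:
  assumes m: "m \<ge> 2" and mN: "m \<le> N" and \<mu>: "\<mu> < \<Lambda>" and r: "r > 0"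
    and super: "\<And>i. i \<ge> m \<Longrightarrow> bd_op (\<lambda>j. r ^ j) i \<le> - \<Lambda> * r ^ i"
    and pos: "\<And>i. m \<le> i \<Longrightarrow> i \<le> N \<Longrightarrow> sol \<mu> i > 0" and neg: "sol \<mu> (Suc N) \<le> 0"
    and i: "m \<le> i" "i \<le> N"
  shows "sol \<mu> i \<le> sol \<mu> m / r ^ m * r ^ i"
proof -
  define k where "k i = sol \<mu> i / r ^ i" for i
  have sk: "sol \<mu> i = k i * r ^ i" for i using r by (simp add: k_def)
  have "Max (k ` {m..N}) \<in> k ` {m..N}" using mN by (intro Max_in) auto
  then obtain p where p: "m \<le> p" "p \<le> N" "k p = Max (k ` {m..N})" by auto
  have max: "k j \<le> k p" if "m \<le> j" "j \<le> N" for j unfolding p(3) using that by (intro Max_ge) auto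
  have kp: "k p > 0" using pos[OF p(1,2)] r by (simp add: k_def)
  have "p = m"
  proof (rule ccontr)
    assume "p \<noteq> m"
    with p have pm: "m < p" by simp
    have up: "k (p + 1) \<le> k p"
    proof (cases "p = N")
      case True
      then have "k (p + 1) \<le> 0" using neg r by (simp add: k_def divide_le_0_iff)
      then show ?thesis using kp by simp
    qed (use p max in auto)
    have down: "k (p - 1) \<le> k p" using pm p(2) by (intro max) auto
    have "- \<mu> * sol \<mu> p = bd_op (sol \<mu>) p" using bd_op_sol m p by simp
    also have "\<dots> \<le> bd_op (\<lambda>j. k p * r ^ j) p"
    proof -
      have "sol \<mu> (p + 1) \<le> k p * r ^ (p + 1)" "sol \<mu> (p - 1) \<le> k p * r ^ (p - 1)"
        unfolding sk using up down r by (auto intro!: mult_right_mono)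
      then show ?thesis unfolding bd_op_def sk[of p] using a_pos[of p] b_pos[of p] z_pos m p
        by (intro add_mono mult_left_mono) auto
    qed
    also have "\<dots> = k p * bd_op (\<lambda>j. r ^ j) p" by (simp add: bd_op_def algebra_simps)
    also have "\<dots> \<le> k p * (- \<Lambda> * r ^ p)" using kp super[OF p(1)] by (intro mult_left_mono) auto
    also have "\<dots> = - \<Lambda> * sol \<mu> p" by (simp add: sk)
    finally show False using \<mu> pos[OF p(1,2)] by simp
  qed
  then show ?thesis using max[OF i] r by (simp add: k_def field_simps)
qed

lemma sol_eigenvector:
  assumes "(\<lambda>i. wt i * (sol \<mu> i)\<^sup>2) summable_on {2..}"
  shows "BD_eigenvalue a b z (- \<mu>)"
  unfolding BD_eigenvalue_def
proof (intro exI[of _ "\<lambda>i. wt i * sol \<mu> i"] conjI allI impI)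
  have "(wt i * sol \<mu> i)\<^sup>2 / (BD_Q a b i * z ^ i) = wt i * (sol \<mu> i)\<^sup>2" if "i \<in> {2..}" for i
    using wt_pos[of i] that unfolding wt_def[symmetric] by (simp add: power2_eq_square)
  then show "in_H a b z (\<lambda>i. wt i * sol \<mu> i)"
    unfolding in_H_def
    by (subst summable_on_cong[where g = "\<lambda>i. wt i * (sol \<mu> i)\<^sup>2"]) (auto simp: assms)
  show "\<exists>i\<ge>2. wt i * sol \<mu> i \<noteq> 0"
    using wt_pos[of 2] sol_2 by (intro exI[of _ 2]) auto
  fix j :: nat assume j: "j \<ge> 2"
  have "(\<Sum>\<^sub>\<infinity>i\<in>{2..}. wt i * sol \<mu> i * BD_rate a b z i j) =
      (\<Sum>\<^sub>\<infinity>i\<in>{j - 1, j, j + 1}. wt i * sol \<mu> i * BD_rate a b z i j)"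
    using j by (intro infsum_cong_neutral) (auto simp: BD_rate_def)
  also have "\<dots> = wt (j - 1) * sol \<mu> (j - 1) * BD_rate a b z (j - 1) j + wt j * sol \<mu> j * BD_rate a b z j j
      + wt (j + 1) * sol \<mu> (j + 1) * BD_rate a b z (j + 1) j"
    using j by (subst infsum_finite, simp, cases j) (auto simp: algebra_simps)
  also have "wt (j - 1) * sol \<mu> (j - 1) * BD_rate a b z (j - 1) j = kap (j - 1) * sol \<mu> (j - 1)"
    using j by (cases "j = 2") (auto simp: BD_rate_def kap_def)
  also have "kap (j - 1) = wt j * b j" using wt_b[OF j] by simp
  also have "wt (j + 1) * sol \<mu> (j + 1) * BD_rate a b z (j + 1) j = kap j * sol \<mu> (j + 1)"
    using j wt_Suc[of j] by (auto simp: BD_rate_def)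
  also have "kap j = wt j * a j * z" by (simp add: kap_def)
  also have "wt j * sol \<mu> j * BD_rate a b z j j = - wt j * sol \<mu> j * (a j * z + b j)"
    using j by (simp add: BD_rate_def algebra_simps)
  also have "wt j * b j * sol \<mu> (j - 1) + - wt j * sol \<mu> j * (a j * z + b j) + wt j * a j * z * sol \<mu> (j + 1)
      = wt j * bd_op (sol \<mu>) j" by (simp add: bd_op_def algebra_simps)
  finally show "(\<Sum>\<^sub>\<infinity>i\<in>{2..}. wt i * sol \<mu> i * BD_rate a b z i j) = - \<mu> * (wt j * sol \<mu> j)"
    using bd_op_sol[OF j] by simp
qed

text \<open>Writing \<open>g = h * (g / h)\<close>, the quadratic form of the generator becomes \<open>- l\<close> times the square of the norm, minus the
Dirichlet form of the quotient \<open>g / h\<close> with conductances \<open>kap i * h i * h (i + 1)\<close>. The proof regroups the terms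
edge by edge: \<open>A i\<close> and \<open>B (i + 1)\<close> are the contributions of the two ends of the edge between \<open>i\<close> and \<open>i + 1\<close>.\<close>

lemma ground_state_inequality:
  assumes h: "\<And>i. i \<ge> 2 \<Longrightarrow> h i > 0" "h 1 = 0" "\<And>i. i \<ge> 2 \<Longrightarrow> bd_op h i = - l * h i"
    and g: "g 1 = 0" "g (Suc N) = 0" and N: "N \<ge> 2"
  shows "(\<Sum>i=2..N. wt i * (g i * bd_op g i)) \<le> - l * (\<Sum>i=2..N. wt i * (g i)\<^sup>2)"
proof -
  define A where "A i = kap i * (g i * g (Suc i) - (g i)\<^sup>2 * (h (Suc i) / h i))" for i
  define B where "B i = kap (i - 1) * (g i * g (i - 1) - (g i)\<^sup>2 * (h (i - 1) / h i))" for i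
  have AB: "A i + B (Suc i) \<le> 0" if "i \<ge> 2" for i
  proof -
    have hi: "h i > 0" "h (Suc i) > 0" using h that by auto
    have "A i + B (Suc i) = - kap i * (h i * h (Suc i) * (g i / h i - g (Suc i) / h (Suc i))\<^sup>2)"
      using hi by (simp add: A_def B_def power2_eq_square field_simps)
    then show ?thesis using kap_pos[of i] that hi by (simp add: mult_nonneg_nonneg)
  qed
  have "(\<Sum>i=2..n. A i + B i) \<le> A n" if "n \<ge> 2" for n
    using that
  proof (induction n rule: dec_induct)
    case base
    have "B 2 = 0" unfolding B_def using g(1) h(2) by simp
    then show ?case by simp
  next
    case (step n)
    then show ?case using AB[of n] by simp
  qed
  from this[OF N] have "(\<Sum>i=2..N. A i + B i) \<le> A N" .
  also have "A N \<le> 0" using kap_pos[of N] h(1)[of N] h(1)[of "Suc N"] N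
    unfolding A_def g by (simp add: mult_nonneg_nonneg)
  finally have "(\<Sum>i=2..N. A i + B i) \<le> 0" .
  moreover have "A i + B i = wt i * (g i * bd_op g i) + l * (wt i * (g i)\<^sup>2)" if "i \<in> {2..N}" for i
  proof -
    have i: "i \<ge> 2" and hi: "h i > 0" using that h(1) by auto
    have e: "a i * z * (h (Suc i) - h i) + b i * (h (i - 1) - h i) = - l * h i"
      using h(3)[OF i] by (simp add: bd_op_def)
    have "A i + B i = wt i * (g i * bd_op g i) - wt i * (g i)\<^sup>2 / h i * (a i * z * (h (Suc i) - h i) + b i * (h (i - 1) - h i))"
      unfolding A_def B_def wt_b[OF i, symmetric] kap_def[of i] bd_op_def using hi
      by (simp add: power2_eq_square field_simps)
    then show ?thesis unfolding e using hi by (simp add: algebra_simps)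
  qed
  ultimately have "(\<Sum>i=2..N. wt i * (g i * bd_op g i) + l * (wt i * (g i)\<^sup>2)) \<le> 0" by simp
  then show ?thesis by (simp add: sum.distrib sum_distrib_left sum_negf)
qed

text \<open>The birth-and-death equation killed outside \<open>2..N\<close>. Its solution \<open>G\<close> vanishes outside this range, so the boundary
terms in the ground state inequality vanish, and \<open>exp (2 * l * t)\<close> times the square of its norm decreases.\<close>

lemma truncated_decay:
  assumes h: "\<And>i. i \<ge> 2 \<Longrightarrow> h i > 0" "h 1 = 0" "\<And>i. i \<ge> 2 \<Longrightarrow> bd_op h i = - l * h i"
    and N: "N \<ge> 2"
  obtains G where
    "\<And>i. i \<in> {2..N} \<Longrightarrow> G i 0 = \<eta> i"
    "\<And>i t. i \<notin> {2..N} \<Longrightarrow> G i t = 0"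
    "\<And>i t. i \<in> {2..N} \<Longrightarrow> (G i has_real_derivative bd_op (\<lambda>j. G j t) i) (at t)"
    "\<And>t. t \<ge> 0 \<Longrightarrow> (\<Sum>i=2..N. wt i * (G i t)\<^sup>2) \<le> exp (- 2 * l * t) * (\<Sum>i=2..N. wt i * (\<eta> i)\<^sup>2)"
proof -
  \<comment> \<open>Matrix of the generator restricted to the sizes in question.\<close>
  define A where "A i j = bd_op (\<lambda>k. if k = j then 1 else 0) i" for i j
  obtain G0 where G0: "\<And>i. i \<in> {2..N} \<Longrightarrow> G0 i 0 = \<eta> i"
    "\<And>i t. i \<in> {2..N} \<Longrightarrow> (G0 i has_real_derivative (\<Sum>j\<in>{2..N}. A i j * G0 j t)) (at t)"
    using linear_ode_solution[of "{2..N}" \<eta> A] by blast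
  define G where "G i t = (if i \<in> {2..N} then G0 i t else 0)" for i t
  have A: "(\<Sum>j\<in>{2..N}. A i j * G0 j t) = bd_op (\<lambda>j. G j t) i" for i t
  proof -
    have d: "(\<Sum>j\<in>{2..N}. (if k = j then 1 else 0) * G0 j t) = G k t" for k
      unfolding G_def by (simp add: if_distrib[of "\<lambda>c. c * _"] cong: if_cong)
    have "(\<Sum>j\<in>{2..N}. A i j * G0 j t) = a i * z * ((\<Sum>j\<in>{2..N}. (if i + 1 = j then 1 else 0) * G0 j t)
        - (\<Sum>j\<in>{2..N}. (if i = j then 1 else 0) * G0 j t))
      + b i * ((\<Sum>j\<in>{2..N}. (if i - 1 = j then 1 else 0) * G0 j t) - (\<Sum>j\<in>{2..N}. (if i = j then 1 else 0) * G0 j t))"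
      unfolding A_def bd_op_def sum_subtractf[symmetric] sum_distrib_left sum.distrib[symmetric]
      by (intro sum.cong refl) (simp add: algebra_simps)
    then show ?thesis unfolding d bd_op_def .
  qed
  have Gd: "(G i has_real_derivative bd_op (\<lambda>j. G j t) i) (at t)" if "i \<in> {2..N}" for i t
  proof -
    have "G i = G0 i" using that by (auto simp: G_def)
    then show ?thesis using G0(2)[OF that, of t] A by simp
  qed
  define E where "E t = (\<Sum>i=2..N. wt i * (G i t)\<^sup>2)" for t
  have Ed: "((\<lambda>t. exp (2 * l * t) * E t) has_real_derivative
      exp (2 * l * t) * (2 * l * E t + 2 * (\<Sum>i=2..N. wt i * (G i t * bd_op (\<lambda>j. G j t) i)))) (at t)" for t
    unfolding E_def
    by (rule derivative_eq_intros Gd refl | assumption | simp)+ (simp add: sum_distrib_left algebra_simps)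
  have "E t \<le> exp (- 2 * l * t) * E 0" if t: "t \<ge> 0" for t
  proof -
    have "exp (2 * l * t) * E t \<le> exp (2 * l * 0) * E 0"
    proof (rule DERIV_nonpos_imp_nonincreasing[OF t])
      fix s
      have "(\<Sum>i=2..N. wt i * (G i s * bd_op (\<lambda>j. G j s) i)) \<le> - l * E s"
        unfolding E_def by (rule ground_state_inequality[OF h]) (use N in \<open>auto simp: G_def\<close>)
      then show "\<exists>y. ((\<lambda>t. exp (2 * l * t) * E t) has_real_derivative y) (at s) \<and> y \<le> 0"
        by (intro exI[of _ "exp (2 * l * s) * (2 * l * E s + 2 * (\<Sum>i=2..N. wt i * (G i s * bd_op (\<lambda>j. G j s) i)))"]
          conjI Ed mult_nonneg_nonpos) auto
    qed
    then show ?thesis by (simp add: exp_minus field_simps)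
  qed
  moreover have "E 0 = (\<Sum>i=2..N. wt i * (\<eta> i)\<^sup>2)"
    unfolding E_def using G0(1) by (intro sum.cong) (auto simp: G_def)
  ultimately show thesis
    by (intro that[of G]) (use G0(1) Gd in \<open>auto simp: G_def E_def\<close>)
qed

end

section \<open>Positivity of the solution at the spectral constant\<close>

locale BD_asymp = BD_coeffs +
  fixes zs :: real
  assumes zs_pos: "zs > 0"
    and b_a_lim: "(\<lambda>i. b i / a i) \<longlonglongrightarrow> zs"
    and b_ratio_lim: "(\<lambda>i. b (i + 1) / b i) \<longlonglongrightarrow> 1"
    and a_linear: "a \<in> O(\<lambda>i. real i)"
    and a_at_top: "filterlim a at_top sequentially"
    and z_ne_zs: "z \<noteq> zs"
begin

lemma a_b_lim: "(\<lambda>i. a i / b i) \<longlonglongrightarrow> 1 / zs"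
  using tendsto_inverse[OF b_a_lim] zs_pos by (simp add: inverse_eq_divide)

lemma kap_ratio_lim: "(\<lambda>i. kap (Suc i) / kap i) \<longlonglongrightarrow> z / zs"
proof -
  have "(\<lambda>i. z * (a (Suc i) / b (Suc i))) \<longlonglongrightarrow> z * (1 / zs)"
    by (rule tendsto_mult[OF tendsto_const LIMSEQ_Suc[OF a_b_lim]])
  then have "(\<lambda>i. kap (Suc i) / kap i) \<longlonglongrightarrow> z * (1 / zs)"
  proof (rule Lim_transform_eventually)
    show "\<forall>\<^sub>F i in sequentially. z * (a (Suc i) / b (Suc i)) = kap (Suc i) / kap i"
      using eventually_ge_at_top[of 1]
    proof eventually_elim
      case (elim i)
      then show ?case
        using wt_pos[of "Suc i"] b_pos[of "Suc i"] unfolding wt_Suc[OF elim, symmetric] kap_def[of "Suc i"] by (simp add: field_simps)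
    qed
  qed
  then show ?thesis by simp
qed

lemma wt_ratio_lim: "(\<lambda>i. wt (Suc i) / wt i) \<longlonglongrightarrow> z / zs"
proof -
  have "(\<lambda>i. z * (a i / b i) * inverse (b (i + 1) / b i)) \<longlonglongrightarrow> z * (1 / zs) * inverse 1"
    by (rule tendsto_mult[OF tendsto_mult[OF tendsto_const a_b_lim] tendsto_inverse[OF b_ratio_lim]]) simp
  then have "(\<lambda>i. wt (Suc i) / wt i) \<longlonglongrightarrow> z * (1 / zs) * inverse 1"
  proof (rule Lim_transform_eventually)
    show "\<forall>\<^sub>F i in sequentially. z * (a i / b i) * inverse (b (i + 1) / b i) = wt (Suc i) / wt i"
      using eventually_ge_at_top[of 2]
    proof eventually_elim
      case (elim i)
      then have "wt (Suc i) * b (Suc i) = a i * z * wt i" using wt_Suc[of i] by (simp add: kap_def)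
      then show ?case
        using elim wt_pos[of i] b_pos[of "Suc i"] b_pos[of i] by (simp add: field_simps)
    qed
  qed
  then show ?thesis by simp
qed

text \<open>On \<open>r ^ i\<close> the generator acts as multiplication by \<open>a i * (r - 1) * (z - (b i / a i) / r)\<close>. The sign of this factor is
negative at infinity if \<open>r\<close> lies strictly between 1 and \<open>zs / z\<close>, and it tends to minus infinity with \<open>a i\<close>. The additional
bound \<open>r\<^sup>2 < zs / z\<close> makes \<open>r ^ i\<close> square summable with respect to \<open>wt\<close>.\<close>

lemma power_supersolution_at_infinity:
  obtains r m where "r > 0" "r\<^sup>2 * (z / zs) < 1" "m \<ge> 2"
    "\<And>i. i \<ge> m \<Longrightarrow> bd_op (\<lambda>j. r ^ j) i \<le> - \<Lambda> * r ^ i"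
proof -
  \<comment> \<open>The harmonic mean of 1 and \<open>zs / z\<close>: strictly between them, and strictly below their geometric mean.\<close>
  define r where "r = 2 * zs / (z + zs)"
  have r: "r > 0" using z_pos zs_pos by (simp add: r_def)
  have sq: "(z - zs)\<^sup>2 > 0" using z_ne_zs by simp
  have "4 * zs * z < (z + zs)\<^sup>2" using sq by (simp add: power2_eq_square algebra_simps)
  then have r2: "r\<^sup>2 * (z / zs) < 1"
  proof -
    have "r\<^sup>2 * (z / zs) = 4 * zs * z / (z + zs)\<^sup>2"
      using zs_pos by (simp add: r_def power2_eq_square field_simps)
    then show ?thesis using \<open>4 * zs * z < _\<close> z_pos zs_pos by simp
  qed
  define c where "c = (z - zs)\<^sup>2 / (2 * (z + zs))"
  have c: "c > 0" using sq z_pos zs_pos by (simp add: c_def)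
  have lim: "(\<lambda>i. (r - 1) * (z - (b i / a i) / r)) \<longlonglongrightarrow> (r - 1) * (z - zs / r)"
    using r by (intro tendsto_intros b_a_lim) auto
  have "(r - 1) * (z - zs / r) = - c"
  proof -
    have e: "r - 1 = (zs - z) / (z + zs)" "z - zs / r = (z - zs) / 2"
    proof -
      have "zs / r = (z + zs) / 2" using zs_pos by (simp add: r_def)
      then show "z - zs / r = (z - zs) / 2" by (simp add: diff_divide_distrib add_divide_distrib)
      have "2 * zs = (zs - z) + (z + zs)" by simp
      then have "r = (zs - z) / (z + zs) + (z + zs) / (z + zs)"
        unfolding r_def by (metis add_divide_distrib)
      then show "r - 1 = (zs - z) / (z + zs)" using z_pos zs_pos by simp
    qed
    have "(zs - z) / (z + zs) * ((z - zs) / 2) = - c"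
    proof -
      have "(zs - z) * (z - zs) = - ((z - zs)\<^sup>2)" by (simp add: power2_eq_square algebra_simps)
      then have "(zs - z) / (z + zs) * ((z - zs) / 2) = - ((z - zs)\<^sup>2) / ((z + zs) * 2)"
        by (simp only: times_divide_times_eq)
      then show ?thesis by (simp only: c_def minus_divide_left mult.commute)
    qed
    then show ?thesis unfolding e .
  qed
  then have ev1: "\<forall>\<^sub>F i in sequentially. (r - 1) * (z - (b i / a i) / r) < - c / 2"
    using order_tendstoD(2)[OF lim, of "- c / 2"] c by simp
  have ev2: "\<forall>\<^sub>F i in sequentially. a i \<ge> 2 * \<bar>\<Lambda>\<bar> / c"
    using a_at_top by (simp add: filterlim_at_top)
  have "\<forall>\<^sub>F i in sequentially. bd_op (\<lambda>j. r ^ j) i \<le> - \<Lambda> * r ^ i"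
    using ev1 ev2 eventually_ge_at_top[of 2]
  proof eventually_elim
    case (elim i)
    have ai: "a i > 0" using a_pos elim(3) by simp
    obtain j where j: "i = Suc j" using elim(3) by (cases i) auto
    have "bd_op (\<lambda>j. r ^ j) i = r ^ i * (a i * ((r - 1) * (z - (b i / a i) / r)))"
      unfolding bd_op_def using ai r by (simp add: j field_simps)
    also have "\<dots> \<le> r ^ i * (a i * (- c / 2))"
      using r ai elim(1) by (intro mult_left_mono) auto
    also have "\<dots> \<le> r ^ i * (- \<Lambda>)"
    proof (intro mult_left_mono)
      have "2 * \<bar>\<Lambda>\<bar> \<le> a i * c" using elim(2) c by (simp add: field_simps)
      then show "a i * (- c / 2) \<le> - \<Lambda>" by simp
    qed (use r in auto)
    finally show ?case by (simp add: algebra_simps)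
  qed
  then obtain m where "\<And>i. i \<ge> m \<Longrightarrow> bd_op (\<lambda>j. r ^ j) i \<le> - \<Lambda> * r ^ i"
    by (auto simp: eventually_sequentially)
  then show thesis by (intro that[of r "max m 2"] r r2) auto
qed

text \<open>Up to its first change of sign each approximating solution is dominated by a multiple of the
supersolution \<open>r ^ i\<close>, whose factor only involves the value at the fixed size \<open>m\<close>. The changes of sign move to
infinity, because the limit is positive at every fixed size, so the domination passes to the limit.\<close>

lemma sol_critical_square_summable:
  assumes "\<mu>s \<longlonglongrightarrow> \<mu>" and pos: "\<And>i. i \<ge> 2 \<Longrightarrow> sol \<mu> i > 0"
    and change: "\<And>n. \<exists>i\<ge>2. sol (\<mu>s n) i \<le> 0"
  shows "(\<lambda>i. wt i * (sol \<mu> i)\<^sup>2) summable_on {2..}"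
proof -
  obtain r m where r: "r > 0" "r\<^sup>2 * (z / zs) < 1" and m: "m \<ge> 2" and
    super: "\<And>i. i \<ge> m \<Longrightarrow> bd_op (\<lambda>j. r ^ j) i \<le> - (\<mu> + 1) * r ^ i"
    using power_supersolution_at_infinity by blast
  have lim: "(\<lambda>n. sol (\<mu>s n) i) \<longlonglongrightarrow> sol \<mu> i" for i
    using isCont_tendsto_compose[OF isCont_sol assms(1)] .
  define c where "c = sol \<mu> m / r ^ m"
  have bound: "sol \<mu> i \<le> c * r ^ i" if i: "i \<ge> m" for i
  proof (rule LIMSEQ_le)
    show "(\<lambda>n. sol (\<mu>s n) i) \<longlonglongrightarrow> sol \<mu> i" by (rule lim)
    show "(\<lambda>n. sol (\<mu>s n) m / r ^ m * r ^ i) \<longlonglongrightarrow> c * r ^ i"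
      unfolding c_def using r by (intro tendsto_intros lim) auto
    have ev: "\<forall>\<^sub>F n in sequentially. \<forall>j\<in>{2..i}. sol (\<mu>s n) j > 0"
      by (intro eventually_ball_finite ballI order_tendstoD(1)[OF lim] pos) auto
    have ev2: "\<forall>\<^sub>F n in sequentially. \<mu>s n < \<mu> + 1"
      by (rule order_tendstoD(2)[OF assms(1)]) simp
    have "\<forall>\<^sub>F n in sequentially. sol (\<mu>s n) i \<le> sol (\<mu>s n) m / r ^ m * r ^ i"
      using ev ev2
    proof eventually_elim
      case (elim n)
      define p where "p = (LEAST j. j \<ge> 2 \<and> sol (\<mu>s n) j \<le> 0)"
      have p: "p \<ge> 2" "sol (\<mu>s n) p \<le> 0"
        using LeastI_ex[of "\<lambda>j. j \<ge> 2 \<and> sol (\<mu>s n) j \<le> 0"] change[of n] unfolding p_def by blast+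
      have least: "sol (\<mu>s n) j > 0" if "2 \<le> j" "j < p" for j
        using not_less_Least[of j "\<lambda>j. j \<ge> 2 \<and> sol (\<mu>s n) j \<le> 0"] that unfolding p_def by auto
      have "i < p"
      proof (rule ccontr)
        assume "\<not> i < p"
        then show False using elim(1) p by force
      qed
      then obtain N where N: "p = Suc N" "i \<le> N" by (cases p) auto
      show ?case
        by (rule sol_le_supersolution[OF m _ elim(2) r(1) super, of N]) (use N i m p least in auto)
    qed
    then show "\<exists>N. \<forall>n\<ge>N. sol (\<mu>s n) i \<le> sol (\<mu>s n) m / r ^ m * r ^ i"
      by (simp add: eventually_sequentially)
  qed
  have sm: "summable (\<lambda>i. wt i * r ^ (2 * i))"
  proof (rule summable_ratio_limit)
    show "wt i * r ^ (2 * i) > 0" if "i \<ge> 1" for i using wt_pos[OF that] r by simp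
    have "(\<lambda>i. r\<^sup>2 * (wt (Suc i) / wt i)) \<longlonglongrightarrow> r\<^sup>2 * (z / zs)"
      by (rule tendsto_mult[OF tendsto_const wt_ratio_lim])
    moreover have "r\<^sup>2 * (wt (Suc i) / wt i) = wt (Suc i) * r ^ (2 * Suc i) / (wt i * r ^ (2 * i))" for i
      using r by (simp add: power2_eq_square)
    ultimately show "(\<lambda>i. wt (Suc i) * r ^ (2 * Suc i) / (wt i * r ^ (2 * i))) \<longlonglongrightarrow> r\<^sup>2 * (z / zs)" by simp
  qed (rule r(2))
  have "summable (\<lambda>i. norm (wt i * (sol \<mu> i)\<^sup>2))"
  proof (rule summable_comparison_test_ev)
    show "summable (\<lambda>i. c\<^sup>2 * (wt i * r ^ (2 * i)))" using sm by (rule summable_mult)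
    show "\<forall>\<^sub>F i in sequentially. norm (norm (wt i * (sol \<mu> i)\<^sup>2)) \<le> c\<^sup>2 * (wt i * r ^ (2 * i))"
      using eventually_ge_at_top[of m]
    proof eventually_elim
      case (elim i)
      have "(sol \<mu> i)\<^sup>2 \<le> (c * r ^ i)\<^sup>2"
        using bound[OF elim] pos[of i] elim m by (intro power_mono) auto
      then have "wt i * (sol \<mu> i)\<^sup>2 \<le> wt i * (c * r ^ i)\<^sup>2"
        using wt_pos[of i] elim m by (intro mult_left_mono) auto
      also have "\<dots> = c\<^sup>2 * (wt i * r ^ (2 * i))" by (simp add: power_mult_distrib power_even_eq)
      finally show ?case using wt_pos[of i] elim m by simp
    qed
  qed
  then have "(\<lambda>i. wt i * (sol \<mu> i)\<^sup>2) summable_on UNIV"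
    by (rule norm_summable_imp_summable_on)
  then show ?thesis by (rule summable_on_subset_banach) auto
qed

text \<open>If positivity failed, and \<open>\<mu>\<close> were the first parameter beyond which it fails, then \<open>- \<mu>\<close> would be an eigenvalue above the
maximal one.\<close>

theorem sol_spectral_constant_pos:
  assumes lam: "BD_spectral_constant a b z lam" and "i \<ge> 2"
  shows "sol lam i > 0"
proof (rule ccontr)
  assume "\<not> sol lam i > 0"
  \<comment> \<open>Parameters for which positivity fails. The infimum of \<open>T\<close> does not belong to \<open>T\<close>.\<close>
  define T where "T = {\<mu>\<in>{0..lam}. \<exists>i\<ge>2. sol \<mu> i \<le> 0}"
  have lam0: "lam > 0" using lam by (simp add: BD_spectral_constant_def)
  have lamT: "lam \<in> T" using \<open>\<not> sol lam i > 0\<close> assms(2) lam0 by (auto simp: T_def not_less)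
  have bdd: "bdd_below T" by (rule bdd_belowI[of _ 0]) (auto simp: T_def)
  define \<mu> where "\<mu> = Inf T"
  have \<mu>: "0 \<le> \<mu>" "\<mu> \<le> lam"
    unfolding \<mu>_def using lamT bdd by (auto intro!: cInf_greatest cInf_lower) (auto simp: T_def)
  have nn: "sol \<mu> j \<ge> 0" if j: "j \<ge> 2" for j
  proof (rule ccontr)
    assume neg: "\<not> sol \<mu> j \<ge> 0"
    then have "\<mu> \<noteq> 0" using sol_0_pos[OF j] by auto
    with \<mu> have mu0: "\<mu> > 0" by simp
    have "((\<lambda>\<mu>. sol \<mu> j) \<longlongrightarrow> sol \<mu> j) (at_left \<mu>)"
      using isCont_sol[of \<mu> j] by (simp add: isCont_def filterlim_at_split)
    then have "\<forall>\<^sub>F x in at_left \<mu>. sol x j < 0" using neg by (intro order_tendstoD) auto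
    moreover have "\<forall>\<^sub>F x in at_left \<mu>. x \<in> {0<..<\<mu>}" using eventually_at_left_real[OF mu0] .
    ultimately have "\<forall>\<^sub>F x in at_left \<mu>. sol x j < 0 \<and> x \<in> {0<..<\<mu>}" by (rule eventually_conj)
    then obtain x where x: "sol x j < 0" "0 < x" "x < \<mu>"
      using eventually_happens'[of "at_left \<mu>"] by auto
    then have "x \<in> T" using j \<mu> by (force simp: T_def)
    then have "\<mu> \<le> x" unfolding \<mu>_def by (rule cInf_lower[OF _ bdd])
    then show False using x by simp
  qed
  have pos: "sol \<mu> j > 0" if "j \<ge> 2" for j using sol_nonneg_imp_pos[OF nn that] .
  have "\<mu> \<in> closure T" unfolding \<mu>_def using lamT bdd by (intro closure_contains_Inf) auto
  then obtain \<mu>s where \<mu>s: "\<And>n. \<mu>s n \<in> T" "\<mu>s \<longlonglongrightarrow> \<mu>" by (auto simp: closure_sequential)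
  have "BD_eigenvalue a b z (- \<mu>)"
    by (rule sol_eigenvector, rule sol_critical_square_summable[OF \<mu>s(2) pos]) (use \<mu>s(1) in \<open>auto simp: T_def\<close>)
  then have "lam \<le> \<mu>" using lam by (auto simp: BD_spectral_constant_def)
  then have "\<mu> = lam" using \<mu> by simp
  then show False using pos lamT by (force simp: T_def)
qed

end

section \<open>Configurations and the Becker--Doering generator\<close>

text \<open>A cluster of size 1 is a monomer and is not recorded, so adding one changes nothing. This makes the dissolution of a
dimer a case of the rule for \<open>move_cl\<close>.\<close>

definition add_cl :: "(nat \<Rightarrow> nat) \<Rightarrow> nat \<Rightarrow> nat \<Rightarrow> nat" where
  "add_cl x i = (if i \<ge> 2 then x(i := x i + 1) else x)"

text \<open>One cluster changes its size from \<open>k\<close> to \<open>j\<close>. If \<open>x k = 0\<close>, it only occurs with the factor \<open>x k\<close>.\<close>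

definition move_cl :: "(nat \<Rightarrow> nat) \<Rightarrow> nat \<Rightarrow> nat \<Rightarrow> nat \<Rightarrow> nat" where
  "move_cl x k j = add_cl (x(k := x k - 1)) j"

definition diff_cl :: "((nat \<Rightarrow> nat) \<Rightarrow> real) \<Rightarrow> nat \<Rightarrow> (nat \<Rightarrow> nat) \<Rightarrow> real" where
  "diff_cl \<phi> i x = \<phi> (add_cl x i) - \<phi> x"

lemma diff_cl_1 [simp]: "diff_cl \<phi> (Suc 0) x = 0"
  by (simp add: diff_cl_def add_cl_def)

lemma BD_states_upd:
  assumes "x \<in> BD_states" "i \<ge> 2"
  shows "x(i := v) \<in> BD_states"
proof -
  have "finite {k. (x(i := v)) k \<noteq> 0}"
    by (rule finite_subset[of _ "insert i {k. x k \<noteq> 0}"]) (use assms in \<open>auto simp: BD_states_def\<close>)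
  then show ?thesis using assms unfolding BD_states_def by simp
qed

lemma add_cl_in [simp]: "x \<in> BD_states \<Longrightarrow> add_cl x i \<in> BD_states"
  by (simp add: add_cl_def BD_states_upd)

lemma move_cl_in: "x \<in> BD_states \<Longrightarrow> k \<ge> 2 \<Longrightarrow> move_cl x k j \<in> BD_states"
  by (simp add: move_cl_def BD_states_upd)

lemma BD_states_bound:
  assumes "x \<in> BD_states"
  obtains N where "N \<ge> n" "\<forall>i\<ge>N. x i = 0"
proof -
  have "finite {k. x k \<noteq> 0}" using assms by (simp add: BD_states_def)
  then obtain m where "\<And>k. x k \<noteq> 0 \<Longrightarrow> k < m" by (auto simp: finite_nat_set_iff_bounded)
  then show ?thesis by (intro that[of "max n m"]) (force simp: not_less[symmetric])+
qed

lemma move_add_cl: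
  "i \<ge> 2 \<Longrightarrow> x k > 0 \<Longrightarrow> move_cl (add_cl x i) k j = add_cl (move_cl x k j) i"
  by (auto simp: move_cl_def add_cl_def fun_eq_iff)

lemma move_add_cl_same: "i \<ge> 2 \<Longrightarrow> move_cl (add_cl x i) i j = add_cl x j"
  by (auto simp: move_cl_def add_cl_def fun_eq_iff)

text \<open>The additive functional with the value \<open>d k\<close> for each cluster of size \<open>k\<close>. Summing over the support
avoids a bound on the sizes present.\<close>

definition load :: "(nat \<Rightarrow> real) \<Rightarrow> (nat \<Rightarrow> nat) \<Rightarrow> real" where
  "load d x = (\<Sum>k | x k \<noteq> 0. real (x k) * d k)"

lemma load_sum:
  assumes "x \<in> BD_states" "\<forall>i\<ge>N. x i = 0"
  shows "load d x = (\<Sum>k\<in>{2..<N}. real (x k) * d k)"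
  unfolding load_def
proof (rule sum.mono_neutral_left)
  show "{k. x k \<noteq> 0} \<subseteq> {2..<N}"
  proof
    fix k assume "k \<in> {k. x k \<noteq> 0}"
    then have "x k \<noteq> 0" "k \<noteq> 0" "k \<noteq> 1" using assms(1) by (auto simp: BD_states_def) (metis gr0I)
    then show "k \<in> {2..<N}" using assms(2) by (cases "k < N") auto
  qed
qed auto

lemma load_add_cl:
  assumes x: "x \<in> BD_states" and i: "i \<ge> 2"
  shows "load d (add_cl x i) = load d x + d i"
proof -
  obtain N where N: "N \<ge> i + 1" "\<forall>k\<ge>N. x k = 0" using BD_states_bound[OF x] by blast
  have z: "\<forall>k\<ge>N. add_cl x i k = 0" using N by (auto simp: add_cl_def)
  have "load d (add_cl x i) = (\<Sum>k\<in>{2..<N}. real (x k) * d k + (if k = i then d i else 0))"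
    unfolding load_sum[OF add_cl_in[OF x] z]
    by (intro sum.cong) (use i in \<open>auto simp: add_cl_def algebra_simps\<close>)
  also have "\<dots> = load d x + d i"
    unfolding load_sum[OF x N(2)] sum.distrib using N i by simp
  finally show ?thesis .
qed

definition mass_cl :: "(nat \<Rightarrow> nat) \<Rightarrow> nat" where
  "mass_cl x = (\<Sum>k | x k \<noteq> 0. k * x k)"

lemma mass_cl_load: "real (mass_cl x) = load real x"
  by (simp add: mass_cl_def load_def mult.commute)

lemma mass_cl_add:
  assumes x: "x \<in> BD_states"
  shows "mass_cl (add_cl x i) = mass_cl x + (if i \<ge> 2 then i else 0)"
proof (cases "i \<ge> 2")
  case True
  have "real (mass_cl (add_cl x i)) = real (mass_cl x + i)"
    using load_add_cl[OF x True, of real] by (simp add: mass_cl_load)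
  then show ?thesis using True by (simp only: of_nat_eq_iff if_True)
qed (simp add: add_cl_def)

lemma mass_cl_move:
  assumes x: "x \<in> BD_states" and k: "k \<ge> 2" "x k > 0"
  shows "mass_cl (move_cl x k j) + k = mass_cl x + (if j \<ge> 2 then j else 0)"
proof -
  define y where "y = x(k := x k - 1)"
  have y: "y \<in> BD_states" unfolding y_def by (rule BD_states_upd[OF x k(1)])
  have "add_cl y k = x" using k by (auto simp: y_def add_cl_def)
  then show ?thesis using mass_cl_add[OF y, of k] mass_cl_add[OF y, of j] k by (simp add: move_cl_def y_def)
qed

lemma finite_mass_cl_le: "finite {x \<in> BD_states. mass_cl x \<le> R}"
proof (rule finite_subset)
  show "finite {f. \<forall>k. (k \<in> {..R} \<longrightarrow> f k \<in> {..R}) \<and> (k \<notin> {..R} \<longrightarrow> f k = (0::nat))}"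
    by (rule finite_set_of_finite_funs) auto
  show "{x \<in> BD_states. mass_cl x \<le> R} \<subseteq> {f. \<forall>k. (k \<in> {..R} \<longrightarrow> f k \<in> {..R}) \<and> (k \<notin> {..R} \<longrightarrow> f k = 0)}"
  proof (intro subsetI CollectI allI)
    fix x k assume "x \<in> {x \<in> BD_states. mass_cl x \<le> R}"
    then have x: "x \<in> BD_states" "mass_cl x \<le> R" by auto
    have "k \<le> R \<and> x k \<le> R" if "x k \<noteq> 0"
    proof -
      have "k * x k \<le> mass_cl x"
        unfolding mass_cl_def using x that by (intro member_le_sum) (auto simp: BD_states_def)
      moreover have "k \<noteq> 0" using that x by (auto simp: BD_states_def) (metis gr0I)
      ultimately have "k * x k \<le> R" "k \<ge> 1" "x k \<ge> 1" using x(2) that by auto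
      moreover have "k * 1 \<le> k * x k" "1 * x k \<le> k * x k"
        using \<open>k \<ge> 1\<close> \<open>x k \<ge> 1\<close> by (intro mult_le_mono; simp)+
      ultimately show ?thesis by linarith
    qed
    then show "(k \<in> {..R} \<longrightarrow> x k \<in> {..R}) \<and> (k \<notin> {..R} \<longrightarrow> x k = 0)"
      by (cases "x k = 0") auto
  qed
qed

lemma countable_BD_states: "countable BD_states"
proof -
  have "BD_states = (\<Union>R. {x \<in> BD_states. mass_cl x \<le> R})" by auto
  moreover have "countable (\<Union>R. {x \<in> BD_states. mass_cl x \<le> R})"
    by (intro countable_UN countableI_type countable_finite finite_mass_cl_le)
  ultimately show ?thesis by simp
qed

context BD_coeffs
begin

abbreviation "gen \<equiv> BD_generator a b z"

text \<open>The definition sums over the edges between consecutive sizes; here the terms are regrouped by the size of the cluster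
that reacts, as the additivity in the clusters is visible only in this form.\<close>

lemma gen_expand:
  assumes x: "x \<in> BD_states" and N: "N \<ge> 2" "\<forall>i\<ge>N. x i = 0"
  shows "gen \<phi> x = a 1 * z * z * (\<phi> (add_cl x 2) - \<phi> x) +
    (\<Sum>k\<in>{2..<N}. real (x k) * (a k * z * (\<phi> (move_cl x k (k + 1)) - \<phi> x) + b k * (\<phi> (move_cl x k (k - 1)) - \<phi> x)))"
proof -
  define up where "up i = a i * z * BD_conc z x i * (\<phi> (add_jump x (BD_jump i)) - \<phi> x)" for i
  define down where "down i = b (i + 1) * BD_conc z x (i + 1) * (\<phi> (add_jump x (\<lambda>j. - BD_jump i j)) - \<phi> x)" for i
  define up' where "up' k = real (x k) * (a k * z * (\<phi> (move_cl x k (k + 1)) - \<phi> x))" for k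
  define down' where "down' k = real (x k) * (b k * (\<phi> (move_cl x k (k - 1)) - \<phi> x))" for k
  have "gen \<phi> x = (\<Sum>\<^sub>\<infinity>i\<in>{1..}. up i + down i)" by (simp add: BD_generator_def up_def down_def)
  also have "\<dots> = (\<Sum>\<^sub>\<infinity>i\<in>{1..<N}. up i + down i)"
    by (intro infsum_cong_neutral) (use N in \<open>auto simp: up_def down_def BD_conc_def\<close>)
  also have "\<dots> = (\<Sum>i\<in>{1..<N}. up i) + (\<Sum>i\<in>{1..<N}. down i)" by (simp add: sum.distrib)
  also have "(\<Sum>i\<in>{1..<N}. up i) = up 1 + (\<Sum>i\<in>{2..<N}. up i)"
    using N by (subst sum.atLeast_Suc_lessThan) (auto simp: numeral_2_eq_2)
  also have "up 1 = a 1 * z * z * (\<phi> (add_cl x 2) - \<phi> x)"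
  proof -
    have "add_jump x (BD_jump 1) = add_cl x 2"
      by (auto simp: add_jump_def BD_jump_def unit_seq_def add_cl_def fun_eq_iff)
    then show ?thesis by (simp add: up_def BD_conc_def)
  qed
  also have "(\<Sum>i\<in>{2..<N}. up i) = (\<Sum>k\<in>{2..<N}. up' k)"
  proof (intro sum.cong refl)
    fix k assume k: "k \<in> {2..<N}"
    show "up k = up' k"
    proof (cases "x k = 0")
      case False
      then have "add_jump x (BD_jump k) = move_cl x k (k + 1)"
        using k by (auto simp: add_jump_def BD_jump_def unit_seq_def add_cl_def move_cl_def fun_eq_iff)
      then show ?thesis using k by (simp add: up_def up'_def BD_conc_def)
    qed (use k in \<open>simp add: up_def up'_def BD_conc_def\<close>)
  qed
  also have "(\<Sum>i\<in>{1..<N}. down i) = (\<Sum>i\<in>{1..<N}. down' (i + 1))"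
  proof (intro sum.cong refl)
    fix i assume i: "i \<in> {1..<N}"
    show "down i = down' (i + 1)"
    proof (cases "x (i + 1) = 0")
      case False
      then have "add_jump x (\<lambda>j. - BD_jump i j) = move_cl x (i + 1) i"
        using i by (auto simp: add_jump_def BD_jump_def unit_seq_def add_cl_def move_cl_def fun_eq_iff)
      then show ?thesis using i by (simp add: down_def down'_def BD_conc_def)
    qed (use i in \<open>simp add: down_def down'_def BD_conc_def\<close>)
  qed
  also have "(\<Sum>i\<in>{1..<N}. down' (i + 1)) = (\<Sum>k\<in>{2..<Suc N}. down' k)"
    using sum.shift_bounds_Suc_ivl[of down' 1 N] by (simp add: numeral_2_eq_2)
  also have "\<dots> = (\<Sum>k\<in>{2..<N}. down' k)" using N by (simp add: down'_def)
  finally show ?thesis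
    by (simp add: up'_def down'_def sum.distrib[symmetric] algebra_simps)
qed

lemma gen_add:
  assumes x: "x \<in> BD_states"
  shows "gen (\<lambda>y. f y + g y) x = gen f x + gen g x"
proof -
  obtain N where N: "N \<ge> 2" "\<forall>i\<ge>N. x i = 0" using BD_states_bound[OF x] by blast
  show ?thesis unfolding gen_expand[OF x N]
    by (simp add: algebra_simps sum.distrib sum_subtractf)
qed

lemma gen_cmult:
  assumes x: "x \<in> BD_states"
  shows "gen (\<lambda>y. c * f y) x = c * gen f x"
proof -
  obtain N where N: "N \<ge> 2" "\<forall>i\<ge>N. x i = 0" using BD_states_bound[OF x] by blast
  show ?thesis unfolding gen_expand[OF x N]
    by (simp add: algebra_simps sum_distrib_left sum.distrib sum_subtractf)
qed

lemma gen_const: assumes x: "x \<in> BD_states" shows "gen (\<lambda>y. c) x = 0"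
proof -
  obtain N where N: "N \<ge> 2" "\<forall>i\<ge>N. x i = 0" using BD_states_bound[OF x] by blast
  show ?thesis unfolding gen_expand[OF x N] by simp
qed

lemma gen_le_0_at_max:
  assumes x: "x \<in> BD_states" and max: "\<And>y. y \<in> BD_states \<Longrightarrow> f y \<le> f x"
  shows "gen f x \<le> 0"
proof -
  obtain N where N: "N \<ge> 2" "\<forall>i\<ge>N. x i = 0" using BD_states_bound[OF x] by blast
  have "a 1 * z * z * (f (add_cl x 2) - f x) \<le> 0"
    using max[OF add_cl_in[OF x]] a_pos[of 1] z_pos by (intro mult_nonneg_nonpos) auto
  moreover have "(\<Sum>k\<in>{2..<N}. real (x k) * (a k * z * (f (move_cl x k (k + 1)) - f x) + b k * (f (move_cl x k (k - 1)) - f x))) \<le> 0"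
  proof (intro sum_nonpos mult_nonneg_nonpos add_nonpos_nonpos)
    fix k assume k: "k \<in> {2..<N}"
    then show "0 \<le> a k * z" "0 \<le> b k" using a_pos[of k] b_pos[of k] z_pos by auto
    show "f (move_cl x k (k + 1)) - f x \<le> 0" "f (move_cl x k (k - 1)) - f x \<le> 0"
      using max[OF move_cl_in[OF x, of k]] k by auto
  qed auto
  ultimately show ?thesis unfolding gen_expand[OF x N] by linarith
qed

text \<open>A cluster grows by one monomer at a rate of at most \<open>A * k * z\<close>, and the formation of a dimer adds mass 2. All other transitions
lower the mass.\<close>

lemma gen_mass_le:
  assumes x: "x \<in> BD_states" and A: "\<And>i. i \<ge> 1 \<Longrightarrow> a i \<le> A * real i"
  shows "gen (\<lambda>y. real (mass_cl y)) x \<le> 2 * a 1 * z * z + A * z * real (mass_cl x)"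
proof -
  obtain N where N: "N \<ge> 2" "\<forall>i\<ge>N. x i = 0" using BD_states_bound[OF x] by blast
  have "(\<Sum>k\<in>{2..<N}. real (x k) * (a k * z * (real (mass_cl (move_cl x k (k + 1))) - real (mass_cl x)) + b k * (real (mass_cl (move_cl x k (k - 1))) - real (mass_cl x))))
      \<le> (\<Sum>k\<in>{2..<N}. A * z * real (k * x k))"
  proof (intro sum_mono)
    fix k assume k: "k \<in> {2..<N}"
    show "real (x k) * (a k * z * (real (mass_cl (move_cl x k (k + 1))) - real (mass_cl x)) + b k * (real (mass_cl (move_cl x k (k - 1))) - real (mass_cl x)))
        \<le> A * z * real (k * x k)"
    proof (cases "x k = 0")
      case False
      have up: "real (mass_cl (move_cl x k (k + 1))) - real (mass_cl x) = 1"
        using mass_cl_move[OF x, of k "k + 1"] k False by simp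
      have down: "real (mass_cl (move_cl x k (k - 1))) - real (mass_cl x) \<le> 0"
        using mass_cl_move[OF x, of k "k - 1"] k False by (simp split: if_splits)
      have "b k * (real (mass_cl (move_cl x k (k - 1))) - real (mass_cl x)) \<le> 0"
        using down b_pos[of k] k by (intro mult_nonneg_nonpos) auto
      then have "a k * z * 1 + b k * (real (mass_cl (move_cl x k (k - 1))) - real (mass_cl x)) \<le> a k * z" by simp
      also have "\<dots> \<le> A * real k * z" using A[of k] k z_pos by (intro mult_right_mono) auto
      finally have "real (x k) * (a k * z * 1 + b k * (real (mass_cl (move_cl x k (k - 1))) - real (mass_cl x))) \<le> real (x k) * (A * real k * z)"
        by (intro mult_left_mono) auto
      then show ?thesis unfolding up by (simp add: algebra_simps)
    qed simp
  qed
  also have "\<dots> = A * z * real (mass_cl x)" unfolding mass_cl_load load_sum[OF x N(2)] by (simp add: sum_distrib_left algebra_simps)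
  finally show ?thesis
    unfolding gen_expand[OF x N] using mass_cl_add[OF x, of 2] by (simp add: algebra_simps)
qed

text \<open>An additional cluster leaves the reactions of the other clusters unchanged. Those give the first term,
the reactions of the additional cluster itself the second.\<close>

lemma gen_diff_cl:
  assumes x: "x \<in> BD_states" and i: "i \<ge> 2"
  shows "gen \<phi> (add_cl x i) - gen \<phi> x = gen (diff_cl \<phi> i) x + bd_op (\<lambda>j. diff_cl \<phi> j x) i"
proof -
  obtain N where N: "N \<ge> i + 1" "\<forall>i\<ge>N. x i = 0" using BD_states_bound[OF x] by blast
  have N2: "N \<ge> 2" using N i by simp
  define y where "y = add_cl x i"
  have y: "y \<in> BD_states" "\<forall>k\<ge>N. y k = 0" using x N i by (auto simp: y_def add_cl_def BD_states_upd)
  define T where "T \<phi> x k = a k * z * (\<phi> (move_cl x k (k + 1)) - \<phi> x) + b k * (\<phi> (move_cl x k (k - 1)) - \<phi> x)"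
    for \<phi> :: "(nat \<Rightarrow> nat) \<Rightarrow> real" and x k
  have yk: "real (y k) = real (x k) + (if k = i then 1 else 0)" for k using i by (simp add: y_def add_cl_def)
  have "(\<Sum>k\<in>{2..<N}. real (y k) * T \<phi> y k) = (\<Sum>k\<in>{2..<N}. real (x k) * T \<phi> y k + (if k = i then T \<phi> y k else 0))"
    by (intro sum.cong refl) (simp add: yk algebra_simps)
  also have "\<dots> = (\<Sum>k\<in>{2..<N}. real (x k) * T \<phi> y k) + T \<phi> y i"
    using N i by (simp add: sum.distrib)
  also have "T \<phi> y i = bd_op (\<lambda>j. diff_cl \<phi> j x) i"
    unfolding T_def y_def bd_op_def diff_cl_def using move_add_cl_same[OF i, of x] by simp
  finally have sy: "(\<Sum>k\<in>{2..<N}. real (y k) * T \<phi> y k) = (\<Sum>k\<in>{2..<N}. real (x k) * T \<phi> y k) + bd_op (\<lambda>j. diff_cl \<phi> j x) i" .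
  have "(\<Sum>k\<in>{2..<N}. real (x k) * T (diff_cl \<phi> i) x k) = (\<Sum>k\<in>{2..<N}. real (x k) * T \<phi> y k - real (x k) * T \<phi> x k)"
  proof (intro sum.cong refl)
    fix k assume "k \<in> {2..<N}"
    show "real (x k) * T (diff_cl \<phi> i) x k = real (x k) * T \<phi> y k - real (x k) * T \<phi> x k"
      by (cases "x k = 0") (simp_all add: T_def diff_cl_def y_def move_add_cl[OF i] algebra_simps)
  qed
  then have sx: "(\<Sum>k\<in>{2..<N}. real (x k) * T (diff_cl \<phi> i) x k) =
      (\<Sum>k\<in>{2..<N}. real (x k) * T \<phi> y k) - (\<Sum>k\<in>{2..<N}. real (x k) * T \<phi> x k)"
    by (simp add: sum_subtractf)
  have c: "add_cl (add_cl x i) 2 = add_cl (add_cl x 2) i" by (auto simp: add_cl_def fun_eq_iff)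
  define u where "u \<phi> x = a 1 * z * z * (\<phi> (add_cl x 2) - \<phi> x)" for \<phi> :: "(nat \<Rightarrow> nat) \<Rightarrow> real" and x
  have gy: "gen \<phi> y = u \<phi> y + (\<Sum>k\<in>{2..<N}. real (y k) * T \<phi> y k)"
    unfolding gen_expand[OF y(1) N2 y(2)] T_def u_def ..
  have gx: "gen \<phi>' x = u \<phi>' x + (\<Sum>k\<in>{2..<N}. real (x k) * T \<phi>' x k)" for \<phi>'
    unfolding gen_expand[OF x N2 N(2)] T_def u_def ..
  have "u (diff_cl \<phi> i) x = u \<phi> y - u \<phi> x"
    by (simp add: u_def diff_cl_def y_def c algebra_simps)
  then show ?thesis
    unfolding y_def[symmetric] gy gx sy sx by simp
qed

lemma gen_continuous:
  assumes x: "x \<in> BD_states" and w: "\<And>y. y \<in> BD_states \<Longrightarrow> continuous_on T (\<lambda>s. w s y)"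
  shows "continuous_on T (\<lambda>s. gen (w s) x)"
proof -
  obtain N where N: "N \<ge> 2" "\<forall>i\<ge>N. x i = 0" using BD_states_bound[OF x] by blast
  show ?thesis unfolding gen_expand[OF x N]
    by (intro continuous_intros w add_cl_in move_cl_in x) auto
qed

section \<open>Sensitivity to an additional cluster\<close>

text \<open>The equation for the tagged pair, for a difference that is split into an excess \<open>U\<close>, a comparison function \<open>g\<close> of the size of
the tagged cluster, and a Lyapunov function \<open>W\<close> with a small factor \<open>e\<close>.\<close>

lemma gen_joint_diff:
  assumes x: "x \<in> BD_states" and i: "i \<ge> 2"
    and U: "\<And>y j. y \<in> BD_states \<Longrightarrow> \<sigma> * diff_cl \<phi> j y = U y j + g j + e * W y j"
  shows "\<sigma> * (gen \<phi> (add_cl x i) - gen \<phi> x) =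
    (gen (\<lambda>y. U y i) x + bd_op (U x) i) + bd_op g i + e * (gen (\<lambda>y. W y i) x + bd_op (W x) i)"
proof -
  have "\<sigma> * gen (diff_cl \<phi> i) x = gen (\<lambda>y. \<sigma> * diff_cl \<phi> i y) x" by (rule gen_cmult[OF x, symmetric])
  also have "\<dots> = gen (\<lambda>y. U y i + (g i + e * W y i)) x"
  proof -
    obtain N where N: "N \<ge> 2" "\<forall>i\<ge>N. x i = 0" using BD_states_bound[OF x] by blast
    show ?thesis unfolding gen_expand[OF x N]
      by (intro arg_cong2[where f = "(+)"] sum.cong refl)
         (simp_all add: U move_cl_in[OF x] x add_cl_in)
  qed
  also have "\<dots> = gen (\<lambda>y. U y i) x + e * gen (\<lambda>y. W y i) x"
    by (simp add: gen_add[OF x] gen_cmult[OF x] gen_const[OF x])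
  finally have 1: "\<sigma> * gen (diff_cl \<phi> i) x = gen (\<lambda>y. U y i) x + e * gen (\<lambda>y. W y i) x" .
  have "\<sigma> * bd_op (\<lambda>j. diff_cl \<phi> j x) i = bd_op (\<lambda>j. \<sigma> * diff_cl \<phi> j x) i"
    by (simp add: bd_op_def algebra_simps)
  also have "\<dots> = bd_op (U x) i + bd_op g i + e * bd_op (W x) i"
    unfolding U[OF x] by (simp add: bd_op_def algebra_simps)
  finally show ?thesis unfolding gen_diff_cl[OF x i] using 1 by (simp add: algebra_simps)
qed

text \<open>Maximum principle for the excess of \<open>\<sigma> * diff_cl (w t)\<close>, \<open>\<sigma> = \<plusminus>1\<close>, over the truncated solution plus
\<open>\<epsilon>\<close> times the Lyapunov function \<open>1 + mass + size\<close>. The Lyapunov term alone exceeds the trivial bound 1 on the difference as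
soon as the tagged cluster is larger than \<open>N\<close> or the mass is large, which leaves finitely many pairs to control.\<close>

lemma diff_cl_le_truncated:
  fixes w :: "real \<Rightarrow> (nat \<Rightarrow> nat) \<Rightarrow> real"
  assumes wd: "\<And>x t. x \<in> BD_states \<Longrightarrow> 0 \<le> t \<Longrightarrow>
      ((\<lambda>s. w s x) has_real_derivative gen (w t) x) (at t within {0..})"
    and wB: "\<And>x t. x \<in> BD_states \<Longrightarrow> 0 \<le> t \<Longrightarrow> 0 \<le> w t x \<and> w t x \<le> 1"
    and w0: "\<And>x i. x \<in> BD_states \<Longrightarrow> i \<ge> 2 \<Longrightarrow> \<bar>diff_cl (w 0) i x\<bar> \<le> \<eta> i"
    and A: "\<And>i. i \<ge> 1 \<Longrightarrow> a i \<le> A * real i"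
    and G0: "\<And>i. i \<in> {2..N} \<Longrightarrow> G i 0 = \<eta> i"
    and Gout: "\<And>i t. i \<notin> {2..N} \<Longrightarrow> G i t = 0"
    and Gd: "\<And>i t. i \<in> {2..N} \<Longrightarrow> (G i has_real_derivative bd_op (\<lambda>j. G j t) i) (at t)"
    and GB: "\<And>i t. 0 \<le> t \<Longrightarrow> \<bar>G i t\<bar> \<le> BG"
    and \<epsilon>: "\<epsilon> > 0" "\<epsilon> * real N \<ge> 1"
    and x: "x \<in> BD_states" and i: "i \<in> {2..N}" and t: "0 \<le> t" and \<sigma>: "\<bar>\<sigma>\<bar> = 1"
  shows "\<sigma> * diff_cl (w t) i x \<le> G i t + \<epsilon> * exp ((2 * a 1 * z * z + A * z) * t) * (1 + real (mass_cl x) + real i)"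
proof -
  define c where "c = 2 * a 1 * z * z + A * z"
  define W where "W x i = 1 + real (mass_cl x) + real i" for x :: "nat \<Rightarrow> nat" and i :: nat
  have A0: "A \<ge> 0" using A[of 1] a_pos[of 1] by simp
  have c0: "c \<ge> 0" unfolding c_def using a_pos[of 1] z_pos A0 by simp
  \<comment> \<open>Above mass \<open>R\<close> the Lyapunov term also outweighs the bound \<open>BG\<close> on the truncated solution.\<close>
  define R where "R = nat \<lceil>(1 + BG) / \<epsilon>\<rceil>"
  have R: "\<epsilon> * real R \<ge> 1 + BG"
  proof -
    have "(1 + BG) / \<epsilon> \<le> real R" unfolding R_def by linarith
    then show ?thesis using \<epsilon> by (simp add: field_simps)
  qed
  define F where "F = {x \<in> BD_states. mass_cl x \<le> R} \<times> {2..N}"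
  define u where "u p s = \<sigma> * diff_cl (w s) (snd p) (fst p) - G (snd p) s - \<epsilon> * exp (c * s) * W (fst p) (snd p)"
    for p s
  define u' where "u' p s = \<sigma> * (gen (w s) (add_cl (fst p) (snd p)) - gen (w s) (fst p)) - bd_op (\<lambda>j. G j s) (snd p)
      - \<epsilon> * (c * exp (c * s)) * W (fst p) (snd p)" for p s
  have D1: "\<sigma> * diff_cl (w s) j y \<le> 1" if "y \<in> BD_states" "0 \<le> s" for s j y
    using wB[OF that] wB[OF add_cl_in[OF that(1)] that(2), of j] \<sigma>
    unfolding diff_cl_def by (cases "\<sigma> \<ge> 0") auto
  have outside: "u (y, j) s \<le> 0" if "y \<in> BD_states" "0 \<le> s" "j \<ge> 1" "(y, j) \<notin> F" for y j s
  proof -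
    have e1: "exp (c * s) \<ge> 1" using c0 that by simp
    have "\<epsilon> * W y j \<le> \<epsilon> * exp (c * s) * W y j"
      using \<epsilon> e1 by (simp add: W_def mult.assoc)
    moreover have "j = 1 \<or> j > N \<or> (j \<in> {2..N} \<and> mass_cl y > R)"
      using that by (auto simp: F_def)
    then consider "j = 1" | "j > N" | "j \<in> {2..N}" "mass_cl y > R" by blast
    then have "\<sigma> * diff_cl (w s) j y - G j s \<le> \<epsilon> * W y j"
    proof cases
      case 1
      then show ?thesis using Gout[of j s] \<epsilon> by (simp add: W_def)
    next
      case 2
      have "1 \<le> \<epsilon> * real N" by (rule \<epsilon>)
      also have "\<dots> \<le> \<epsilon> * W y j" using 2 \<epsilon> by (intro mult_left_mono) (auto simp: W_def)
      finally show ?thesis using D1[OF that(1,2), of j] Gout[of j s] 2 by simp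
    next
      case 3
      have "1 + BG \<le> \<epsilon> * real R" by (rule R)
      also have "\<dots> \<le> \<epsilon> * W y j" using 3 \<epsilon> by (intro mult_left_mono) (auto simp: W_def)
      finally show ?thesis using D1[OF that(1,2), of j] GB[OF that(2), of j] by linarith
    qed
    ultimately show ?thesis by (simp add: u_def)
  qed
  have main: "u p t \<le> 0" if p: "p \<in> F" for p
  proof (rule real_max_principle[of F t u u'])
    show "finite F" unfolding F_def using finite_mass_cl_le by auto
    show "u p 0 \<le> 0" if p: "p \<in> F" for p
    proof -
      obtain y j where yj: "p = (y, j)" "y \<in> BD_states" "j \<in> {2..N}" using p by (auto simp: F_def)
      have "\<sigma> * diff_cl (w 0) j y \<le> \<bar>diff_cl (w 0) j y\<bar>" using \<sigma> by (cases "\<sigma> \<ge> 0") auto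
      then have "\<sigma> * diff_cl (w 0) j y \<le> G j 0" using w0[OF yj(2), of j] G0[OF yj(3)] yj(3) by simp
      moreover have "\<epsilon> * W y j \<ge> 0" using \<epsilon> by (simp add: W_def)
      ultimately show ?thesis by (simp add: u_def yj)
    qed
    fix p s assume p: "p \<in> F"
    then obtain y j where yj: "p = (y, j)" "y \<in> BD_states" "j \<in> {2..N}" by (auto simp: F_def)
    show "(u p has_real_derivative u' p s) (at s within {0..t})" if s: "0 \<le> s" "s \<le> t"
    proof -
      have wd': "((\<lambda>s. w s y) has_real_derivative gen (w s) y) (at s within {0..t})" if "y \<in> BD_states" for y
        by (rule has_field_derivative_subset[OF wd[OF that s(1)]]) auto
      have Gd': "(G j has_real_derivative bd_op (\<lambda>k. G k s) j) (at s within {0..t})"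
        using Gd[OF yj(3)] by (rule has_field_derivative_at_within)
      show ?thesis
        unfolding u_def u'_def yj fst_conv snd_conv diff_cl_def
        by (rule derivative_eq_intros wd' Gd' yj(2) add_cl_in refl | simp)+
    qed
    assume s: "0 < s" "s \<le> t" and pos: "0 < u p s" and mx: "\<And>q. q \<in> F \<Longrightarrow> u q s \<le> u p s"
    have glob: "u (y', j') s \<le> u p s" if "y' \<in> BD_states" "j' \<ge> 1" for y' j'
      using outside[OF that(1) _ that(2), of s] mx[of "(y', j')"] pos s by (cases "(y', j') \<in> F") auto
    have j2: "j \<ge> 2" using yj by simp
    have "\<sigma> * (gen (w s) (add_cl y j) - gen (w s) y) =
        (gen (\<lambda>y. u (y, j) s) y + bd_op (\<lambda>j. u (y, j) s) j) + bd_op (\<lambda>j. G j s) j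
        + \<epsilon> * exp (c * s) * (gen (\<lambda>y. W y j) y + bd_op (W y) j)"
      by (rule gen_joint_diff[OF yj(2) j2]) (simp add: u_def)
    moreover have "gen (\<lambda>y. u (y, j) s) y \<le> 0"
      by (rule gen_le_0_at_max[OF yj(2)]) (use glob[of _ j] j2 yj(1) in auto)
    moreover have "bd_op (\<lambda>j. u (y, j) s) j \<le> 0"
      unfolding bd_op_def using glob[OF yj(2), of "j + 1"] glob[OF yj(2), of "j - 1"] a_pos[of j] b_pos[of j] z_pos j2 yj(1)
      by (intro add_nonpos_nonpos mult_nonneg_nonpos) auto
    moreover have "\<epsilon> * exp (c * s) * (gen (\<lambda>y. W y j) y + bd_op (W y) j) \<le> \<epsilon> * exp (c * s) * (c * W y j)"
    proof (rule mult_left_mono)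
      have "gen (\<lambda>y. W y j) y = gen (\<lambda>y. real (mass_cl y)) y"
      proof -
        have "(\<lambda>y. W y j) = (\<lambda>y. (1 + real j) + real (mass_cl y))" by (simp add: W_def fun_eq_iff)
        then show ?thesis using gen_add[OF yj(2), of "\<lambda>_. 1 + real j" "\<lambda>y. real (mass_cl y)"]
          by (simp add: gen_const[OF yj(2)])
      qed
      also have "\<dots> \<le> 2 * a 1 * z * z + A * z * real (mass_cl y)" by (rule gen_mass_le[OF yj(2) A])
      finally have g: "gen (\<lambda>y. W y j) y \<le> 2 * a 1 * z * z + A * z * real (mass_cl y)" .
      have "bd_op (W y) j = a j * z - b j" using j2 by (simp add: bd_op_def W_def of_nat_diff algebra_simps)
      also have "\<dots> \<le> A * real j * z"
      proof -
        have "a j * z \<le> A * real j * z" using A[of j] z_pos j2 by (intro mult_right_mono) auto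
        then show ?thesis using b_pos[of j] j2 by simp
      qed
      finally have "gen (\<lambda>y. W y j) y + bd_op (W y) j \<le> 2 * a 1 * z * z + A * z * (real (mass_cl y) + real j)"
        using g by (simp add: algebra_simps)
      also have "\<dots> \<le> c * W y j"
      proof -
        have "0 \<le> 2 * a 1 * z * z * (real (mass_cl y) + real j)" using a_pos[of 1] z_pos by simp
        moreover have "0 \<le> A * z" using A0 z_pos by simp
        ultimately show ?thesis unfolding c_def W_def by (simp add: algebra_simps)
      qed
      finally show "gen (\<lambda>y. W y j) y + bd_op (W y) j \<le> c * W y j" .
    qed (use \<epsilon> in auto)
    ultimately show "u' p s \<le> 0" unfolding u'_def yj by simp (simp add: algebra_simps)
  qed (use that t in auto)
  have "u (x, i) t \<le> 0"
  proof (cases "(x, i) \<in> F")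
    case True
    then show ?thesis by (rule main)
  next
    case False
    then show ?thesis using i by (intro outside[OF x t]) auto
  qed
  then show ?thesis by (simp add: u_def c_def W_def)
qed

lemma L2_set_sqrt_wt:
  "L2_set (\<lambda>i. sqrt (wt i) * g i) {2..M} = sqrt (\<Sum>i=2..M. wt i * (g i)\<^sup>2)"
  unfolding L2_set_def
  by (intro arg_cong[where f = sqrt] sum.cong refl) (simp add: power_mult_distrib wt_pos less_imp_le)

text \<open>For fixed configurations \<open>xs i\<close>, one per size, the Lyapunov terms have a fixed finite norm \<open>Q\<close>. So the factor \<open>\<epsilon>\<close>, and with it the
truncation level \<open>N \<ge> 1 / \<epsilon>\<close>, is at free disposal.\<close>

lemma diff_cl_L2_bound:
  fixes w :: "real \<Rightarrow> (nat \<Rightarrow> nat) \<Rightarrow> real"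
  assumes h: "\<And>i. i \<ge> 2 \<Longrightarrow> h i > 0" "h 1 = 0" "\<And>i. i \<ge> 2 \<Longrightarrow> bd_op h i = - l * h i" and l: "l \<ge> 0"
    and wd: "\<And>x t. x \<in> BD_states \<Longrightarrow> 0 \<le> t \<Longrightarrow>
      ((\<lambda>s. w s x) has_real_derivative gen (w t) x) (at t within {0..})"
    and wB: "\<And>x t. x \<in> BD_states \<Longrightarrow> 0 \<le> t \<Longrightarrow> 0 \<le> w t x \<and> w t x \<le> 1"
    and w0: "\<And>x i. x \<in> BD_states \<Longrightarrow> i \<ge> 2 \<Longrightarrow> \<bar>diff_cl (w 0) i x\<bar> \<le> \<eta> i"
    and A: "\<And>i. i \<ge> 1 \<Longrightarrow> a i \<le> A * real i"
    and K: "\<And>N. (\<Sum>i=2..N. wt i * (\<eta> i)\<^sup>2) \<le> K\<^sup>2" "K \<ge> 0"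
    and xs: "\<And>i. xs i \<in> BD_states" and t: "0 \<le> t"
  shows "L2_set (\<lambda>i. sqrt (wt i) * \<bar>diff_cl (w t) i (xs i)\<bar>) {2..M} \<le> K * exp (- l * t)"
proof -
  define C where "C i = exp ((2 * a 1 * z * z + A * z) * t) * (1 + real (mass_cl (xs i)) + real i)" for i
  define Q where "Q = L2_set (\<lambda>i. sqrt (wt i) * C i) {2..M}"
  have bound: "L2_set (\<lambda>i. sqrt (wt i) * \<bar>diff_cl (w t) i (xs i)\<bar>) {2..M} \<le> K * exp (- l * t) + \<epsilon> * Q" if \<epsilon>: "\<epsilon> > 0" for \<epsilon>
  proof -
    define N where "N = max (max M 2) (nat \<lceil>1 / \<epsilon>\<rceil>)"
    have N: "N \<ge> 2" "N \<ge> M" by (auto simp: N_def)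
    have "1 / \<epsilon> \<le> real N" unfolding N_def by linarith
    then have N\<epsilon>: "\<epsilon> * real N \<ge> 1" using \<epsilon> by (simp add: field_simps)
    obtain G where G: "\<And>i. i \<in> {2..N} \<Longrightarrow> G i 0 = \<eta> i"
      "\<And>i t. i \<notin> {2..N} \<Longrightarrow> G i t = 0"
      "\<And>i t. i \<in> {2..N} \<Longrightarrow> (G i has_real_derivative bd_op (\<lambda>j. G j t) i) (at t)"
      "\<And>t. t \<ge> 0 \<Longrightarrow> (\<Sum>i=2..N. wt i * (G i t)\<^sup>2) \<le> exp (- 2 * l * t) * (\<Sum>i=2..N. wt i * (\<eta> i)\<^sup>2)"
      using truncated_decay[OF h N(1)] by blast
    have G2: "(\<Sum>i=2..N. wt i * (G i s)\<^sup>2) \<le> exp (- 2 * l * s) * K\<^sup>2" if "s \<ge> 0" for s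
      by (rule order_trans[OF G(4)[OF that]]) (intro mult_left_mono K, simp)
    have GL: "L2_set (\<lambda>i. sqrt (wt i) * G i s) {2..N} \<le> K * exp (- l * s)" if "s \<ge> 0" for s
    proof -
      have "L2_set (\<lambda>i. sqrt (wt i) * G i s) {2..N} \<le> sqrt (exp (- 2 * l * s) * K\<^sup>2)"
        unfolding L2_set_sqrt_wt using G2[OF that] by (rule real_sqrt_le_mono)
      also have "exp (- 2 * l * s) * K\<^sup>2 = (K * exp (- l * s))\<^sup>2"
        by (simp add: power_mult_distrib exp_double[symmetric])
      finally show ?thesis using K(2) by simp
    qed
    define BG where "BG = (\<Sum>i=2..N. K / sqrt (wt i))"
    have BG0: "BG \<ge> 0" unfolding BG_def using K(2) wt_pos by (intro sum_nonneg divide_nonneg_nonneg) (auto simp: less_imp_le)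
    have GB: "\<bar>G i s\<bar> \<le> BG" if "s \<ge> 0" for i s
    proof (cases "i \<in> {2..N}")
      case True
      have "sqrt (wt i) * \<bar>G i s\<bar> = \<bar>sqrt (wt i) * G i s\<bar>" using wt_pos[of i] True by (simp add: abs_mult)
      also have "\<dots> \<le> L2_set (\<lambda>i. sqrt (wt i) * G i s) {2..N}"
        using member_le_L2_set[of "{2..N}" i "\<lambda>i. \<bar>sqrt (wt i) * G i s\<bar>"] True by (simp add: L2_set_def)
      also have "\<dots> \<le> K * exp (- l * s)" by (rule GL[OF that])
      also have "\<dots> \<le> K * 1" using K(2) l that by (intro mult_left_mono) auto
      finally have "\<bar>G i s\<bar> \<le> K / sqrt (wt i)" using wt_pos[of i] True by (simp add: field_simps)
      also have "\<dots> \<le> BG" unfolding BG_def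
        using True K(2) wt_pos by (intro member_le_sum divide_nonneg_nonneg) (auto simp: less_imp_le)
      finally show ?thesis .
    qed (use G(2) BG0 in simp)
    have pt: "\<bar>diff_cl (w t) i (xs i)\<bar> \<le> G i t + \<epsilon> * C i" if i: "i \<in> {2..M}" for i
    proof -
      have iN: "i \<in> {2..N}" using i N by auto
      have b: "\<sigma> * diff_cl (w t) i (xs i) \<le> G i t + \<epsilon> * exp ((2 * a 1 * z * z + A * z) * t) * (1 + real (mass_cl (xs i)) + real i)"
        if \<sigma>: "\<bar>\<sigma>\<bar> = 1" for \<sigma>
        by (rule diff_cl_le_truncated[where w = w and \<eta> = \<eta> and A = A and N = N and G = G and BG = BG and \<epsilon> = \<epsilon>
              and x = "xs i" and i = i and t = t and \<sigma> = \<sigma>];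
            fact wd wB w0 A G(1) G(2) G(3) GB \<epsilon> N\<epsilon> xs iN t \<sigma>)
      show ?thesis using b[of 1] b[of "-1"] by (simp add: C_def)
    qed
    have "L2_set (\<lambda>i. sqrt (wt i) * \<bar>diff_cl (w t) i (xs i)\<bar>) {2..M} \<le>
        L2_set (\<lambda>i. sqrt (wt i) * G i t + sqrt (wt i) * (\<epsilon> * C i)) {2..M}"
      unfolding distrib_left[symmetric] using wt_pos
      by (intro L2_set_mono mult_left_mono pt) (auto simp: less_imp_le)
    also have "\<dots> \<le> L2_set (\<lambda>i. sqrt (wt i) * G i t) {2..M} + L2_set (\<lambda>i. sqrt (wt i) * (\<epsilon> * C i)) {2..M}"
      by (rule L2_set_triangle_ineq)
    also have "L2_set (\<lambda>i. sqrt (wt i) * (\<epsilon> * C i)) {2..M} = \<epsilon> * Q"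
      unfolding Q_def using L2_set_right_distrib[of \<epsilon> "\<lambda>i. sqrt (wt i) * C i" "{2..M}"] \<epsilon> by (simp add: algebra_simps)
    also have "L2_set (\<lambda>i. sqrt (wt i) * G i t) {2..M} \<le> L2_set (\<lambda>i. sqrt (wt i) * G i t) {2..N}"
      unfolding L2_set_def using N by (intro real_sqrt_le_mono sum_mono2) auto
    also have "\<dots> \<le> K * exp (- l * t)" by (rule GL[OF t])
    finally show ?thesis by simp
  qed
  have Q0: "Q \<ge> 0" unfolding Q_def by (rule L2_set_nonneg)
  show ?thesis
  proof (rule field_le_epsilon)
    fix e :: real assume e: "e > 0"
    have "e / (Q + 1) * Q \<le> e" using e Q0 by (simp add: field_simps)
    then show "L2_set (\<lambda>i. sqrt (wt i) * \<bar>diff_cl (w t) i (xs i)\<bar>) {2..M} \<le> K * exp (- l * t) + e"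
      using bound[of "e / (Q + 1)"] e Q0 by simp
  qed
qed

end

lemma load_nonneg: "(\<And>k. k \<ge> 2 \<Longrightarrow> d k \<ge> 0) \<Longrightarrow> x \<in> BD_states \<Longrightarrow> load d x \<ge> 0"
  unfolding load_def
proof (intro sum_nonneg)
  fix k assume d: "\<And>k. k \<ge> 2 \<Longrightarrow> d k \<ge> 0" and x: "x \<in> BD_states" and k: "k \<in> {k. x k \<noteq> 0}"
  have "k \<noteq> 0" "k \<noteq> 1" using x k by (auto simp: BD_states_def) (metis gr0I)
  then show "0 \<le> real (x k) * d k" using d[of k] by simp
qed

text \<open>The configuration is built up from the empty one cluster by cluster.\<close>

lemma diff_from_empty_le_load:
  assumes x: "x \<in> BD_states"
    and d: "\<And>y k. y \<in> BD_states \<Longrightarrow> k \<ge> 2 \<Longrightarrow> \<bar>diff_cl \<phi> k y\<bar> \<le> d k"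
  shows "\<bar>\<phi> x - \<phi> (\<lambda>_. 0)\<bar> \<le> load d x"
  using x
proof (induction "mass_cl x" arbitrary: x rule: less_induct)
  case less
  show ?case
  proof (cases "x = (\<lambda>_. 0)")
    case True
    then show ?thesis by (simp add: load_def)
  next
    case False
    then obtain k where k: "x k > 0" by auto
    then have "k \<noteq> 0" "k \<noteq> 1" using less.prems by (auto simp: BD_states_def) (metis gr0I less_numeral_extra(3))
    then have k2: "k \<ge> 2" by simp
    define y where "y = x(k := x k - 1)"
    have y: "y \<in> BD_states" unfolding y_def by (rule BD_states_upd[OF less.prems k2])
    have xy: "x = add_cl y k" using k k2 by (auto simp: y_def add_cl_def)
    have "mass_cl y < mass_cl x" unfolding xy mass_cl_add[OF y] using k2 by simp
    then have "\<bar>\<phi> y - \<phi> (\<lambda>_. 0)\<bar> \<le> load d y" by (rule less.hyps) (rule y)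
    moreover have "\<bar>\<phi> x - \<phi> y\<bar> \<le> d k" using d[OF y k2] by (simp add: diff_cl_def xy)
    ultimately show ?thesis unfolding xy load_add_cl[OF y k2] by linarith
  qed
qed

section \<open>Poisson configurations with constant flux\<close>

definition poisson_states :: "nat \<Rightarrow> (nat \<Rightarrow> real) \<Rightarrow> (nat \<Rightarrow> nat) pmf" where
  "poisson_states N m = Pi_pmf {2..N} 0 (\<lambda>i. poisson_pmf (m i))"

lemma poisson_states_support: "x \<in> set_pmf (poisson_states N m) \<Longrightarrow> i \<notin> {2..N} \<Longrightarrow> x i = 0"
  using set_Pi_pmf_subset[of "{2..N}" 0 "\<lambda>i. poisson_pmf (m i)"] by (auto simp: poisson_states_def)

lemma set_poisson_states: "set_pmf (poisson_states N m) \<subseteq> BD_states"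
proof
  fix x assume x: "x \<in> set_pmf (poisson_states N m)"
  have z: "x i = 0" if "i \<notin> {2..N}" for i by (rule poisson_states_support[OF x that])
  have "{i. x i \<noteq> 0} \<subseteq> {2..N}"
  proof
    fix i assume "i \<in> {i. x i \<noteq> 0}"
    then have "x i \<noteq> 0" by simp
    then show "i \<in> {2..N}" by (rule contrapos_np) (rule z)
  qed
  then have "finite {i. x i \<noteq> 0}" by (rule finite_subset) simp
  moreover have "x 0 = 0" "x 1 = 0" by (rule z, simp)+
  ultimately show "x \<in> BD_states" by (simp add: BD_states_def)
qed

lemma poisson_states_add:
  assumes m: "\<forall>i\<ge>2. m i > 0" and k: "k \<in> {2..N}"
  shows "pmf (poisson_states N m) (add_cl x k) * real (add_cl x k k) = m k * pmf (poisson_states N m) x"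
proof (cases "\<forall>i. i \<notin> {2..N} \<longrightarrow> x i = 0")
  case True
  then have True': "\<forall>i. i \<notin> {2..N} \<longrightarrow> add_cl x k i = 0" using k by (auto simp: add_cl_def)
  define R where "R = (\<Prod>i\<in>{2..N}-{k}. pmf (poisson_pmf (m i)) (x i))"
  have mk: "m k > 0" using m k by simp
  have "pmf (poisson_states N m) (add_cl x k) = (\<Prod>i\<in>{2..N}. pmf (poisson_pmf (m i)) (add_cl x k i))"
    unfolding poisson_states_def using True' by (intro pmf_Pi') auto
  also have "\<dots> = pmf (poisson_pmf (m k)) (add_cl x k k) * (\<Prod>i\<in>{2..N}-{k}. pmf (poisson_pmf (m i)) (add_cl x k i))"
    using k by (subst prod.remove[of _ k]) auto
  also have "(\<Prod>i\<in>{2..N}-{k}. pmf (poisson_pmf (m i)) (add_cl x k i)) = R"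
    unfolding R_def by (intro prod.cong) (auto simp: add_cl_def)
  finally have 0: "pmf (poisson_states N m) (add_cl x k) = pmf (poisson_pmf (m k)) (add_cl x k k) * R" .
  have 1: "pmf (poisson_states N m) (add_cl x k) = pmf (poisson_pmf (m k)) (Suc (x k)) * R"
  proof -
    have "add_cl x k k = Suc (x k)" using k by (simp add: add_cl_def)
    then show ?thesis using 0 by simp
  qed
  have "pmf (poisson_states N m) x = (\<Prod>i\<in>{2..N}. pmf (poisson_pmf (m i)) (x i))"
    unfolding poisson_states_def using True by (intro pmf_Pi') auto
  also have "\<dots> = pmf (poisson_pmf (m k)) (x k) * R"
    unfolding R_def using k by (subst prod.remove[of _ k]) auto
  finally have 2: "pmf (poisson_states N m) x = pmf (poisson_pmf (m k)) (x k) * R" .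
  have "pmf (poisson_pmf (m k)) (Suc (x k)) * real (Suc (x k)) = m k * pmf (poisson_pmf (m k)) (x k)"
    using mk by (simp del: of_nat_Suc)
  then show ?thesis unfolding 1 2 using k by (simp add: add_cl_def algebra_simps)
next
  case False
  then obtain i where i: "i \<notin> {2..N}" "x i \<noteq> 0" by blast
  then have i': "add_cl x k i \<noteq> 0" using k by (auto simp: add_cl_def)
  have "pmf (poisson_states N m) x = 0" "pmf (poisson_states N m) (add_cl x k) = 0"
    unfolding poisson_states_def by (rule pmf_Pi_outside; use i i' in auto)+
  then show ?thesis by simp
qed

text \<open>Mecke's formula: adding a cluster of size \<open>k\<close> maps the configurations bijectively to those with at least one such cluster,
and the weights change by the factor in \<open>poisson_states_add\<close>.\<close>

lemma poisson_states_mecke: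
  assumes m: "\<forall>i\<ge>2. m i > 0" and k: "k \<in> {2..N}"
    and B: "\<And>x. x \<in> BD_states \<Longrightarrow> \<bar>\<phi> x\<bar> \<le> B"
  shows "((\<lambda>x. pmf (poisson_states N m) x * (real (x k) * \<phi> x)) has_sum
    m k * measure_pmf.expectation (poisson_states N m) (\<lambda>x. \<phi> (add_cl x k))) BD_states"
proof -
  let ?\<nu> = "poisson_states N m"
  define g where "g x = pmf ?\<nu> x * (real (x k) * \<phi> x)" for x
  have "((\<lambda>x. pmf ?\<nu> x * \<phi> (add_cl x k)) has_sum measure_pmf.expectation ?\<nu> (\<lambda>x. \<phi> (add_cl x k))) BD_states"
    by (rule pmf_expectation_has_sum[OF set_poisson_states, where B = B]) (simp add: B)
  then have "((\<lambda>x. m k * (pmf ?\<nu> x * \<phi> (add_cl x k))) has_sum m k * measure_pmf.expectation ?\<nu> (\<lambda>x. \<phi> (add_cl x k))) BD_states"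
    by (rule has_sum_cmult_right)
  moreover have "m k * (pmf ?\<nu> x * \<phi> (add_cl x k)) = (g \<circ> (\<lambda>x. add_cl x k)) x" for x
    unfolding g_def o_def mult.assoc[symmetric] poisson_states_add[OF m k, symmetric] ..
  ultimately have "((g \<circ> (\<lambda>x. add_cl x k)) has_sum m k * measure_pmf.expectation ?\<nu> (\<lambda>x. \<phi> (add_cl x k))) BD_states"
    by (simp only:)
  moreover have inj: "inj_on (\<lambda>x. add_cl x k) BD_states"
  proof (rule inj_onI)
    fix x y assume e: "add_cl x k = add_cl y k"
    show "x = y"
    proof
      fix j show "x j = y j" using fun_cong[OF e, of j] k by (auto simp: add_cl_def split: if_splits)
    qed
  qed
  ultimately have "(g has_sum m k * measure_pmf.expectation ?\<nu> (\<lambda>x. \<phi> (add_cl x k))) ((\<lambda>x. add_cl x k) ` BD_states)"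
    by (simp add: has_sum_reindex)
  then have "(g has_sum m k * measure_pmf.expectation ?\<nu> (\<lambda>x. \<phi> (add_cl x k))) BD_states"
  proof (rule has_sum_cong_neutral[THEN iffD1, rotated -1])
    fix x assume x: "x \<in> BD_states - (\<lambda>x. add_cl x k) ` BD_states"
    have "x k = 0"
    proof (rule ccontr)
      assume "x k \<noteq> 0"
      then have "x = add_cl (x(k := x k - 1)) k" using k by (auto simp: add_cl_def)
      moreover have "x(k := x k - 1) \<in> BD_states" using x k by (intro BD_states_upd) auto
      ultimately show False using x by blast
    qed
    then show "g x = 0" by (simp add: g_def)
  qed auto
  then show ?thesis unfolding g_def[abs_def] .
qed

lemma poisson_states_load:
  assumes m: "\<forall>i\<ge>2. m i > 0"
  shows "((\<lambda>x. pmf (poisson_states N m) x * load d x) has_sum (\<Sum>k=2..N. m k * d k)) BD_states"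
proof -
  let ?\<nu> = "poisson_states N m"
  have "((\<lambda>x. \<Sum>k=2..N. (pmf ?\<nu> x * (real (x k) * 1)) * d k) has_sum (\<Sum>k=2..N. m k * 1 * d k)) BD_states"
  proof (intro has_sum_sum has_sum_cmult_left finite_atLeastAtMost)
    fix k assume k: "k \<in> {2..N}"
    have "((\<lambda>x. pmf ?\<nu> x * (real (x k) * 1)) has_sum m k * measure_pmf.expectation ?\<nu> (\<lambda>x. 1)) BD_states"
      by (rule poisson_states_mecke[OF m k, of "\<lambda>_. 1" 1]) auto
    then show "((\<lambda>x. pmf ?\<nu> x * (real (x k) * 1)) has_sum m k * 1) BD_states" by simp
  qed
  then have "((\<lambda>x. \<Sum>k=2..N. (pmf ?\<nu> x * (real (x k) * 1)) * d k) has_sum (\<Sum>k=2..N. m k * d k)) BD_states" by simp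
  then show ?thesis
  proof (rule has_sum_cong[THEN iffD1, rotated])
    fix x assume x: "x \<in> BD_states"
    show "(\<Sum>k=2..N. (pmf ?\<nu> x * (real (x k) * 1)) * d k) = pmf ?\<nu> x * load d x"
    proof (cases "x \<in> set_pmf ?\<nu>")
      case True
      have z: "\<forall>i\<ge>Suc N. x i = 0" using poisson_states_support[OF True] by auto
      show ?thesis unfolding load_sum[OF x z] by (simp add: sum_distrib_left atLeastLessThanSuc_atLeastAtMost mult.assoc)
    qed (simp add: set_pmf_eq)
  qed
qed

context BD_coeffs
begin

text \<open>Summation by parts. The interior terms are \<open>J * (e (k + 1) - e k)\<close>, where the formation of dimers supplies the term \<open>k = 1\<close>.\<close>

lemma flux_summation:
  assumes m1: "m 1 = z" and flux: "\<forall>i\<ge>1. a i * z * m i - b (Suc i) * m (Suc i) = J"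
    and e1: "e 1 = 0" and N: "N \<ge> 1"
  shows "a 1 * z * z * e 2 + (\<Sum>k=2..N. m k * bd_op e k) = J * e N + m N * a N * z * (e (Suc N) - e N)"
  using N
proof (induction N rule: dec_induct)
  case base
  then show ?case using e1 m1 by (simp add: numeral_2_eq_2)
next
  case (step n)
  have "m (Suc n) * bd_op e (Suc n) = m (Suc n) * a (Suc n) * z * (e (Suc (Suc n)) - e (Suc n))
      + (b (Suc n) * m (Suc n)) * (e n - e (Suc n))"
    by (simp add: bd_op_def algebra_simps)
  also have "b (Suc n) * m (Suc n) = a n * z * m n - J" using flux[rule_format, of n] step.hyps by simp
  finally show ?case using step by (simp add: algebra_simps)
qed

text \<open>By Mecke's formula the mean of the generator is a combination of the mean sensitivities \<open>e k\<close>, whose coefficients are the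
fluxes between neighbouring sizes. As the flux is constant below \<open>N\<close>, these cancel except at the truncation.\<close>

lemma gen_poisson:
  assumes m: "\<forall>i\<ge>2. m i > 0" and m1: "m 1 = z"
    and flux: "\<forall>i\<ge>1. a i * z * m i - b (Suc i) * m (Suc i) = J" and N: "N \<ge> 2"
    and B: "\<And>x. x \<in> BD_states \<Longrightarrow> \<bar>\<phi> x\<bar> \<le> B"
  defines "e \<equiv> \<lambda>k. measure_pmf.expectation (poisson_states N m) (diff_cl \<phi> k)"
  shows "((\<lambda>x. pmf (poisson_states N m) x * gen \<phi> x) has_sum
     (J * e N + m N * a N * z * (e (Suc N) - e N))) BD_states"
proof -
  let ?\<nu> = "poisson_states N m"
  define \<psi> where "\<psi> k x = a k * z * (\<phi> (move_cl x k (k + 1)) - \<phi> x) + b k * (\<phi> (move_cl x k (k - 1)) - \<phi> x)" for k x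
  have D: "\<bar>diff_cl \<phi> k x\<bar> \<le> 2 * B" if "x \<in> BD_states" for k x
    using B[OF that] B[OF add_cl_in[OF that], of k] unfolding diff_cl_def by linarith
  have int: "integrable (measure_pmf ?\<nu>) (diff_cl \<phi> k)" for k
    by (rule integrable_pmf_bounded_on[OF set_poisson_states D])
  have e1: "e 1 = 0" unfolding e_def by (simp add: diff_cl_def[abs_def] add_cl_def)
  have t1: "((\<lambda>x. pmf ?\<nu> x * diff_cl \<phi> 2 x) has_sum e 2) BD_states"
    unfolding e_def by (rule pmf_expectation_has_sum[OF set_poisson_states D])
  have tk: "((\<lambda>x. pmf ?\<nu> x * (real (x k) * \<psi> k x)) has_sum m k * bd_op e k) BD_states" if k: "k \<in> {2..N}" for k
  proof -
    have kk: "k \<ge> 2" using k by simp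
    have \<psi>B: "\<bar>\<psi> k x\<bar> \<le> (a k * z + b k) * (2 * B)" if x: "x \<in> BD_states" for x
    proof -
      have "\<bar>\<phi> (move_cl x k j) - \<phi> x\<bar> \<le> 2 * B" for j
        using B[OF x] B[OF move_cl_in[OF x kk], of j] by linarith
      then have "\<bar>a k * z * (\<phi> (move_cl x k (k + 1)) - \<phi> x)\<bar> \<le> a k * z * (2 * B)"
        "\<bar>b k * (\<phi> (move_cl x k (k - 1)) - \<phi> x)\<bar> \<le> b k * (2 * B)"
        using a_pos[of k] b_pos[of k] z_pos kk by (simp_all add: abs_mult)
      then show ?thesis unfolding \<psi>_def by (simp add: algebra_simps abs_le_iff)
    qed
    have "measure_pmf.expectation ?\<nu> (\<lambda>x. \<psi> k (add_cl x k)) = bd_op e k"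
    proof -
      have "\<psi> k (add_cl x k) = bd_op (\<lambda>j. diff_cl \<phi> j x) k" for x
        unfolding \<psi>_def bd_op_def diff_cl_def using move_add_cl_same[OF kk, of x] by simp
      then show ?thesis unfolding bd_op_def e_def using int by simp
    qed
    moreover have "((\<lambda>x. pmf ?\<nu> x * (real (x k) * \<psi> k x)) has_sum
        m k * measure_pmf.expectation ?\<nu> (\<lambda>x. \<psi> k (add_cl x k))) BD_states"
      by (rule poisson_states_mecke[OF m k]) (rule \<psi>B)
    ultimately show ?thesis by simp
  qed
  have "((\<lambda>x. a 1 * z * z * (pmf ?\<nu> x * diff_cl \<phi> 2 x) + (\<Sum>k=2..N. pmf ?\<nu> x * (real (x k) * \<psi> k x))) has_sum
      (a 1 * z * z * e 2 + (\<Sum>k=2..N. m k * bd_op e k))) BD_states"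
    by (intro has_sum_add has_sum_cmult_right t1 has_sum_sum tk finite_atLeastAtMost)
  also have "a 1 * z * z * e 2 + (\<Sum>k=2..N. m k * bd_op e k) = J * e N + m N * a N * z * (e (Suc N) - e N)"
    by (rule flux_summation[where m = m and e = e, OF m1 flux e1]) (use N in auto)
  finally show ?thesis
  proof (rule has_sum_cong[THEN iffD1, rotated])
    fix x assume x: "x \<in> BD_states"
    show "a 1 * z * z * (pmf ?\<nu> x * diff_cl \<phi> 2 x) + (\<Sum>k=2..N. pmf ?\<nu> x * (real (x k) * \<psi> k x)) = pmf ?\<nu> x * gen \<phi> x"
    proof (cases "x \<in> set_pmf ?\<nu>")
      case True
      have z: "\<forall>i\<ge>Suc N. x i = 0" using poisson_states_support[OF True] by auto
      have N': "Suc N \<ge> 2" using N by simp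
      show ?thesis unfolding gen_expand[OF x N' z] \<psi>_def diff_cl_def
        by (simp add: sum_distrib_left atLeastLessThanSuc_atLeastAtMost algebra_simps)
    qed (simp add: set_pmf_eq)
  qed
qed

end

section \<open>Comparison of the evolved law with a Poisson law\<close>

text \<open>All initial laws are compared with the empty configuration.\<close>

lemma expectation_diff_from_empty:
  assumes p: "set_pmf p \<subseteq> BD_states" and E: "((\<lambda>x. pmf p x * load d x) has_sum E) BD_states"
    and B: "\<And>x. x \<in> BD_states \<Longrightarrow> \<bar>\<phi> x\<bar> \<le> B"
    and d: "\<And>y k. y \<in> BD_states \<Longrightarrow> k \<ge> 2 \<Longrightarrow> \<bar>diff_cl \<phi> k y\<bar> \<le> d k"
  shows "\<bar>measure_pmf.expectation p \<phi> - \<phi> (\<lambda>_. 0)\<bar> \<le> E"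
proof -
  have "((\<lambda>x. pmf p x * \<phi> x) has_sum measure_pmf.expectation p \<phi>) BD_states"
    by (rule pmf_expectation_has_sum[OF p B])
  from has_sum_add[OF this has_sum_cmult_left[OF pmf_has_sum_1[OF p], of "- \<phi> (\<lambda>_. 0)"]]
  have s: "((\<lambda>x. pmf p x * (\<phi> x - \<phi> (\<lambda>_. 0))) has_sum (measure_pmf.expectation p \<phi> - \<phi> (\<lambda>_. 0))) BD_states"
    by (simp add: algebra_simps)
  have "\<bar>pmf p x * (\<phi> x - \<phi> (\<lambda>_. 0))\<bar> \<le> pmf p x * load d x" if x: "x \<in> BD_states" for x
    using diff_from_empty_le_load[OF x d] by (simp add: abs_mult mult_left_mono)
  from has_sum_tail_bound[OF E s this, of "{}"] show ?thesis by simp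
qed

context BD_coeffs
begin

lemma gen_bound:
  assumes x: "x \<in> BD_states" and B: "\<And>y. y \<in> BD_states \<Longrightarrow> 0 \<le> \<phi> y \<and> \<phi> y \<le> 1"
  shows "\<bar>gen \<phi> x\<bar> \<le> a 1 * z * z + load (\<lambda>k. a k * z + b k) x"
proof -
  obtain N where N: "N \<ge> 2" "\<forall>i\<ge>N. x i = 0" using BD_states_bound[OF x] by blast
  have d: "\<bar>\<phi> y - \<phi> x\<bar> \<le> 1" if "y \<in> BD_states" for y using B[OF that] B[OF x] by (simp add: abs_le_iff)
  have "\<bar>a 1 * z * z * (\<phi> (add_cl x 2) - \<phi> x)\<bar> \<le> a 1 * z * z"
    using d[OF add_cl_in[OF x], of 2] a_pos[of 1] z_pos by (simp add: abs_mult mult_left_le)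
  moreover have "\<bar>\<Sum>k\<in>{2..<N}. real (x k) * (a k * z * (\<phi> (move_cl x k (k + 1)) - \<phi> x) + b k * (\<phi> (move_cl x k (k - 1)) - \<phi> x))\<bar>
      \<le> (\<Sum>k\<in>{2..<N}. real (x k) * (a k * z + b k))"
  proof (rule order_trans[OF sum_abs sum_mono])
    fix k assume k: "k \<in> {2..<N}"
    have "\<bar>a k * z * (\<phi> (move_cl x k (k + 1)) - \<phi> x) + b k * (\<phi> (move_cl x k (k - 1)) - \<phi> x)\<bar>
        \<le> \<bar>a k * z * (\<phi> (move_cl x k (k + 1)) - \<phi> x)\<bar> + \<bar>b k * (\<phi> (move_cl x k (k - 1)) - \<phi> x)\<bar>"
      by (rule abs_triangle_ineq)
    also have "\<dots> \<le> a k * z + b k"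
      using d[OF move_cl_in[OF x, of k]] k a_pos[of k] b_pos[of k] z_pos
      by (intro add_mono) (simp_all add: abs_mult mult_left_le)
    finally show "\<bar>real (x k) * (a k * z * (\<phi> (move_cl x k (k + 1)) - \<phi> x) + b k * (\<phi> (move_cl x k (k - 1)) - \<phi> x))\<bar>
        \<le> real (x k) * (a k * z + b k)"
      by (simp add: abs_mult mult_left_mono)
  qed
  ultimately show ?thesis unfolding gen_expand[OF x N] load_sum[OF x N(2)] by linarith
qed

text \<open>The time derivative of the mean is the mean of the generator. To avoid differentiating an infinite sum, the mean value theorem is
applied to the sum over a finite set \<open>A\<close> of configurations, chosen such that the remaining ones carry little of the total jump rate.\<close>

lemma poisson_states_evolution:
  fixes w :: "real \<Rightarrow> (nat \<Rightarrow> nat) \<Rightarrow> real"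
  assumes m: "\<forall>i\<ge>2. m i > 0" and m1: "m 1 = z"
    and flux: "\<forall>i\<ge>1. a i * z * m i - b (Suc i) * m (Suc i) = J" and N: "N \<ge> 2"
    and wd: "\<And>x t. x \<in> BD_states \<Longrightarrow> 0 \<le> t \<Longrightarrow>
      ((\<lambda>s. w s x) has_real_derivative gen (w t) x) (at t within {0..})"
    and wB: "\<And>x t. x \<in> BD_states \<Longrightarrow> 0 \<le> t \<Longrightarrow> 0 \<le> w t x \<and> w t x \<le> 1"
    and d: "\<And>x s k. x \<in> BD_states \<Longrightarrow> 0 \<le> s \<Longrightarrow> k \<ge> 2 \<Longrightarrow> \<bar>diff_cl (w s) k x\<bar> \<le> \<delta> k" and t: "0 \<le> t"
  shows "\<bar>measure_pmf.expectation (poisson_states N m) (w t) - measure_pmf.expectation (poisson_states N m) (w 0)\<bar>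
    \<le> t * (\<bar>J\<bar> * \<delta> N + m N * a N * z * (\<delta> (Suc N) + \<delta> N))"
proof -
  let ?\<nu> = "poisson_states N m"
  define B where "B = \<bar>J\<bar> * \<delta> N + m N * a N * z * (\<delta> (Suc N) + \<delta> N)"
  define T where "T s = infsum (\<lambda>x. pmf ?\<nu> x * gen (w s) x) BD_states" for s
  have wB1: "\<bar>w s x\<bar> \<le> 1" if "x \<in> BD_states" "0 \<le> s" for x s using wB[OF that] by simp
  have T: "((\<lambda>x. pmf ?\<nu> x * gen (w s) x) has_sum T s) BD_states" "\<bar>T s\<bar> \<le> B" if s: "0 \<le> s" for s
  proof -
    define e where "e k = measure_pmf.expectation ?\<nu> (diff_cl (w s) k)" for k
    have e: "\<bar>e k\<bar> \<le> \<delta> k" if "k \<ge> 2" for k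
      unfolding e_def by (rule pmf_expectation_le[OF set_poisson_states]) (rule d[OF _ s that])
    have hs: "((\<lambda>x. pmf ?\<nu> x * gen (w s) x) has_sum (J * e N + m N * a N * z * (e (Suc N) - e N))) BD_states"
      unfolding e_def by (rule gen_poisson[where B = 1, OF m m1 flux N]) (rule wB1[OF _ s])
    then show "((\<lambda>x. pmf ?\<nu> x * gen (w s) x) has_sum T s) BD_states"
      unfolding T_def by (meson has_sum_imp_summable has_sum_infsum)
    have "T s = J * e N + m N * a N * z * (e (Suc N) - e N)" unfolding T_def using hs by (rule infsumI)
    also have "\<bar>\<dots>\<bar> \<le> \<bar>J * e N\<bar> + \<bar>m N * a N * z * (e (Suc N) - e N)\<bar>" by (rule abs_triangle_ineq)
    also have "\<dots> \<le> B"
    proof -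
      have c: "m N * a N * z \<ge> 0" using m a_pos[of N] z_pos N by (simp add: less_imp_le)
      have "\<bar>e (Suc N) - e N\<bar> \<le> \<delta> (Suc N) + \<delta> N" using e[of N] e[of "Suc N"] N by linarith
      then have "\<bar>m N * a N * z * (e (Suc N) - e N)\<bar> \<le> m N * a N * z * (\<delta> (Suc N) + \<delta> N)"
        unfolding abs_mult[of "m N * a N * z"] abs_of_nonneg[OF c] by (rule mult_left_mono[OF _ c])
      moreover have "\<bar>J * e N\<bar> \<le> \<bar>J\<bar> * \<delta> N" using e[of N] N by (simp add: abs_mult mult_left_mono)
      ultimately show ?thesis by (simp add: B_def)
    qed
    finally show "\<bar>T s\<bar> \<le> B" .
  qed
  \<comment> \<open>The summand 1 lets the same tail control the probabilities and the jump rates.\<close>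
  define q where "q x = 1 + (a 1 * z * z + load (\<lambda>k. a k * z + b k) x)" for x
  define G where "G = 1 + (a 1 * z * z * 1 + (\<Sum>k=2..N. m k * (a k * z + b k)))"
  have "((\<lambda>x. pmf ?\<nu> x + (a 1 * z * z * pmf ?\<nu> x + pmf ?\<nu> x * load (\<lambda>k. a k * z + b k) x)) has_sum G) BD_states"
    unfolding G_def by (intro has_sum_add has_sum_cmult_right pmf_has_sum_1 set_poisson_states poisson_states_load m)
  then have qs: "((\<lambda>x. pmf ?\<nu> x * q x) has_sum G) BD_states" by (simp add: q_def algebra_simps)
  have l0: "0 \<le> a 1 * z * z" "0 \<le> load (\<lambda>k. a k * z + b k) x" if "x \<in> BD_states" for x
  proof -
    show "0 \<le> a 1 * z * z" using a_pos[of 1] z_pos by simp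
    show "0 \<le> load (\<lambda>k. a k * z + b k) x"
      by (rule load_nonneg[OF _ that]) (use a_pos b_pos z_pos in \<open>simp add: add_nonneg_nonneg less_imp_le\<close>)
  qed
  have genq: "\<bar>pmf ?\<nu> x * gen (w s) x\<bar> \<le> pmf ?\<nu> x * q x" if x: "x \<in> BD_states" and s: "0 \<le> s" for x s
  proof -
    have "\<bar>gen (w s) x\<bar> \<le> a 1 * z * z + load (\<lambda>k. a k * z + b k) x"
      by (rule gen_bound[OF x]) (rule wB[OF _ s])
    then show ?thesis unfolding q_def by (simp add: abs_mult mult_left_mono)
  qed
  have wq: "\<bar>pmf ?\<nu> x * w s x\<bar> \<le> pmf ?\<nu> x * q x" if x: "x \<in> BD_states" and s: "0 \<le> s" for x s
    using wB1[OF x s] l0[OF x] unfolding q_def abs_mult by (intro mult_mono) auto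
  have ws: "((\<lambda>x. pmf ?\<nu> x * w s x) has_sum measure_pmf.expectation ?\<nu> (w s)) BD_states" if s: "0 \<le> s" for s
    by (rule pmf_expectation_has_sum[OF set_poisson_states wB1[OF _ s]])
  show ?thesis
  proof (rule field_le_epsilon)
    fix \<epsilon> :: real assume \<epsilon>: "\<epsilon> > 0"
    define \<eta> where "\<eta> = \<epsilon> / (t + 2)"
    have \<eta>: "\<eta> > 0" using \<epsilon> t by (simp add: \<eta>_def)
    obtain A where A: "finite A" "A \<subseteq> BD_states" "dist (\<Sum>x\<in>A. pmf ?\<nu> x * q x) G \<le> \<eta>"
      using has_sum_finite_approximation[OF qs \<eta>] by blast
    have tail: "G - (\<Sum>x\<in>A. pmf ?\<nu> x * q x) \<le> \<eta>" using A(3) by (simp add: dist_real_def)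
    define F where "F s = (\<Sum>x\<in>A. pmf ?\<nu> x * w s x)" for s
    have FE: "\<bar>measure_pmf.expectation ?\<nu> (w s) - F s\<bar> \<le> \<eta>" if s: "0 \<le> s" for s
      unfolding F_def using has_sum_tail_bound[OF qs ws[OF s] wq[OF _ s] A(1,2)] tail by simp
    have "norm (F t - F 0) \<le> (B + \<eta>) * norm (t - 0)"
    proof (rule field_differentiable_bound[where S = "{0..}" and f' = "\<lambda>s. \<Sum>x\<in>A. pmf ?\<nu> x * gen (w s) x"])
      fix s :: real assume "s \<in> {0..}"
      then have s: "0 \<le> s" by simp
      show "(F has_field_derivative (\<Sum>x\<in>A. pmf ?\<nu> x * gen (w s) x)) (at s within {0..})"
        unfolding F_def using A(2) by (intro DERIV_sum DERIV_cmult wd[OF _ s]) auto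
      show "norm (\<Sum>x\<in>A. pmf ?\<nu> x * gen (w s) x) \<le> B + \<eta>"
        using has_sum_tail_bound[OF qs T(1)[OF s] genq[OF _ s] A(1,2)] tail T(2)[OF s] by simp
    qed (use t in auto)
    then have "\<bar>F t - F 0\<bar> \<le> (B + \<eta>) * t" using t by simp
    then have "\<bar>measure_pmf.expectation ?\<nu> (w t) - measure_pmf.expectation ?\<nu> (w 0)\<bar> \<le> (B + \<eta>) * t + 2 * \<eta>"
      using FE[OF t] FE[of 0] by linarith
    also have "\<dots> = t * B + \<eta> * (t + 2)" by (simp add: algebra_simps)
    also have "\<eta> * (t + 2) = \<epsilon>" using t by (simp add: \<eta>_def)
    finally show "\<bar>measure_pmf.expectation ?\<nu> (w t) - measure_pmf.expectation ?\<nu> (w 0)\<bar>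
      \<le> t * (\<bar>J\<bar> * \<delta> N + m N * a N * z * (\<delta> (Suc N) + \<delta> N)) + \<epsilon>" by (simp add: B_def)
  qed
qed

text \<open>The bounds for single choices of configurations extend to suprema, as near-maximizers can be chosen independently for each size.\<close>

lemma sup_diff_L2_bound:
  assumes bound: "\<And>xs. (\<And>i. xs i \<in> BD_states) \<Longrightarrow> L2_set (\<lambda>i. sqrt (wt i) * \<bar>diff_cl \<phi> i (xs i)\<bar>) {2..M} \<le> c"
    and B: "\<And>x i. x \<in> BD_states \<Longrightarrow> \<bar>diff_cl \<phi> i x\<bar> \<le> 1"
  shows "L2_set (\<lambda>i. sqrt (wt i) * (SUP x\<in>BD_states. \<bar>diff_cl \<phi> i x\<bar>)) {2..M} \<le> c"
proof -
  define s where "s i = (SUP x\<in>BD_states. \<bar>diff_cl \<phi> i x\<bar>)" for i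
  have ne: "BD_states \<noteq> {}" by (auto simp: BD_states_def intro!: exI[of _ "\<lambda>_. 0"])
  have bdd: "bdd_above ((\<lambda>x. \<bar>diff_cl \<phi> i x\<bar>) ` BD_states)" for i
    by (rule bdd_aboveI[of _ 1]) (use B in auto)
  define Q where "Q = L2_set (\<lambda>i. sqrt (wt i)) {2..M}"
  have Q0: "Q \<ge> 0" unfolding Q_def by (rule L2_set_nonneg)
  have "L2_set (\<lambda>i. sqrt (wt i) * s i) {2..M} \<le> c + \<epsilon> * Q" if \<epsilon>: "\<epsilon> > 0" for \<epsilon>
  proof -
    have "\<exists>x\<in>BD_states. s i - \<epsilon> < \<bar>diff_cl \<phi> i x\<bar>" for i
      using less_cSUP_iff[OF ne bdd, of "s i - \<epsilon>" i] \<epsilon> by (simp add: s_def)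
    then obtain xs where xs: "\<And>i. xs i \<in> BD_states" "\<And>i. s i - \<epsilon> < \<bar>diff_cl \<phi> i (xs i)\<bar>" by metis
    have s0: "s i \<ge> 0" for i
      using cSUP_upper[OF xs(1) bdd, of i i] unfolding s_def by linarith
    have "L2_set (\<lambda>i. sqrt (wt i) * s i) {2..M} \<le>
        L2_set (\<lambda>i. sqrt (wt i) * \<bar>diff_cl \<phi> i (xs i)\<bar> + \<epsilon> * sqrt (wt i)) {2..M}"
    proof (rule L2_set_mono)
      fix i assume i: "i \<in> {2..M}"
      have w: "sqrt (wt i) \<ge> 0" using wt_pos[of i] i by simp
      have "s i \<le> \<bar>diff_cl \<phi> i (xs i)\<bar> + \<epsilon>" using xs(2)[of i] by linarith
      from mult_left_mono[OF this w] show "sqrt (wt i) * s i \<le> sqrt (wt i) * \<bar>diff_cl \<phi> i (xs i)\<bar> + \<epsilon> * sqrt (wt i)"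
        by (simp add: algebra_simps)
      show "0 \<le> sqrt (wt i) * s i" using w s0 by simp
    qed
    also have "\<dots> \<le> L2_set (\<lambda>i. sqrt (wt i) * \<bar>diff_cl \<phi> i (xs i)\<bar>) {2..M} + L2_set (\<lambda>i. \<epsilon> * sqrt (wt i)) {2..M}"
      by (rule L2_set_triangle_ineq)
    also have "L2_set (\<lambda>i. \<epsilon> * sqrt (wt i)) {2..M} = \<epsilon> * Q"
      unfolding Q_def using \<epsilon> by (simp add: L2_set_right_distrib)
    finally have "L2_set (\<lambda>i. sqrt (wt i) * s i) {2..M} \<le> L2_set (\<lambda>i. sqrt (wt i) * \<bar>diff_cl \<phi> i (xs i)\<bar>) {2..M} + \<epsilon> * Q" .
    moreover have "L2_set (\<lambda>i. sqrt (wt i) * \<bar>diff_cl \<phi> i (xs i)\<bar>) {2..M} \<le> c" by (rule bound) (rule xs(1))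
    ultimately show ?thesis by simp
  qed
  then have le: "L2_set (\<lambda>i. sqrt (wt i) * s i) {2..M} \<le> c + \<epsilon> * Q" if "\<epsilon> > 0" for \<epsilon> using that .
  have "L2_set (\<lambda>i. sqrt (wt i) * s i) {2..M} \<le> c"
  proof (rule field_le_epsilon)
    fix e :: real assume e: "e > 0"
    have "e / (Q + 1) * Q \<le> e" using e Q0 by (simp add: field_simps)
    then show "L2_set (\<lambda>i. sqrt (wt i) * s i) {2..M} \<le> c + e"
      using le[of "e / (Q + 1)"] e Q0 by simp
  qed
  then show ?thesis by (simp add: s_def)
qed

text \<open>The law started from \<open>p\<close> is compared with the law started from the Poisson law, and the latter with its value at time 0. The two
upper bounds \<open>1\<close> and \<open>K / sqrt (wt k)\<close> on the sensitivity serve different regimes: \<open>wt\<close> tends to 0 in the sub-critical case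
and to infinity in the super-critical case.\<close>

lemma poisson_comparison:
  fixes w :: "real \<Rightarrow> (nat \<Rightarrow> nat) \<Rightarrow> real"
  assumes h: "\<And>i. i \<ge> 2 \<Longrightarrow> h i > 0" "h 1 = 0" "\<And>i. i \<ge> 2 \<Longrightarrow> bd_op h i = - l * h i" and l: "l \<ge> 0"
    and A: "\<And>i. i \<ge> 1 \<Longrightarrow> a i \<le> A * real i"
    and wd: "\<And>x t. x \<in> BD_states \<Longrightarrow> 0 \<le> t \<Longrightarrow>
      ((\<lambda>s. w s x) has_real_derivative gen (w t) x) (at t within {0..})"
    and wB: "\<And>x t. x \<in> BD_states \<Longrightarrow> 0 \<le> t \<Longrightarrow> 0 \<le> w t x \<and> w t x \<le> 1"
    and w0: "\<And>x i. x \<in> BD_states \<Longrightarrow> i \<ge> 2 \<Longrightarrow> \<bar>diff_cl (w 0) i x\<bar> \<le> \<eta> i"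
    and K: "\<And>N. (\<Sum>i=2..N. wt i * (\<eta> i)\<^sup>2) \<le> K\<^sup>2" "K \<ge> 0"
    and m: "\<forall>i\<ge>2. m i > 0" and m1: "m 1 = z"
    and flux: "\<forall>i\<ge>1. a i * z * m i - b (Suc i) * m (Suc i) = J"
    and p: "set_pmf p \<subseteq> BD_states"
    and E: "((\<lambda>x. pmf p x * load (\<lambda>k. 1 / sqrt (wt k)) x) has_sum E) BD_states"
    and N: "N \<ge> 2" and t: "0 \<le> t"
  defines "\<delta> \<equiv> \<lambda>k. min 1 (K / sqrt (wt k))"
  shows "\<bar>measure_pmf.expectation p (w t) - measure_pmf.expectation (poisson_states N m) (w 0)\<bar> \<le>
    K * (E + L2_set (\<lambda>k. m k / sqrt (wt k)) {2..N}) * exp (- l * t)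
      + t * (\<bar>J\<bar> * \<delta> N + m N * a N * z * (\<delta> (Suc N) + \<delta> N))"
proof -
  let ?\<nu> = "poisson_states N m"
  define ds where "ds s i = (SUP x\<in>BD_states. \<bar>diff_cl (w s) i x\<bar>)" for s i
  have D1: "\<bar>diff_cl (w s) i x\<bar> \<le> 1" if "x \<in> BD_states" "0 \<le> s" for s i x
    using wB[OF that] wB[OF add_cl_in[OF that(1)] that(2), of i] unfolding diff_cl_def by (simp add: abs_le_iff)
  have dsL: "L2_set (\<lambda>i. sqrt (wt i) * ds s i) {2..M} \<le> K * exp (- l * s)" if s: "0 \<le> s" for s M
    unfolding ds_def
  proof (rule sup_diff_L2_bound)
    fix xs :: "nat \<Rightarrow> nat \<Rightarrow> nat" assume xs: "\<And>i. xs i \<in> BD_states"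
    show "L2_set (\<lambda>i. sqrt (wt i) * \<bar>diff_cl (w s) i (xs i)\<bar>) {2..M} \<le> K * exp (- l * s)"
      by (rule diff_cl_L2_bound[where h = h and l = l and w = w and \<eta> = \<eta> and A = A and K = K and xs = xs and t = s and M = M];
          fact h(1) h(2) h(3) l wd wB w0 A K(1) K(2) xs s)
  qed (rule D1[OF _ s])
  have up: "\<bar>diff_cl (w s) i x\<bar> \<le> ds s i" if "x \<in> BD_states" "0 \<le> s" for s i x
    unfolding ds_def by (rule cSUP_upper[OF that(1)]) (use D1[OF _ that(2)] in \<open>auto intro!: bdd_aboveI[of _ 1]\<close>)
  have ds0: "ds s i \<ge> 0" if "0 \<le> s" for s i
    using up[of "\<lambda>_. 0" s i] that by (auto simp: BD_states_def)
  have ptw: "ds s i \<le> K * exp (- l * s) / sqrt (wt i)" if s: "0 \<le> s" and i: "i \<ge> 2" for s i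
  proof -
    have w: "sqrt (wt i) > 0" using wt_pos[of i] i by simp
    have "sqrt (wt i) * ds s i \<le> L2_set (\<lambda>i. sqrt (wt i) * ds s i) {2..i}"
      using i w by (intro member_le_L2_set[of "{2..i}" i "\<lambda>i. sqrt (wt i) * ds s i"]) auto
    also have "\<dots> \<le> K * exp (- l * s)" by (rule dsL[OF s])
    finally show ?thesis using w by (simp add: field_simps)
  qed
  have d\<delta>: "\<bar>diff_cl (w s) k x\<bar> \<le> \<delta> k" if "x \<in> BD_states" "0 \<le> s" "k \<ge> 2" for x s k
  proof -
    have w: "sqrt (wt k) > 0" using wt_pos[of k] that by simp
    have "K * exp (- l * s) \<le> K * 1" using K(2) l that by (intro mult_left_mono) auto
    then have "K * exp (- l * s) / sqrt (wt k) \<le> K / sqrt (wt k)" using w by (simp add: divide_right_mono)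
    then show ?thesis using D1[OF that(1,2), of k] up[OF that(1,2), of k] ptw[OF that(2,3)] by (simp add: \<delta>_def)
  qed
  have wB1: "\<bar>w t x\<bar> \<le> 1" if "x \<in> BD_states" for x using wB[OF that t] by simp
  have P1: "\<bar>measure_pmf.expectation p (w t) - w t (\<lambda>_. 0)\<bar> \<le> K * exp (- l * t) * E"
  proof (rule expectation_diff_from_empty[OF p _ wB1])
    have "((\<lambda>x. K * exp (- l * t) * (pmf p x * load (\<lambda>k. 1 / sqrt (wt k)) x)) has_sum K * exp (- l * t) * E) BD_states"
      by (intro has_sum_cmult_right E)
    moreover have "K * exp (- l * t) * (pmf p x * load (\<lambda>k. 1 / sqrt (wt k)) x) =
        pmf p x * load (\<lambda>k. K * exp (- l * t) / sqrt (wt k)) x" for x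
      by (simp add: load_def sum_distrib_left algebra_simps)
    ultimately show "((\<lambda>x. pmf p x * load (\<lambda>k. K * exp (- l * t) / sqrt (wt k)) x) has_sum K * exp (- l * t) * E) BD_states"
      by (simp only:)
    show "\<bar>diff_cl (w t) k y\<bar> \<le> K * exp (- l * t) / sqrt (wt k)" if "y \<in> BD_states" "k \<ge> 2" for y k
      using up[OF that(1) t, of k] ptw[OF t that(2)] by simp
  qed
  have "\<bar>measure_pmf.expectation ?\<nu> (w t) - w t (\<lambda>_. 0)\<bar> \<le> (\<Sum>k=2..N. m k * ds t k)"
    by (rule expectation_diff_from_empty[OF set_poisson_states poisson_states_load[OF m], where B = 1])
       (fact wB1, rule up[OF _ t])
  also have "\<dots> \<le> L2_set (\<lambda>k. m k / sqrt (wt k)) {2..N} * L2_set (\<lambda>k. sqrt (wt k) * ds t k) {2..N}"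
  proof -
    have "(\<Sum>k=2..N. m k * ds t k) = (\<Sum>k=2..N. \<bar>m k / sqrt (wt k)\<bar> * \<bar>sqrt (wt k) * ds t k\<bar>)"
    proof (intro sum.cong refl)
      fix k assume k: "k \<in> {2..N}"
      then have "m k > 0" "sqrt (wt k) > 0" "ds t k \<ge> 0" using m wt_pos[of k] ds0[OF t] by auto
      then show "m k * ds t k = \<bar>m k / sqrt (wt k)\<bar> * \<bar>sqrt (wt k) * ds t k\<bar>" by (simp add: abs_mult)
    qed
    then show ?thesis by (simp only: L2_set_mult_ineq)
  qed
  also have "\<dots> \<le> L2_set (\<lambda>k. m k / sqrt (wt k)) {2..N} * (K * exp (- l * t))"
    by (intro mult_left_mono dsL t L2_set_nonneg)
  finally have P2: "\<bar>measure_pmf.expectation ?\<nu> (w t) - w t (\<lambda>_. 0)\<bar> \<le> L2_set (\<lambda>k. m k / sqrt (wt k)) {2..N} * (K * exp (- l * t))" .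
  have P3: "\<bar>measure_pmf.expectation ?\<nu> (w t) - measure_pmf.expectation ?\<nu> (w 0)\<bar>
      \<le> t * (\<bar>J\<bar> * \<delta> N + m N * a N * z * (\<delta> (Suc N) + \<delta> N))"
    by (rule poisson_states_evolution[OF m m1 flux N]; fact wd wB d\<delta> t)
  have "K * (E + L2_set (\<lambda>k. m k / sqrt (wt k)) {2..N}) * exp (- l * t) =
     K * exp (- l * t) * E + L2_set (\<lambda>k. m k / sqrt (wt k)) {2..N} * (K * exp (- l * t))"
    by (simp add: algebra_simps)
  then show ?thesis using P1 P2 P3 by linarith
qed

end

context BD_coeffs
begin

lemma law_comparison:
  assumes h: "\<And>i. i \<ge> 2 \<Longrightarrow> h i > 0" "h 1 = 0" "\<And>i. i \<ge> 2 \<Longrightarrow> bd_op h i = - l * h i" and l: "l \<ge> 0"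
    and A: "\<And>i. i \<ge> 1 \<Longrightarrow> a i \<le> A * real i"
    and P: "transition_function BD_states P" "has_generator BD_states P gen"
    and p: "set_pmf p \<subseteq> BD_states"
    and E: "((\<lambda>x. pmf p x * load (\<lambda>k. 1 / sqrt (wt k)) x) has_sum E) BD_states"
    and t: "0 \<le> t"
    and \<eta>: "\<And>x i. x \<in> BD_states \<Longrightarrow> i \<ge> 2 \<Longrightarrow> \<bar>diff_cl (indicator D) i x\<bar> \<le> \<eta> i"
    and K: "\<And>N. (\<Sum>i=2..N. wt i * (\<eta> i)\<^sup>2) \<le> K\<^sup>2" "K \<ge> 0"
    and m: "\<forall>i\<ge>2. m i > 0" "m 1 = z" "\<forall>i\<ge>1. a i * z * m i - b (Suc i) * m (Suc i) = J" and N: "N \<ge> 2"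
  shows "measure_pmf.prob (bind_pmf p (trans_pmf BD_states P t)) D - measure_pmf.prob (poisson_states N m) D \<le>
        K * (E + L2_set (\<lambda>k. m k / sqrt (wt k)) {2..N}) * exp (- l * t)
        + t * (\<bar>J\<bar> * min 1 (K / sqrt (wt N)) + m N * a N * z * (min 1 (K / sqrt (wt (Suc N))) + min 1 (K / sqrt (wt N))))"
proof -
  define \<mu> where "\<mu> = bind_pmf p (trans_pmf BD_states P t)"
  have sub: "set_pmf (trans_pmf BD_states P t x) \<subseteq> BD_states" if "x \<in> set_pmf p" for x
    using set_trans_pmf[OF P(1) t] p that by auto
  define \<psi> :: "(nat \<Rightarrow> nat) \<Rightarrow> real" where "\<psi> = indicator D"
  define w where "w s = semigroup_op BD_states P s \<psi>" for s
  have \<psi>B: "\<bar>\<psi> y\<bar> \<le> 1" for y by (simp add: \<psi>_def indicator_def)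
  have cont: "continuous_on {0..} (\<lambda>s. w s x)" if "x \<in> BD_states" for x
    unfolding w_def by (rule semigroup_op_continuous[OF P that \<psi>B])
  have wd: "((\<lambda>s. w s x) has_real_derivative gen (w s) x) (at s within {0..})" if x: "x \<in> BD_states" and s: "0 \<le> s" for x s
    unfolding w_def
    by (rule backward_equation[OF P x \<psi>B _ s]) (rule gen_continuous[OF x cont, unfolded w_def])
  have wB: "0 \<le> w s x \<and> w s x \<le> 1" if "x \<in> BD_states" "0 \<le> s" for x s
    unfolding w_def semigroup_op_def \<psi>_def by simp
  have w0: "w 0 x = \<psi> x" if "x \<in> BD_states" for x
    unfolding w_def by (rule semigroup_op_0[OF P(1) that])
  have d0: "\<bar>diff_cl (w 0) i x\<bar> \<le> \<eta> i" if x: "x \<in> BD_states" and i: "i \<ge> 2" for x i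
    using \<eta>[OF x i] w0[OF x] w0[OF add_cl_in[OF x]] by (simp add: diff_cl_def \<psi>_def)
  have "measure_pmf.prob \<mu> D = measure_pmf.expectation \<mu> \<psi>" by (simp add: \<psi>_def)
  also have "\<dots> = measure_pmf.expectation p (w t)"
    unfolding \<mu>_def w_def semigroup_op_def by (rule expectation_bind_pmf_on[where S = BD_states, OF \<psi>B sub])
  finally have e1: "measure_pmf.prob \<mu> D = measure_pmf.expectation p (w t)" .
  have "measure_pmf.prob (poisson_states N m) D = measure_pmf.expectation (poisson_states N m) \<psi>" by (simp add: \<psi>_def)
  also have "\<dots> = measure_pmf.expectation (poisson_states N m) (w 0)"
    using w0 set_poisson_states[of N m] by (intro integral_cong_AE) (auto simp: AE_measure_pmf_iff)
  finally have e2: "measure_pmf.prob (poisson_states N m) D = measure_pmf.expectation (poisson_states N m) (w 0)" .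
  have "\<bar>measure_pmf.expectation p (w t) - measure_pmf.expectation (poisson_states N m) (w 0)\<bar> \<le>
      K * (E + L2_set (\<lambda>k. m k / sqrt (wt k)) {2..N}) * exp (- l * t)
      + t * (\<bar>J\<bar> * min 1 (K / sqrt (wt N)) + m N * a N * z * (min 1 (K / sqrt (wt (Suc N))) + min 1 (K / sqrt (wt N))))"
    by (rule poisson_comparison[where h = h and l = l and A = A and w = w and \<eta> = \<eta> and K = K and m = m and J = J and p = p and E = E];
        fact h(1) h(2) h(3) l A wd wB d0 K(1) K(2) m(1) m(2) m(3) p E N t)
  then show ?thesis
    unfolding \<mu>_def[symmetric] e1 e2 by linarith
qed

section \<open>The equilibrium and stationary laws\<close>

lemma inner_H_sqrt_Q:
  assumes x: "x \<in> BD_states"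
  shows "inner_H a b z (\<lambda>i. real (x i)) (sqrt_Q a b z) = load (\<lambda>k. 1 / sqrt (wt k)) x"
proof -
  obtain N where N: "N \<ge> 2" "\<forall>i\<ge>N. x i = 0" using BD_states_bound[OF x] by blast
  have "inner_H a b z (\<lambda>i. real (x i)) (sqrt_Q a b z) = (\<Sum>\<^sub>\<infinity>i\<in>{2..<N}. real (x i) * (1 / sqrt (wt i)))"
    unfolding inner_H_def sqrt_Q_def wt_def[symmetric]
  proof (intro infsum_cong_neutral)
    fix i assume "i \<in> {2..} \<inter> {2..<N}"
    then have "wt i > 0" using wt_pos by simp
    then have "sqrt (wt i) / wt i = 1 / sqrt (wt i)" by (simp add: field_simps)
    then show "real (x i) * sqrt (wt i) / wt i = real (x i) * (1 / sqrt (wt i))" by (metis times_divide_eq_right)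
  qed (use N in auto)
  then show ?thesis unfolding load_sum[OF x N(2)] by simp
qed

lemma pmf_poisson_states:
  assumes m: "\<forall>i\<ge>2. m i > 0" and x: "\<forall>i. i \<notin> {2..N} \<longrightarrow> x i = 0"
  shows "pmf (poisson_states N m) x = exp (- (\<Sum>i=2..N. m i)) * (\<Prod>i=2..N. m i ^ x i / fact (x i))"
proof -
  have "pmf (poisson_states N m) x = (\<Prod>i=2..N. pmf (poisson_pmf (m i)) (x i))"
    unfolding poisson_states_def using x by (intro pmf_Pi') auto
  also have "\<dots> = (\<Prod>i=2..N. exp (- m i) * (m i ^ x i / fact (x i)))"
  proof (intro prod.cong refl)
    fix i assume "i \<in> {2..N}"
    then have "m i > 0" using m by simp
    then show "pmf (poisson_pmf (m i)) (x i) = exp (- m i) * (m i ^ x i / fact (x i))" by simp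
  qed
  also have "\<dots> = exp (- (\<Sum>i=2..N. m i)) * (\<Prod>i=2..N. m i ^ x i / fact (x i))"
    by (simp only: prod.distrib exp_sum[symmetric] finite_atLeastAtMost sum_negf)
  finally show ?thesis .
qed

lemma BD_eq_poisson_states:
  assumes sm: "summable wt" and x: "x \<in> BD_states" and supp: "\<forall>i. i \<notin> {2..N} \<longrightarrow> x i = 0" and N: "N \<ge> 2"
  shows "BD_eq a b z x = exp ((\<Sum>i=2..N. wt i) - (\<Sum>i. wt (i + 2))) * pmf (poisson_states N wt) x"
proof -
  define f where "f i = exp (- wt (i + 2)) * wt (i + 2) ^ x (i + 2) / fact (x (i + 2))" for i
  define W where "W = (\<Sum>i. wt (i + 2))"
  define G where "G = (\<Prod>i=2..N. wt i ^ x i / fact (x i))"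
  have wp: "\<forall>i\<ge>2. wt i > 0" using wt_pos by auto
  have fn: "f i \<noteq> 0" for i using wt_pos[of "i + 2"] by (simp add: f_def)
  have prodf: "(\<Prod>i\<le>n. f i) = exp (- (\<Sum>i\<le>n. wt (i + 2))) * G" if n: "n \<ge> N" for n
  proof -
    have "(\<Prod>i\<le>n. f i) = exp (- (\<Sum>i\<le>n. wt (i + 2))) * (\<Prod>i\<le>n. wt (i + 2) ^ x (i + 2) / fact (x (i + 2)))"
      unfolding f_def by (simp add: exp_sum[symmetric] sum_negf prod.distrib times_divide_eq_right[symmetric] del: times_divide_eq_right)
    also have "(\<Prod>i\<le>n. wt (i + 2) ^ x (i + 2) / fact (x (i + 2))) = (\<Prod>i\<in>{0+2..n+2}. wt i ^ x i / fact (x i))"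
      by (simp only: prod.shift_bounds_cl_nat_ivl atMost_atLeast0)
    also have "\<dots> = G"
      unfolding G_def by (intro prod.mono_neutral_right) (use n supp in auto)
    finally show ?thesis .
  qed
  have "(\<lambda>n. \<Sum>i\<le>n. wt (i + 2)) \<longlonglongrightarrow> W"
    unfolding W_def using summable_LIMSEQ'[OF summable_ignore_initial_segment[OF sm, of 2]] .
  then have "(\<lambda>n. exp (- (\<Sum>i\<le>n. wt (i + 2))) * G) \<longlonglongrightarrow> exp (- W) * G"
    by (intro tendsto_mult tendsto_exp tendsto_minus tendsto_const)
  then have lim: "(\<lambda>n. \<Prod>i\<le>n. f i) \<longlonglongrightarrow> exp (- W) * G"
    by (rule Lim_transform_eventually) (rule eventually_sequentiallyI[of N], simp only: prodf)
  have "G \<noteq> 0" unfolding G_def using wp by (auto simp: prod_zero_iff) 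
  then have "convergent_prod f" using lim fn by (subst convergent_prod_iff_nz_lim) auto
  then have "prodinf f = exp (- W) * G" using prodinf_eq_lim[of f] fn limI[OF lim] by simp
  then have "BD_eq a b z x = exp (- W) * G"
    unfolding BD_eq_def wt_def[symmetric] f_def[symmetric] .
  also have "\<dots> = exp ((\<Sum>i=2..N. wt i) - W) * (exp (- (\<Sum>i=2..N. wt i)) * G)"
    by (simp add: mult.assoc[symmetric] exp_add[symmetric])
  finally show ?thesis unfolding pmf_poisson_states[OF wp supp] G_def W_def .
qed

text \<open>The equilibrium law and its truncations have the same point masses up to the factor \<open>exp (\<Sum>i=2..N. wt i - W)\<close> on configurations with
clusters of size at most \<open>N\<close>. The factor tends to 1, and it is at most 1.\<close>

lemma BD_eq_approximation:
  assumes sm: "summable wt"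
  defines "W \<equiv> (\<Sum>i. wt (i + 2))"
  shows "(\<lambda>N. \<Sum>i=2..N. wt i) \<longlonglongrightarrow> W" and "(\<Sum>i=2..N. wt i) \<le> W"
    and "x \<in> BD_states \<Longrightarrow> N \<ge> 2 \<Longrightarrow> exp ((\<Sum>i=2..N. wt i) - W) * pmf (poisson_states N wt) x \<le> BD_eq a b z x"
    and "finite F \<Longrightarrow> F \<subseteq> BD_states \<Longrightarrow> \<exists>N\<ge>2. \<forall>x\<in>F. BD_eq a b z x \<le> pmf (poisson_states N wt) x"
    and "x \<in> BD_states \<Longrightarrow> BD_eq a b z x \<ge> 0"
proof -
  have sm2: "summable (\<lambda>i. wt (i + 2))" by (rule summable_ignore_initial_segment[OF sm])
  have shift: "(\<Sum>i\<le>n. wt (i + 2)) = (\<Sum>i=2..n+2. wt i)" for n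
    using sum.shift_bounds_cl_nat_ivl[of wt 0 2 n, symmetric] by (simp only: atMost_atLeast0 add_0)
  have "(\<lambda>n. \<Sum>i=2..n+2. wt i) \<longlonglongrightarrow> W"
    unfolding W_def shift[symmetric] by (rule summable_LIMSEQ'[OF sm2])
  then show "(\<lambda>N. \<Sum>i=2..N. wt i) \<longlonglongrightarrow> W" by (rule LIMSEQ_offset)
  show sN: "(\<Sum>i=2..N. wt i) \<le> W" for N
  proof -
    have "(\<Sum>i=2..N. wt i) \<le> (\<Sum>i=2..N+2. wt i)" using wt_pos by (intro sum_mono2) (auto simp: less_imp_le)
    also have "\<dots> = (\<Sum>i\<le>N. wt (i + 2))" by (simp only: shift)
    also have "\<dots> \<le> W" unfolding W_def using wt_pos by (intro sum_le_suminf[OF sm2]) (auto simp: less_imp_le)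
    finally show ?thesis .
  qed
  have supp_ex: "\<exists>N\<ge>2. \<forall>i. i \<notin> {2..N} \<longrightarrow> x i = 0" if x: "x \<in> BD_states" for x
  proof -
    obtain N where N: "N \<ge> 2" "\<forall>i\<ge>N. x i = 0" using BD_states_bound[OF x] by blast
    have "x i = 0" if "i \<notin> {2..N}" for i
    proof (cases "i < 2")
      case True
      then have "i = 0 \<or> i = 1" by auto
      then show ?thesis using x by (auto simp: BD_states_def)
    qed (use that N in auto)
    then show ?thesis using N(1) by blast
  qed
  show nn: "BD_eq a b z x \<ge> 0" if "x \<in> BD_states" for x
    using supp_ex[OF that] BD_eq_poisson_states[OF sm that] by auto
  show "exp ((\<Sum>i=2..N. wt i) - W) * pmf (poisson_states N wt) x \<le> BD_eq a b z x" if x: "x \<in> BD_states" and N: "N \<ge> 2" for x N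
  proof (cases "\<forall>i. i \<notin> {2..N} \<longrightarrow> x i = 0")
    case True
    then show ?thesis using BD_eq_poisson_states[OF sm x True N] by (simp add: W_def)
  next
    case False
    then have "pmf (poisson_states N wt) x = 0"
      unfolding poisson_states_def by (intro pmf_Pi_outside) auto
    then show ?thesis using nn[OF x] by simp
  qed
  show "\<exists>N\<ge>2. \<forall>x\<in>F. BD_eq a b z x \<le> pmf (poisson_states N wt) x" if F: "finite F" "F \<subseteq> BD_states" for F
  proof -
    have "\<forall>x\<in>F. \<exists>N\<ge>2. \<forall>i. i \<notin> {2..N} \<longrightarrow> x i = 0" using supp_ex F(2) by blast
    then obtain Nf where Nf: "\<And>x. x \<in> F \<Longrightarrow> Nf x \<ge> 2" "\<And>x i. x \<in> F \<Longrightarrow> i \<notin> {2..Nf x} \<Longrightarrow> x i = 0"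
      by metis
    define N where "N = 2 + (\<Sum>x\<in>F. Nf x)"
    have "BD_eq a b z x \<le> pmf (poisson_states N wt) x" if x: "x \<in> F" for x
    proof -
      have "Nf x \<le> (\<Sum>x\<in>F. Nf x)" using F(1) x by (intro member_le_sum) auto
      then have "\<forall>i. i \<notin> {2..N} \<longrightarrow> x i = 0" using Nf(2)[OF x] by (auto simp: N_def)
      then have "BD_eq a b z x = exp ((\<Sum>i=2..N. wt i) - W) * pmf (poisson_states N wt) x"
        unfolding W_def using BD_eq_poisson_states[OF sm _ _, of x N] x F(2) by (auto simp: N_def)
      also have "\<dots> \<le> 1 * pmf (poisson_states N wt) x" using sN[of N] by (intro mult_right_mono) auto
      finally show ?thesis by simp
    qed
    then show ?thesis by (intro exI[of _ N]) (auto simp: N_def)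
  qed
qed

text \<open>The truncated Poisson laws are consistent, so the marginal on the sizes up to \<open>n\<close> does not depend on \<open>N\<close>.\<close>

lemma poisson_states_cylinder:
  assumes m: "\<forall>i\<ge>2. m i > 0" and n: "n \<le> N"
  shows "measure_pmf.prob (poisson_states N m) {x. \<forall>i\<in>{2..n}. x i = y i} = (\<Prod>i=2..n. pmf (poisson_pmf (m i)) (y i))"
proof -
  define y0 where "y0 i = (if i \<in> {2..n} then y i else 0)" for i
  define r where "r f i = (if i \<in> {2..n} then f i else (0::nat))" for f :: "nat \<Rightarrow> nat" and i
  have "Pi_pmf {2..n} 0 (\<lambda>i. poisson_pmf (m i)) = map_pmf r (poisson_states N m)"
    unfolding poisson_states_def r_def[abs_def] using n by (intro Pi_pmf_subset) auto
  then have "pmf (Pi_pmf {2..n} 0 (\<lambda>i. poisson_pmf (m i))) y0 = measure_pmf.prob (poisson_states N m) (r -` {y0})"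
    by (simp add: pmf_map)
  also have "r -` {y0} = {x. \<forall>i\<in>{2..n}. x i = y i}"
    by (auto simp: r_def y0_def fun_eq_iff) metis
  finally have "measure_pmf.prob (poisson_states N m) {x. \<forall>i\<in>{2..n}. x i = y i} =
      pmf (Pi_pmf {2..n} 0 (\<lambda>i. poisson_pmf (m i))) y0" by simp
  also have "\<dots> = (\<Prod>i\<in>{2..n}. pmf (poisson_pmf (m i)) (y0 i))"
    by (intro pmf_Pi') (auto simp: y0_def)
  also have "\<dots> = (\<Prod>i=2..n. pmf (poisson_pmf (m i)) (y i))" by (intro prod.cong) (auto simp: y0_def)
  finally show ?thesis .
qed

lemma BD_stat_cylinder:
  "measure (BD_stat a b z) {x \<in> space (BD_stat a b z). \<forall>i\<in>{2..n}. x i = y i} =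
    (\<Prod>i=2..n. pmf (poisson_pmf (BD_f a b z i)) (y i))"
proof -
  interpret product_prob_space "\<lambda>i. measure_pmf (poisson_pmf (BD_f a b z i))" "{2::nat..}"
    by unfold_locales
  have "emeasure (BD_stat a b z) {x \<in> space (BD_stat a b z). \<forall>i\<in>{2..n}. x i \<in> {y i}} =
      (\<Prod>i\<in>{2..n}. emeasure (measure_pmf (poisson_pmf (BD_f a b z i))) {y i})"
    unfolding BD_stat_def by (rule emeasure_PiM_Collect) auto
  also have "\<dots> = ennreal (\<Prod>i=2..n. pmf (poisson_pmf (BD_f a b z i)) (y i))"
    by (simp add: emeasure_pmf_single prod_ennreal)
  finally have "emeasure (BD_stat a b z) {x \<in> space (BD_stat a b z). \<forall>i\<in>{2..n}. x i = y i} =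
      ennreal (\<Prod>i=2..n. pmf (poisson_pmf (BD_f a b z i)) (y i))" by simp
  then show ?thesis unfolding measure_def by (simp add: prod_nonneg)
qed

end

context BD_asymp
begin

lemma a_linear_bound: "\<exists>A. \<forall>i\<ge>1. a i \<le> A * real i"
proof -
  obtain c where c: "c > 0" "\<forall>\<^sub>F i in sequentially. norm (a i) \<le> c * norm (real i)"
    using a_linear by (elim landau_o.bigE)
  then obtain N where N: "\<And>i. i \<ge> N \<Longrightarrow> \<bar>a i\<bar> \<le> c * real i" by (auto simp: eventually_sequentially)
  define A where "A = c + (\<Sum>i=1..N. a i)"
  have s0: "(\<Sum>i=1..N. a i) \<ge> 0" using a_pos by (intro sum_nonneg) (auto simp: less_imp_le)
  have "a i \<le> A * real i" if i: "i \<ge> 1" for i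
  proof (cases "i \<ge> N")
    case True
    have "c * real i \<le> A * real i" using s0 by (intro mult_right_mono) (auto simp: A_def)
    then show ?thesis using N[OF True] by simp
  next
    case False
    have "a i \<le> (\<Sum>i=1..N. a i)" using False i a_pos by (intro member_le_sum) (auto simp: less_imp_le)
    also have "\<dots> \<le> A * 1" using c by (simp add: A_def)
    also have "\<dots> \<le> A * real i" using i s0 c by (intro mult_left_mono) (auto simp: A_def)
    finally show ?thesis .
  qed
  then show ?thesis by blast
qed

lemma wt_summable_subcritical: "z < zs \<Longrightarrow> summable wt"
  using zs_pos wt_pos by (intro summable_ratio_limit[OF _ wt_ratio_lim, of 1]) auto

lemma sqrt_wt_summable_subcritical: assumes "z < zs" shows "summable (\<lambda>i. sqrt (wt i))"
proof (rule summable_ratio_limit[of 1])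
  have "(\<lambda>i. sqrt (wt (Suc i) / wt i)) \<longlonglongrightarrow> sqrt (z / zs)" by (rule tendsto_real_sqrt[OF wt_ratio_lim])
  then show "(\<lambda>i. sqrt (wt (Suc i)) / sqrt (wt i)) \<longlonglongrightarrow> sqrt (z / zs)" by (simp add: real_sqrt_divide)
  show "sqrt (z / zs) < 1" using assms zs_pos by simp
qed (use wt_pos in auto)

lemma kap_null_subcritical: assumes "z < zs" shows "kap \<longlonglongrightarrow> 0"
  using zs_pos kap_pos assms
  by (intro summable_LIMSEQ_zero summable_ratio_limit[OF _ kap_ratio_lim, of 1]) auto

lemma inverse_kap_summable: assumes "z > zs" shows "summable (\<lambda>i. 1 / kap i)"
  using zs_pos kap_pos assms z_pos
  by (intro summable_ratio_limit[OF _ inverse_ratio_limit[OF kap_ratio_lim], of 1]) auto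

lemma inverse_wt_summable: assumes "z > zs" shows "summable (\<lambda>i. 1 / wt i)"
  using zs_pos wt_pos assms z_pos
  by (intro summable_ratio_limit[OF _ inverse_ratio_limit[OF wt_ratio_lim], of 1]) auto

text \<open>In the picture of an electric network, the resistance between \<open>i\<close> and infinity. It is finite in the super-critical case, where
\<open>BD_f a b z i / wt i\<close> is the corresponding potential for the current \<open>J\<close>.\<close>

definition resistance :: "nat \<Rightarrow> real" where "resistance i = (\<Sum>\<^sub>\<infinity>k\<in>{i..}. 1 / kap k)"

lemma BD_f_eq: assumes "i \<ge> 1" shows "BD_f a b z i = BD_J a b z * wt i * resistance i"
proof -
  have e: "a k * BD_Q a b k * z ^ (k + 1) = kap k" for k by (simp add: kap_def wt_def)
  show ?thesis unfolding BD_f_def resistance_def e by (simp add: wt_def)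
qed

lemma BD_J_eq: "BD_J a b z = inverse (resistance 1)"
proof -
  have e: "a k * BD_Q a b k * z ^ (k + 1) = kap k" for k by (simp add: kap_def wt_def)
  show ?thesis unfolding BD_J_def resistance_def e ..
qed

lemma resistance_Suc: assumes zz: "z > zs" and i: "i \<ge> 1" shows "resistance i = 1 / kap i + resistance (Suc i)"
proof -
  have s: "(\<lambda>k. 1 / kap k) summable_on {Suc i..}"
    by (rule summable_imp_summable_on_pos[OF inverse_kap_summable[OF zz]]) (use kap_pos in auto)
  have "{i..} = {i} \<union> {Suc i..}" by auto
  then show ?thesis unfolding resistance_def using infsum_Un_disjoint[OF summable_on_finite[of "{i}"] s] by simp
qed

lemma resistance_pos: assumes zz: "z > zs" and i: "i \<ge> 1" shows "resistance i > 0"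
proof -
  have "resistance (Suc i) \<ge> 0" unfolding resistance_def using kap_pos by (intro infsum_nonneg) (auto simp: less_imp_le)
  then show ?thesis using resistance_Suc[OF assms] kap_pos[OF i] by (simp add: add_pos_nonneg)
qed

lemma BD_J_pos: "z > zs \<Longrightarrow> BD_J a b z > 0"
  using resistance_pos[of 1] by (simp add: BD_J_eq)

lemma BD_f_pos: "z > zs \<Longrightarrow> i \<ge> 1 \<Longrightarrow> BD_f a b z i > 0"
  using resistance_pos BD_J_pos wt_pos by (simp add: BD_f_eq)

lemma BD_f_1: assumes "z > zs" shows "BD_f a b z 1 = z"
  using resistance_pos[OF assms, of 1] wt_1 by (simp add: BD_f_eq BD_J_eq)

lemma BD_f_flux: assumes zz: "z > zs" and i: "i \<ge> 1"
  shows "a i * z * BD_f a b z i - b (Suc i) * BD_f a b z (Suc i) = BD_J a b z"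
proof -
  have "b (Suc i) * BD_f a b z (Suc i) = BD_J a b z * (wt (Suc i) * b (Suc i)) * resistance (Suc i)"
    by (simp add: BD_f_eq)
  also have "wt (Suc i) * b (Suc i) = kap i" by (rule wt_Suc[OF i])
  finally have 1: "b (Suc i) * BD_f a b z (Suc i) = BD_J a b z * kap i * resistance (Suc i)" .
  have "a i * z * BD_f a b z i = BD_J a b z * kap i * resistance i" using i by (simp add: BD_f_eq kap_def)
  also have "\<dots> = BD_J a b z * kap i * (1 / kap i) + BD_J a b z * kap i * resistance (Suc i)"
    unfolding resistance_Suc[OF zz i] by (simp add: distrib_left)
  finally show ?thesis unfolding 1 using kap_pos[OF i] by simp
qed

text \<open>The conductances eventually grow at least by a factor \<open>\<rho> > 1\<close> per step, so the sum is dominated by the geometric series, written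
here as a telescoping sum of the differences of \<open>c / kap i\<close>.\<close>

lemma kap_resistance_bounded:
  assumes zz: "z > zs"
  shows "\<exists>c n. n \<ge> 1 \<and> (\<forall>i\<ge>n. kap i * resistance i \<le> c)"
proof -
  obtain \<rho> where \<rho>: "1 < \<rho>" "\<rho> < z / zs" using dense[of 1 "z / zs"] zz zs_pos by auto
  have "\<forall>\<^sub>F i in sequentially. kap (Suc i) / kap i > \<rho>" using order_tendstoD(1)[OF kap_ratio_lim \<rho>(2)] .
  then obtain n0 where n0: "\<And>i. i \<ge> n0 \<Longrightarrow> kap (Suc i) / kap i > \<rho>" by (auto simp: eventually_sequentially)
  define n where "n = max n0 1"
  define c where "c = \<rho> / (\<rho> - 1)"
  have c: "c > 0" using \<rho> by (simp add: c_def)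
  have step: "1 / kap i \<le> c / kap i - c / kap (Suc i)" if i: "i \<ge> n" for i
  proof -
    have k: "kap i > 0" "kap (Suc i) > 0" using kap_pos i by (auto simp: n_def)
    have "\<rho> * kap i < kap (Suc i)" using n0[of i] i k by (simp add: n_def field_simps)
    then have "1 / kap (Suc i) \<le> 1 / (\<rho> * kap i)" using k \<rho> by (intro divide_left_mono) auto
    then have "c * (1 / kap (Suc i)) \<le> c * (1 / (\<rho> * kap i))" using c by (intro mult_left_mono) auto
    moreover have "c * (1 / (\<rho> * kap i)) = (c - 1) / kap i"
      using \<rho> k by (simp add: c_def field_simps)
    ultimately show ?thesis by (simp add: diff_divide_distrib)
  qed
  have "kap i * resistance i \<le> c" if i: "i \<ge> n" for i
  proof -
    have tel: "(\<Sum>k=i..<i+m. 1 / kap k) \<le> c / kap i - c / kap (i + m)" for m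
    proof (induction m)
      case (Suc m)
      then show ?case using step[of "i + m"] i by simp
    qed simp
    have i1: "i \<ge> 1" using i by (simp add: n_def)
    have "resistance i \<le> c / kap i"
      unfolding resistance_def
    proof (rule infsum_le_finite_sums)
      show "(\<lambda>k. 1 / kap k) summable_on {i..}"
        by (rule summable_imp_summable_on_pos[OF inverse_kap_summable[OF zz]]) (use kap_pos i1 in auto)
      fix F assume F: "finite F" "F \<subseteq> {i..}"
      obtain M where M: "\<And>k. k \<in> F \<Longrightarrow> k < M" using F(1) finite_nat_set_iff_bounded by auto
      have "(\<Sum>k\<in>F. 1 / kap k) \<le> (\<Sum>k=i..<i+M. 1 / kap k)"
      proof (intro sum_mono2)
        show "F \<subseteq> {i..<i+M}" using F(2) M by (force intro: trans_less_add2)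
        show "0 \<le> 1 / kap k" if "k \<in> {i..<i+M} - F" for k using kap_pos[of k] that i1 by simp
      qed simp
      also have "\<dots> \<le> c / kap i" using tel[of M] c kap_pos[of "i + M"] i1 by (smt (verit) divide_pos_pos trans_le_add1)
      finally show "(\<Sum>k\<in>F. 1 / kap k) \<le> c / kap i" .
    qed
    then show ?thesis using kap_pos[OF i1] by (simp add: field_simps)
  qed
  moreover have "n \<ge> 1" by (simp add: n_def)
  ultimately show ?thesis by blast
qed

lemma BD_f_in_H: assumes zz: "z > zs" shows "(\<lambda>i. (BD_f a b z i)\<^sup>2 / wt i) summable_on {2..}"
proof -
  obtain c n where cn: "n \<ge> 1" "\<forall>i\<ge>n. kap i * resistance i \<le> c" using kap_resistance_bounded[OF zz] by blast
  define D where "D = (BD_J a b z * c / z)\<^sup>2"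
  have "\<forall>\<^sub>F i in sequentially. norm ((BD_f a b z i)\<^sup>2 / wt i) \<le> D * (1 / wt i)"
    using eventually_ge_at_top[of n] a_at_top[unfolded filterlim_at_top, rule_format, of 1]
  proof eventually_elim
    case (elim i)
    have i: "i \<ge> 1" using elim cn by simp
    have w: "wt i > 0" by (rule wt_pos[OF i])
    have "wt i * resistance i * (a i * z) \<le> c" using cn(2)[rule_format, OF elim(1)] by (simp add: kap_def algebra_simps)
    moreover have wt0: "wt i * resistance i \<ge> 0" using resistance_pos[OF zz i] w by simp
    then have "wt i * resistance i * (1 * z) \<le> wt i * resistance i * (a i * z)"
      using elim(2) z_pos by (intro mult_left_mono mult_right_mono) auto
    ultimately have "wt i * resistance i * z \<le> c" by simp
    then have "wt i * resistance i \<le> c / z" using z_pos by (simp add: field_simps)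
    then have "BD_f a b z i \<le> BD_J a b z * c / z"
      using mult_left_mono[of "wt i * resistance i" "c / z" "BD_J a b z"] BD_J_pos[OF zz] by (simp add: BD_f_eq[OF i] algebra_simps)
    then have "(BD_f a b z i)\<^sup>2 \<le> D" unfolding D_def using BD_f_pos[OF zz i] by (intro power_mono) auto
    then show ?case using w by (simp add: divide_right_mono)
  qed
  moreover have "summable (\<lambda>i. D * (1 / wt i))" by (rule summable_mult[OF inverse_wt_summable[OF zz]])
  ultimately have "summable (\<lambda>i. (BD_f a b z i)\<^sup>2 / wt i)" by (rule summable_comparison_test_ev)
  then show ?thesis
    by (rule summable_imp_summable_on_pos) (use BD_f_pos[OF zz] wt_pos in \<open>auto intro!: divide_pos_pos zero_less_power\<close>)
qed

lemma L2_set_BD_f_le: assumes zz: "z > zs"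
  shows "L2_set (\<lambda>k. BD_f a b z k / sqrt (wt k)) {2..N} \<le> norm_H a b z (BD_f a b z)"
proof -
  have "(\<Sum>k=2..N. (BD_f a b z k / sqrt (wt k))\<^sup>2) = (\<Sum>k=2..N. (BD_f a b z k)\<^sup>2 / wt k)"
    using wt_pos by (intro sum.cong refl) (simp add: power_divide less_imp_le)
  also have "\<dots> \<le> (\<Sum>\<^sub>\<infinity>k\<in>{2..}. (BD_f a b z k)\<^sup>2 / wt k)"
    using wt_pos by (intro finite_sum_le_infsum BD_f_in_H[OF zz]) (auto simp: less_imp_le)
  finally show ?thesis unfolding L2_set_def norm_H_def wt_def[symmetric] by (rule real_sqrt_le_mono)
qed

section \<open>Exponential trend to equilibrium\<close>

text \<open>With \<open>m = wt\<close> the flux \<open>J\<close> is zero and the boundary term at \<open>N\<close> is at most \<open>2 * t * kap N\<close>, which tends to 0.\<close>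

theorem subcritical_bound:
  assumes lam: "BD_spectral_constant a b z lam" and sub: "z < zs"
    and proc: "BD_process a b z M C" and p: "set_pmf p \<subseteq> BD_states"
    and init: "\<And>c. c \<in> BD_states \<Longrightarrow> measure M {\<omega> \<in> space M. C 0 \<omega> = c} = pmf p c"
    and E: "((\<lambda>x. pmf p x * load (\<lambda>k. 1 / sqrt (wt k)) x) has_sum E) BD_states"
    and t: "0 \<le> t"
  shows "tv_dist BD_states (\<lambda>c. measure M {\<omega> \<in> space M. C t \<omega> = c}) (BD_eq a b z)
           \<le> sqrt (\<Sum>\<^sub>\<infinity>i\<in>{2..}. wt i) *
               (E + expect BD_states (BD_eq a b z) (\<lambda>c. load (\<lambda>k. 1 / sqrt (wt k)) c)) * exp (- lam * t)"
proof -
  let ?h = "load (\<lambda>k. 1 / sqrt (wt k))" and ?\<pi> = "BD_eq a b z"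
  obtain A where A: "\<And>i. i \<ge> 1 \<Longrightarrow> a i \<le> A * real i" using a_linear_bound by blast
  have lam0: "lam \<ge> 0" using lam by (simp add: BD_spectral_constant_def)
  have sm: "summable wt" by (rule wt_summable_subcritical[OF sub])
  define W where "W = (\<Sum>i. wt (i + 2))"
  define s where "s N = (\<Sum>i=2..N. wt i)" for N
  note eq = BD_eq_approximation[OF sm, folded W_def s_def]
  define K where "K = sqrt (\<Sum>\<^sub>\<infinity>i\<in>{2..}. wt i)"
  have wton: "wt summable_on {2..}" by (rule summable_imp_summable_on_pos[OF sm]) (use wt_pos in auto)
  have K2: "K\<^sup>2 = (\<Sum>\<^sub>\<infinity>i\<in>{2..}. wt i)"
    unfolding K_def using wt_pos by (intro real_sqrt_pow2 infsum_nonneg) (auto simp: less_imp_le)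
  have K0: "K \<ge> 0" unfolding K_def using wt_pos by (auto intro!: infsum_nonneg simp: less_imp_le)
  have KN: "(\<Sum>i=2..N. wt i * (1::real)\<^sup>2) \<le> K\<^sup>2" for N
    unfolding K2 using wt_pos by (simp, intro finite_sum_le_infsum wton) (auto simp: less_imp_le)
  have wp: "\<forall>i\<ge>2. wt i > 0" using wt_pos by auto
  have fl: "\<forall>i\<ge>1. a i * z * wt i - b (Suc i) * wt (Suc i) = 0"
    using wt_Suc by (simp add: kap_def algebra_simps)
  obtain P where P: "transition_function BD_states P" "has_generator BD_states P gen" and
    lawP: "\<forall>t\<ge>0. \<forall>B. measure M {\<omega> \<in> space M. C t \<omega> \<in> B} = measure_pmf.prob (bind_pmf p (trans_pmf BD_states P t)) B"
    using markov_chain_law[OF proc[unfolded BD_process_def] countable_BD_states p init] by blast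
  define \<mu> where "\<mu> = bind_pmf p (trans_pmf BD_states P t)"
  have \<mu>: "set_pmf \<mu> \<subseteq> BD_states" "\<And>D. measure M {\<omega> \<in> space M. C t \<omega> \<in> D} = measure_pmf.prob \<mu> D"
    using set_trans_pmf[OF P(1) t] p lawP t unfolding \<mu>_def by auto
  note sol_facts = sol_spectral_constant_pos[OF lam] sol_1 bd_op_sol
  have \<mu>c: "measure M {\<omega> \<in> space M. C t \<omega> = c} = pmf \<mu> c" for c
    using \<mu>(2)[of "{c}"] by (simp add: measure_pmf_single)
  have fin1: "sum ?\<pi> F \<le> 1" if F: "finite F" "F \<subseteq> BD_states" for F
  proof -
    obtain N where N: "\<forall>x\<in>F. ?\<pi> x \<le> pmf (poisson_states N wt) x" using eq(4)[OF F] by blast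
    have "sum ?\<pi> F \<le> (\<Sum>x\<in>F. pmf (poisson_states N wt) x)" using N by (intro sum_mono) auto
    also have "\<dots> \<le> 1" using F by (simp add: measure_measure_pmf_finite[symmetric])
    finally show ?thesis .
  qed
  have \<pi>on: "?\<pi> summable_on BD_states"
    by (rule nonneg_bdd_above_summable_on) (use fin1 eq(5) in \<open>auto intro!: bdd_aboveI[of _ 1]\<close>)
  have \<pi>1: "infsum ?\<pi> BD_states \<le> 1" by (rule infsum_le_finite_sums[OF \<pi>on fin1])
  have h0: "?h x \<ge> 0" if "x \<in> BD_states" for x
    by (rule load_nonneg[OF _ that]) (use wt_pos in \<open>simp add: less_imp_le\<close>)
  have load\<nu>: "((\<lambda>x. pmf (poisson_states N wt) x * ?h x) has_sum (\<Sum>k=2..N. wt k * (1 / sqrt (wt k)))) BD_states" for N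
    by (rule poisson_states_load[OF wp])
  have wsq: "wt k * (1 / sqrt (wt k)) = sqrt (wt k)" if "k \<ge> 2" for k
    using wt_pos[of k] that by (simp add: real_div_sqrt)
  have sq: "summable (\<lambda>k. sqrt (wt (k + 2)))"
    by (rule summable_ignore_initial_segment[OF sqrt_wt_summable_subcritical[OF sub]])
  have fin2: "(\<Sum>x\<in>F. ?h x * ?\<pi> x) \<le> (\<Sum>k. sqrt (wt (k + 2)))" if F: "finite F" "F \<subseteq> BD_states" for F
  proof -
    obtain N where N: "N \<ge> 2" "\<forall>x\<in>F. ?\<pi> x \<le> pmf (poisson_states N wt) x" using eq(4)[OF F] by blast
    have "(\<Sum>x\<in>F. ?h x * ?\<pi> x) \<le> (\<Sum>x\<in>F. pmf (poisson_states N wt) x * ?h x)"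
    proof (rule sum_mono)
      fix x assume x: "x \<in> F"
      then have "?h x * ?\<pi> x \<le> ?h x * pmf (poisson_states N wt) x" using N(2) h0 F(2) by (intro mult_left_mono) auto
      then show "?h x * ?\<pi> x \<le> pmf (poisson_states N wt) x * ?h x" by (simp add: mult.commute)
    qed
    also have "\<dots> \<le> (\<Sum>k=2..N. wt k * (1 / sqrt (wt k)))"
      by (rule finite_sum_le_has_sum[OF load\<nu>]) (use F h0 in auto)
    also have "\<dots> = (\<Sum>k\<in>{0+2..(N-2)+2}. sqrt (wt k))" using N(1) wsq by (intro sum.cong) auto
    also have "\<dots> = (\<Sum>k\<le>N-2. sqrt (wt (k + 2)))" by (simp only: sum.shift_bounds_cl_nat_ivl atMost_atLeast0)
    also have "\<dots> \<le> (\<Sum>k. sqrt (wt (k + 2)))" by (rule sum_le_suminf[OF sq]) (use wt_pos in \<open>auto simp: less_imp_le\<close>)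
    finally show ?thesis .
  qed
  have hon: "(\<lambda>x. ?h x * ?\<pi> x) summable_on BD_states"
    by (rule nonneg_bdd_above_summable_on) (use fin2 eq(5) h0 in \<open>auto intro!: bdd_aboveI[of _ "\<Sum>k. sqrt (wt (k + 2))"]\<close>)
  define Eeq where "Eeq = expect BD_states ?\<pi> ?h"
  have Eeq: "((\<lambda>x. ?h x * ?\<pi> x) has_sum Eeq) BD_states" unfolding Eeq_def expect_def using hon by (rule has_sum_infsum)
  have L2: "L2_set (\<lambda>k. wt k / sqrt (wt k)) {2..N} \<le> exp (W - s N) * Eeq" if N: "N \<ge> 2" for N
  proof -
    have "exp (s N - W) * (\<Sum>k=2..N. wt k * (1 / sqrt (wt k))) \<le> Eeq"
    proof (rule has_sum_mono[OF has_sum_cmult_right[OF load\<nu>] Eeq])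
      fix x assume x: "x \<in> BD_states"
      have "(exp (s N - W) * pmf (poisson_states N wt) x) * ?h x \<le> ?\<pi> x * ?h x"
        by (rule mult_right_mono[OF eq(3)[OF x N] h0[OF x]])
      then show "exp (s N - W) * (pmf (poisson_states N wt) x * ?h x) \<le> ?h x * ?\<pi> x" by (simp add: algebra_simps)
    qed
    then have "exp (W - s N) * (exp (s N - W) * (\<Sum>k=2..N. wt k * (1 / sqrt (wt k)))) \<le> exp (W - s N) * Eeq"
      by (intro mult_left_mono) auto
    then have "(\<Sum>k=2..N. wt k / sqrt (wt k)) \<le> exp (W - s N) * Eeq"
      by (simp add: mult.assoc[symmetric] exp_add[symmetric])
    moreover have "L2_set (\<lambda>k. wt k / sqrt (wt k)) {2..N} \<le> (\<Sum>k=2..N. wt k / sqrt (wt k))"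
      using wt_pos by (intro L2_set_le_sum) (auto simp: less_imp_le)
    ultimately show ?thesis by linarith
  qed
  define B where "B = {x \<in> BD_states. pmf \<mu> x > ?\<pi> x}"
  have BS: "B \<subseteq> BD_states" by (auto simp: B_def)
  have \<pi>B: "(?\<pi> has_sum infsum ?\<pi> B) B" by (rule has_sum_infsum[OF summable_on_subset_banach[OF \<pi>on BS]])
  have tv: "tv_dist BD_states (pmf \<mu>) ?\<pi> \<le> measure_pmf.prob \<mu> B - infsum ?\<pi> B"
    unfolding B_def
    by (rule tv_dist_le_positive_part[OF pmf_has_sum_1[OF \<mu>(1)] has_sum_infsum[OF \<pi>on] \<pi>1 pmf_has_sum_prob \<pi>B[unfolded B_def]])
  have main: "tv_dist BD_states (pmf \<mu>) ?\<pi> \<le> K * (E + exp (W - s N) * Eeq) * exp (- lam * t) + t * (2 * kap N) + (1 - exp (s N - W))"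
    if N: "N \<ge> 2" for N
  proof -
    have "exp (s N - W) * measure_pmf.prob (poisson_states N wt) B \<le> infsum ?\<pi> B"
      by (rule has_sum_mono[OF has_sum_cmult_right[OF pmf_has_sum_prob] \<pi>B]) (use eq(3)[OF _ N] BS in auto)
    moreover have "(1 - exp (s N - W)) * measure_pmf.prob (poisson_states N wt) B \<le> (1 - exp (s N - W)) * 1"
      using eq(2)[of N] by (intro mult_left_mono) auto
    moreover have "measure_pmf.prob \<mu> B - measure_pmf.prob (poisson_states N wt) B \<le>
        K * (E + L2_set (\<lambda>k. wt k / sqrt (wt k)) {2..N}) * exp (- lam * t)
        + t * (\<bar>0\<bar> * min 1 (K / sqrt (wt N)) + wt N * a N * z * (min 1 (K / sqrt (wt (Suc N))) + min 1 (K / sqrt (wt N))))"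
      unfolding \<mu>_def
    proof (rule law_comparison[where h = "sol lam" and \<eta> = "\<lambda>_. 1"])
      show "\<bar>diff_cl (indicator B) i x\<bar> \<le> 1" for x i by (simp add: diff_cl_def indicator_def)
    qed (fact sol_facts lam0 A P p E t KN K0 wp wt_1 fl N)+
    moreover have "K * (E + L2_set (\<lambda>k. wt k / sqrt (wt k)) {2..N}) * exp (- lam * t) \<le> K * (E + exp (W - s N) * Eeq) * exp (- lam * t)"
      using L2[OF N] K0 by (intro mult_right_mono mult_left_mono) auto
    moreover have "t * (\<bar>0\<bar> * min 1 (K / sqrt (wt N)) + wt N * a N * z * (min 1 (K / sqrt (wt (Suc N))) + min 1 (K / sqrt (wt N)))) \<le> t * (2 * kap N)"
    proof (rule mult_left_mono[OF _ t])
      have "min 1 (K / sqrt (wt (Suc N))) + min 1 (K / sqrt (wt N)) \<le> 2" by linarith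
      moreover have "wt N * a N * z = kap N" by (simp add: kap_def)
      moreover have "kap N \<ge> 0" using kap_pos[of N] N by simp
      ultimately show "\<bar>0\<bar> * min 1 (K / sqrt (wt N)) + wt N * a N * z * (min 1 (K / sqrt (wt (Suc N))) + min 1 (K / sqrt (wt N))) \<le> 2 * kap N"
        using mult_left_mono[of "min 1 (K / sqrt (wt (Suc N))) + min 1 (K / sqrt (wt N))" 2 "kap N"] by simp
    qed
    ultimately show ?thesis using tv by (simp add: algebra_simps)
  qed
  have "(\<lambda>N. K * (E + exp (W - s N) * Eeq) * exp (- lam * t) + t * (2 * kap N) + (1 - exp (s N - W)))
      \<longlonglongrightarrow> K * (E + exp (W - W) * Eeq) * exp (- lam * t) + t * (2 * 0) + (1 - exp (W - W))"
    by (intro tendsto_add tendsto_mult tendsto_diff tendsto_exp tendsto_const eq(1) kap_null_subcritical[OF sub])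
  then have "tv_dist BD_states (pmf \<mu>) ?\<pi> \<le> K * (E + exp (W - W) * Eeq) * exp (- lam * t) + t * (2 * 0) + (1 - exp (W - W))"
    by (rule LIMSEQ_le_const) (use main in auto)
  then show ?thesis unfolding \<mu>c K_def Eeq_def by simp
qed

text \<open>For an event that only depends on the sizes \<open>2..n\<close> the initial sensitivity vanishes above \<open>n\<close>, which gives the constant \<open>K\<close>
of the statement. Since \<open>wt N\<close> tends to infinity, a cluster of size \<open>N\<close> has a vanishing influence on such an event,
uniformly in time, whereas \<open>a N * f N\<close> stays bounded. Hence the boundary terms vanish.\<close>

theorem supercritical_bound:
  assumes lam: "BD_spectral_constant a b z lam" and super: "z > zs"
    and proc: "BD_process a b z M C" and p: "set_pmf p \<subseteq> BD_states"
    and init: "\<And>c. c \<in> BD_states \<Longrightarrow> measure M {\<omega> \<in> space M. C 0 \<omega> = c} = pmf p c"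
    and E: "((\<lambda>x. pmf p x * load (\<lambda>k. 1 / sqrt (wt k)) x) has_sum E) BD_states"
    and t: "0 \<le> t"
  shows "tv_dist (PiE {2..n} (\<lambda>_. UNIV))
             (\<lambda>y. measure M {\<omega> \<in> space M. \<forall>i\<in>{2..n}. C t \<omega> i = y i})
             (\<lambda>y. measure (BD_stat a b z) {x \<in> space (BD_stat a b z). \<forall>i\<in>{2..n}. x i = y i})
           \<le> sqrt (\<Sum>i=2..n. wt i) * (E + norm_H a b z (BD_f a b z)) * exp (- lam * t)"
proof -
  let ?S = "PiE {2..n} (\<lambda>_. UNIV) :: (nat \<Rightarrow> nat) set" and ?f = "BD_f a b z" and ?J = "BD_J a b z"
  obtain A where A: "\<And>i. i \<ge> 1 \<Longrightarrow> a i \<le> A * real i" using a_linear_bound by blast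
  have lam0: "lam \<ge> 0" using lam by (simp add: BD_spectral_constant_def)
  define K where "K = sqrt (\<Sum>i=2..n. wt i)"
  define \<eta> :: "nat \<Rightarrow> real" where "\<eta> i = (if i \<in> {2..n} then 1 else 0)" for i
  have s0: "(\<Sum>i=2..n. wt i) \<ge> 0" using wt_pos by (intro sum_nonneg) (auto simp: less_imp_le)
  have K0: "K \<ge> 0" using s0 by (simp add: K_def)
  have KN: "(\<Sum>i=2..N. wt i * (\<eta> i)\<^sup>2) \<le> K\<^sup>2" for N
  proof -
    have "(\<Sum>i=2..N. wt i * (\<eta> i)\<^sup>2) = (\<Sum>i\<in>{2..N} \<inter> {2..n}. wt i)"
      unfolding \<eta>_def by (subst sum.inter_restrict) (auto intro!: sum.cong)
    also have "\<dots> \<le> (\<Sum>i=2..n. wt i)" using wt_pos by (intro sum_mono2) (auto simp: less_imp_le)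
    also have "\<dots> = K\<^sup>2" using s0 by (simp add: K_def)
    finally show ?thesis .
  qed
  have fp: "\<forall>i\<ge>2. ?f i > 0" using BD_f_pos[OF super] by auto
  have fl: "\<forall>i\<ge>1. a i * z * ?f i - b (Suc i) * ?f (Suc i) = ?J" using BD_f_flux[OF super] by auto
  obtain P where P: "transition_function BD_states P" "has_generator BD_states P gen" and
    lawP: "\<forall>t\<ge>0. \<forall>B. measure M {\<omega> \<in> space M. C t \<omega> \<in> B} = measure_pmf.prob (bind_pmf p (trans_pmf BD_states P t)) B"
    using markov_chain_law[OF proc[unfolded BD_process_def] countable_BD_states p init] by blast
  define \<mu> where "\<mu> = bind_pmf p (trans_pmf BD_states P t)"
  have \<mu>: "set_pmf \<mu> \<subseteq> BD_states" "\<And>D. measure M {\<omega> \<in> space M. C t \<omega> \<in> D} = measure_pmf.prob \<mu> D"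
    using set_trans_pmf[OF P(1) t] p lawP t unfolding \<mu>_def by auto
  note sol_facts = sol_spectral_constant_pos[OF lam] sol_1 bd_op_sol
  \<comment> \<open>The functions in \<open>PiE {2..n}\<close> are undefined outside \<open>{2..n}\<close>, unlike configurations, so the marginal is an image under restriction.\<close>
  define r :: "(nat \<Rightarrow> nat) \<Rightarrow> nat \<Rightarrow> nat" where "r x = restrict x {2..n}" for x
  have rS: "r x \<in> ?S" for x by (auto simp: r_def)
  have rv: "r -` {y} = {x. \<forall>i\<in>{2..n}. x i = y i}" if y: "y \<in> ?S" for y
  proof (intro set_eqI iffI)
    fix x assume "x \<in> {x. \<forall>i\<in>{2..n}. x i = y i}"
    then have "r x = y" by (intro PiE_ext[OF rS y]) (auto simp: r_def)
    then show "x \<in> r -` {y}" by simp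
  qed (auto simp: r_def)
  have law: "measure M {\<omega> \<in> space M. \<forall>i\<in>{2..n}. C t \<omega> i = y i} = pmf (map_pmf r \<mu>) y" if y: "y \<in> ?S" for y
    using \<mu>(2)[of "r -` {y}"] unfolding pmf_map rv[OF y] by simp
  have stat: "measure (BD_stat a b z) {x \<in> space (BD_stat a b z). \<forall>i\<in>{2..n}. x i = y i} = pmf (map_pmf r (poisson_states N ?f)) y"
    if y: "y \<in> ?S" and N: "N \<ge> n" for y N
    unfolding BD_stat_cylinder pmf_map rv[OF y] using poisson_states_cylinder[OF fp N] by simp
  obtain c n1 where cn: "n1 \<ge> 1" "\<forall>i\<ge>n1. kap i * resistance i \<le> c" using kap_resistance_bounded[OF super] by blast
  define tv where "tv = tv_dist ?S (\<lambda>y. measure M {\<omega> \<in> space M. \<forall>i\<in>{2..n}. C t \<omega> i = y i})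
             (\<lambda>y. measure (BD_stat a b z) {x \<in> space (BD_stat a b z). \<forall>i\<in>{2..n}. x i = y i})"
  define \<delta> where "\<delta> N = K * sqrt (1 / wt N)" for N
  have main: "tv \<le> K * (E + norm_H a b z ?f) * exp (- lam * t) + t * (?J * \<delta> N + ?J * c * (\<delta> (Suc N) + \<delta> N))"
    if N: "N \<ge> max 2 (max n n1)" for N
  proof -
    let ?\<nu> = "poisson_states N ?f"
    have N2: "N \<ge> 2" and Nn: "N \<ge> n" and Nn1: "N \<ge> n1" using N by auto
    define B where "B = {y \<in> ?S. pmf (map_pmf r \<mu>) y > pmf (map_pmf r ?\<nu>) y}"
    have "tv = tv_dist ?S (pmf (map_pmf r \<mu>)) (pmf (map_pmf r ?\<nu>))"
      unfolding tv_def tv_dist_def using law stat[OF _ Nn] by (simp cong: infsum_cong)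
    also have "\<dots> \<le> measure_pmf.prob (map_pmf r \<mu>) B - measure_pmf.prob (map_pmf r ?\<nu>) B"
      unfolding B_def
      by (rule tv_dist_le_positive_part[OF pmf_has_sum_1 pmf_has_sum_1 order.refl pmf_has_sum_prob pmf_has_sum_prob]) (use rS in auto)
    also have "\<dots> = measure_pmf.prob \<mu> (r -` B) - measure_pmf.prob ?\<nu> (r -` B)" by simp
    also have "\<dots> \<le> K * (E + L2_set (\<lambda>k. ?f k / sqrt (wt k)) {2..N}) * exp (- lam * t)
        + t * (\<bar>?J\<bar> * min 1 (K / sqrt (wt N)) + ?f N * a N * z * (min 1 (K / sqrt (wt (Suc N))) + min 1 (K / sqrt (wt N))))"
      unfolding \<mu>_def
    proof (rule law_comparison[where h = "sol lam" and \<eta> = \<eta>])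
      fix x and i :: nat assume "x \<in> BD_states" and i: "i \<ge> 2"
      have "r (add_cl x i) = r x" if "i \<notin> {2..n}"
        using that by (auto simp: r_def add_cl_def restrict_def fun_eq_iff)
      then show "\<bar>diff_cl (indicator (r -` B)) i x\<bar> \<le> \<eta> i"
        by (auto simp: diff_cl_def indicator_def \<eta>_def)
    qed (fact sol_facts lam0 A P p E t KN K0 fp BD_f_1[OF super] fl N2)+
    also have "\<dots> \<le> K * (E + norm_H a b z ?f) * exp (- lam * t) + t * (?J * \<delta> N + ?J * c * (\<delta> (Suc N) + \<delta> N))"
    proof (intro add_mono mult_right_mono mult_left_mono)
      show "L2_set (\<lambda>k. ?f k / sqrt (wt k)) {2..N} \<le> norm_H a b z ?f" by (rule L2_set_BD_f_le[OF super])
      show "\<bar>?J\<bar> * min 1 (K / sqrt (wt N)) \<le> ?J * \<delta> N"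
        using BD_J_pos[OF super] mult_left_mono[of "min 1 (K / sqrt (wt N))" "\<delta> N" "?J"] by (simp add: \<delta>_def real_sqrt_divide)
      have "?f N * a N * z = ?J * (kap N * resistance N)" using N2 by (simp add: BD_f_eq kap_def algebra_simps)
      also have "\<dots> \<le> ?J * c" using cn(2)[rule_format, OF Nn1] BD_J_pos[OF super] by (intro mult_left_mono) auto
      finally have fc: "?f N * a N * z \<le> ?J * c" .
      have f0: "0 \<le> ?f N * a N * z" using fp a_pos[of N] z_pos N2 by (simp add: less_imp_le)
      have d0: "0 \<le> min 1 (K / sqrt (wt (Suc N))) + min 1 (K / sqrt (wt N))"
        using K0 wt_pos[of N] wt_pos[of "Suc N"] N2 by simp
      show "?f N * a N * z * (min 1 (K / sqrt (wt (Suc N))) + min 1 (K / sqrt (wt N))) \<le> ?J * c * (\<delta> (Suc N) + \<delta> N)"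
        by (rule mult_mono[OF fc]) (use f0 fc d0 in \<open>auto simp: \<delta>_def real_sqrt_divide\<close>)
    qed (use K0 t in auto)
    finally show ?thesis .
  qed
  have \<delta>0: "\<delta> \<longlonglongrightarrow> K * sqrt 0"
    unfolding \<delta>_def by (intro tendsto_mult tendsto_const tendsto_real_sqrt summable_LIMSEQ_zero inverse_wt_summable[OF super])
  have "(\<lambda>N. K * (E + norm_H a b z ?f) * exp (- lam * t) + t * (?J * \<delta> N + ?J * c * (\<delta> (Suc N) + \<delta> N)))
      \<longlonglongrightarrow> K * (E + norm_H a b z ?f) * exp (- lam * t) + t * (?J * (K * sqrt 0) + ?J * c * (K * sqrt 0 + K * sqrt 0))"
    by (intro tendsto_add tendsto_mult tendsto_const \<delta>0 LIMSEQ_Suc[OF \<delta>0])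
  then have "tv \<le> K * (E + norm_H a b z ?f) * exp (- lam * t) + t * (?J * (K * sqrt 0) + ?J * c * (K * sqrt 0 + K * sqrt 0))"
    by (rule LIMSEQ_le_const) (use main in blast)
  then show ?thesis by (simp add: tv_def K_def)
qed

end

theorem theorem4p1:
  fixes a b :: "nat \<Rightarrow> real" and z zs lam :: real
    and Pin :: "(nat \<Rightarrow> nat) pmf"
    and M :: "'w measure" and C :: "real \<Rightarrow> 'w \<Rightarrow> nat \<Rightarrow> nat"
  assumes "z > 0"
    and "\<And>i. i \<ge> 1 \<Longrightarrow> a i > 0"
    and "\<And>i. i \<ge> 2 \<Longrightarrow> b i > 0"
    and "zs > 0"
    and "(\<lambda>i. b i / a i) \<longlonglongrightarrow> zs"
    and "(\<lambda>i. b (i + 1) / b i) \<longlonglongrightarrow> 1"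
    and "(\<lambda>i. b (i + 1) / b i - 1) \<in> O(\<lambda>i. 1 / real i)"
    and "(\<lambda>i. a (i + 1) / a i - 1) \<in> O(\<lambda>i. 1 / real i)"
    and "a \<in> O(\<lambda>i. real i)"
    and "filterlim a at_top sequentially"
    and "set_pmf Pin \<subseteq> BD_states"
    and "(\<lambda>c. inner_H a b z (\<lambda>i. real (c i)) (sqrt_Q a b z) * pmf Pin c) summable_on BD_states"
    and "BD_process a b z M C"
    and "\<And>c. c \<in> BD_states \<Longrightarrow> measure M {\<omega> \<in> space M. C 0 \<omega> = c} = pmf Pin c"
    and "BD_spectral_constant a b z lam"
  shows
    "(z < zs \<longrightarrow>
        (\<forall>t\<ge>0.
           tv_dist BD_states (\<lambda>c. measure M {\<omega> \<in> space M. C t \<omega> = c}) (BD_eq a b z)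
           \<le> sqrt (\<Sum>\<^sub>\<infinity>i\<in>{2..}. BD_Q a b i * z ^ i) *
               (expect BD_states (pmf Pin) (\<lambda>c. inner_H a b z (\<lambda>i. real (c i)) (sqrt_Q a b z)) +
                expect BD_states (BD_eq a b z) (\<lambda>c. inner_H a b z (\<lambda>i. real (c i)) (sqrt_Q a b z))) *
               exp (- lam * t))) \<and>
     (z > zs \<longrightarrow>
        (\<forall>t\<ge>0. \<forall>n\<ge>2.
           tv_dist (PiE {2..n} (\<lambda>_. UNIV))
             (\<lambda>y. measure M {\<omega> \<in> space M. \<forall>i\<in>{2..n}. C t \<omega> i = y i})
             (\<lambda>y. measure (BD_stat a b z) {x \<in> space (BD_stat a b z). \<forall>i\<in>{2..n}. x i = y i})
           \<le> sqrt (\<Sum>i=2..n. BD_Q a b i * z ^ i) *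
               (expect BD_states (pmf Pin) (\<lambda>c. inner_H a b z (\<lambda>i. real (c i)) (sqrt_Q a b z)) +
                norm_H a b z (BD_f a b z)) *
               exp (- lam * t)))"
proof -
  let ?Ein = "expect BD_states (pmf Pin) (\<lambda>c. inner_H a b z (\<lambda>i. real (c i)) (sqrt_Q a b z))"
  interpret BD_coeffs a b z using assms by unfold_locales auto
  have loc: "BD_asymp a b z zs" if "z \<noteq> zs" using assms that by unfold_locales auto
  have inner: "inner_H a b z (\<lambda>i. real (c i)) (sqrt_Q a b z) = load (\<lambda>k. 1 / sqrt (wt k)) c" if "c \<in> BD_states" for c
    by (rule inner_H_sqrt_Q[OF that])
  have "((\<lambda>c. inner_H a b z (\<lambda>i. real (c i)) (sqrt_Q a b z) * pmf Pin c) has_sum ?Ein) BD_states"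
    unfolding expect_def using assms(12) by (rule has_sum_infsum)
  then have E: "((\<lambda>x. pmf Pin x * load (\<lambda>k. 1 / sqrt (wt k)) x) has_sum ?Ein) BD_states"
    by (rule has_sum_cong[THEN iffD1, rotated]) (simp add: inner)
  have Eeq: "expect BD_states (BD_eq a b z) (\<lambda>c. inner_H a b z (\<lambda>i. real (c i)) (sqrt_Q a b z)) =
      expect BD_states (BD_eq a b z) (load (\<lambda>k. 1 / sqrt (wt k)))"
    unfolding expect_def by (intro infsum_cong) (simp add: inner)
  show ?thesis
    unfolding wt_def[symmetric] Eeq
  proof (intro conjI impI allI)
    fix t :: real assume "z < zs" "t \<ge> 0"
    then show "tv_dist BD_states (\<lambda>c. measure M {\<omega> \<in> space M. C t \<omega> = c}) (BD_eq a b z)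
           \<le> sqrt (\<Sum>\<^sub>\<infinity>i\<in>{2..}. wt i) * (?Ein + expect BD_states (BD_eq a b z) (load (\<lambda>k. 1 / sqrt (wt k)))) * exp (- lam * t)"
      using BD_asymp.subcritical_bound[OF loc assms(15) _ assms(13) assms(11) assms(14) E] by simp
  next
    fix t :: real and n :: nat assume "z > zs" "t \<ge> 0"
    then show "tv_dist (PiE {2..n} (\<lambda>_. UNIV))
             (\<lambda>y. measure M {\<omega> \<in> space M. \<forall>i\<in>{2..n}. C t \<omega> i = y i})
             (\<lambda>y. measure (BD_stat a b z) {x \<in> space (BD_stat a b z). \<forall>i\<in>{2..n}. x i = y i})
           \<le> sqrt (\<Sum>i=2..n. wt i) * (?Ein + norm_H a b z (BD_f a b z)) * exp (- lam * t)"
      using BD_asymp.supercritical_bound[OF loc assms(15) _ assms(13) assms(11) assms(14) E] by simp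
  qed
qed

end
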